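(* Let $\mathcal{R}$ be an RSM over an idempotent semiring of height $H$, and let $\mathcal{C}$ be an $\mathcal{R}$-automaton with $\kappa$ marks (all of whose transitions have weight $\overline1$, as the algorithm requires of its input). The algorithm $\mathtt{ConfDist}$ constructs, in $$O\bigl(H\cdot(|\mathcal{R}|\cdot\theta_e\cdot\kappa^2+|\mathit{Call}|\cdot\theta_e\cdot\theta_x\cdot\kappa^3)\bigr)$$ time, an $\mathcal{R}$-automaton $\mathcal{C}_{\mathit{post}^*}$ with $\kappa+1$ marks, such that $d(\mathcal{L}(\mathcal{C}),c)=\mathcal{C}_{\mathit{post}^*}(c)$ for every configuration $c$.
   Context: **Semirings.** An idempotent semiring $\langle D,\oplus,\otimes,\overline0,\overline1\rangle$: $\langle D,\oplus,\overline0\rangle$ is an idempotent commutative monoid, $\langle D,\otimes,\overline1\rangle$ is a monoid, $\otimes$ distributes over $\oplus$, and $\overline0$ annihilates under $\otimes$. Order: $a\sqsubseteq b\iff a\oplus b=a$. The height $H$ is the length of the longest descending chain in $\sqsubseteq$; all semirings are idempotent and of finite height. **RSMs.** A recursive state machine (RSM) over the semiring is a tuple $\mathcal{R}=\langle\mathcal{M}_1,\dots,\mathcal{M}_f\rangle$ of modules $\mathcal{M}_i=\langle B_i,Y_i,N_i,\delta_i,w_i\rangle$: a finite set $B_i$ of boxes; a map $Y_i:B_i\to\{1,\dots,f\}$; a finite set of nodes $N_i$ partitioned into internal nodes $\mathit{In}_i$, entry nodes $\mathit{En}_i$, exit nodes $\mathit{Ex}_i$, call nodes $\mathit{Call}_i=\{\langle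 b,e\rangle: b\in B_i,e\in \mathit{En}_{Y_i(b)}\}$ and return nodes $\mathit{Ret}_i=\{\langle b,x\rangle: b\in B_i,x\in\mathit{Ex}_{Y_i(b)}\}$; a transition relation $\delta_i\subseteq(\mathit{In}_i\cup\mathit{En}_i\cup\mathit{Ret}_i)\times(\mathit{In}_i\cup\mathit{Ex}_i\cup\mathit{Call}_i)$; weights $w_i:\delta_i\to D$ with $w_i(u,x)=\overline1$ for every exit node $x$. Unindexed $B,N,\mathit{In},\mathit{En},\mathit{Ex},\mathit{Call},\mathit{Ret}$ denote unions over all modules. $|\mathcal{R}|=\max(|N|,\sum_i|\delta_i|)$, $\theta_e=\max_i|\mathit{En}_i|$, $\theta_x=\max_i|\mathit{Ex}_i|$. **Configurations and computations.** A stack is a finite sequence of boxes $S=b_1\cdots b_r$ (top first; $\varepsilon$ is empty). A configuration is $\langle u,S\rangle$ with $u\in\mathit{In}\cup\mathit{En}\cup\mathit{Ret}$ such that, where $b_i\in B_{j_i}$, $Y_{j_i}(b_i)=j_{i-1}$ for $1<i\le r$ and $u\in N_{Y_{j_1}(b_1)}$ (if $r\geq1$). Steps: internal, $\langle u,S\rangle\Rightarrow\langle u',S\rangle$ for $(u,u')\in\delta_i$, $u'\in\mathit{In}_i$; call, $\langle u,S\rangle\Rightarrow\langle e,bS\rangle$ for $(u,\langle b,e\rangle)\in\delta_i$; return, $\langle u,bS\rangle\Rightarrow\langle\langle b,x\rangle,S\rangle$ for an RSM transition $(u,x)$ with $x$ an exit node of the module called by box $b$; each step carries the weight of the RSM transition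 used. A computation is a finite sequence of steps; its weight is the $\otimes$-product of its step weights in order (empty product $\overline1$). For a set $R$ of configurations, the configuration distance is $d(R,c)=\bigoplus\{\text{weight}(\pi):\pi\text{ a computation from some }c_0\in R\text{ to }c\}$ (empty combine $\overline 0$). **Configuration automata.** Let $\mathbb{M}$ be a countably infinite set of marks. An $\mathcal{R}$-automaton is $\mathcal{C}=\langle Q,B,\to,I,F,\ell\rangle$ with finite $Q\subseteq(\mathit{In}\cup\mathit{En}\cup\mathit{Ret})\times\mathbb{M}$, initial states $I\subseteq Q$, final states $F\subseteq Q\cap(\mathit{En}\times\mathbb{M})$, weights $\ell$ from transitions to $D$, and transitions of two forms: b-transitions $\langle e,m\rangle\xrightarrow{b}\langle e',m'\rangle$ with $b\in B_i$, $e\in\mathit{En}_{Y_i(b)}$, $e'\in\mathit{En}_i$; $\varepsilon$-transitions $\langle u,m\rangle\xrightarrow{\varepsilon}\langle e,m'\rangle$ with $e\in\mathit{En}_i$ and either $u\in\mathit{In}_i\cup\mathit{Ret}_i$ or $u=e$. Every state whose node is an entry is considered to have an $\varepsilon$-self-loop of weight $\overline1$. A run is a path of transitions $t_1,\dots,t_n$; its label is the concatenation of the labels and its weight is $\ell(t_n)\otimes\cdots\otimes\ell(t_1)$ (reversed order). It is accepting if it goes from $I$ to $F$. $\mathcal{C}(\langle u,S\rangle)$ is the combine of the weights of all accepting runs labeled $S$ that start in a state $\langle u,m\rangle$ for some $m$. $\mathcal{C}$ accepts $\langle u,S\rangle$ if there is such an accepting run of weight $\neq\overline0$; $\mathcal{L}(\mathcal{C})$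 is the set of accepted configurations. The number of marks of $\mathcal{C}$ is the number of distinct marks occurring in its states. **Algorithm $\mathtt{ConfDist}$.** Input: $\mathcal{R}$ and an $\mathcal{R}$-automaton $\mathcal{C}$ with all transition weights $\overline1$. *Preprocessing:* let $\hat m$ be a fresh mark not used in $\mathcal{C}$. (1) For every $u\in\mathit{In}\cup\mathit{En}\cup\mathit{Ret}$ add the state $\langle u,\hat m\rangle$ and make it initial. (2) For every initial state $\langle u,m\rangle$ and RSM transition $(u,\langle b,e\rangle)$, and every state $\langle e',m'\rangle$ with $e'$ an entry of the module of $u$, add $\langle e,\hat m\rangle\xrightarrow{b}\langle e',m'\rangle$ with weight $\overline0$. (3) For every state $\langle e,m\rangle$ with $e\in\mathit{En}_i$ and every $u\in\mathit{In}_i\cup\mathit{Ret}_i$ add $\langle u,\hat m\rangle\xrightarrow{\varepsilon}\langle e,m\rangle$ with weight $\overline0$. *Initialization:* the worklist $\mathsf{WL}$ contains all $\varepsilon$-transitions of weight $\overline1$ whose source is initial (the $\varepsilon$-self-loops count as transitions); $\mathsf{sum}(\langle e,m\rangle,x):=\overline0$ for all states $\langle e,m\rangle$ with entry node and all $x\in\mathit{Ex}$. $\mathtt{Relax}(t,v)$ means: if $\ell(t)\neq\ell(t)\oplus v$, set $\ell(t):=\ell(t)\oplus v$ and add $t$ to $\mathsf{WL}$. *Main loop:* while $\mathsf{WL}\ne\emptyset$, extract some $t$ from $\mathsf{WL}$. (A) If $t=\langle u,m_u\rangle\xrightarrow{\varepsilon}\langle e,m_e\rangle$ with $u$ in module $i$: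 (a) for each $(u,u')\in\delta_i$ with $u'\in\mathit{In}_i$, $\mathtt{Relax}(\langle u',\hat m\rangle\xrightarrow{\varepsilon}\langle e,m_e\rangle,\ \ell(t)\otimes w_i(u,u'))$; (b) for each $(u,\langle b,e'\rangle)\in\delta_i$, $\mathtt{Relax}(\langle e',\hat m\rangle\xrightarrow{b}\langle e,m_e\rangle,\ \ell(t)\otimes w_i(u,\langle b,e'\rangle))$, and add the self-loop $\langle e',\hat m\rangle\xrightarrow{\varepsilon}\langle e',\hat m\rangle$ to $\mathsf{WL}$ if it was never added before; (c) for each $(u,x)\in\delta_i$ with $x\in\mathit{Ex}_i$, if $\mathsf{sum}(\langle e,m_e\rangle,x)\not\sqsubseteq\ell(t)$, set $\mathsf{sum}(\langle e,m_e\rangle,x):=\mathsf{sum}(\langle e,m_e\rangle,x)\oplus\ell(t)$ and for each transition $\langle e,m_e\rangle\xrightarrow{b}\langle e',m'\rangle$ of current weight $v$ do $\mathtt{Relax}(\langle\langle b,x\rangle,\hat m\rangle\xrightarrow{\varepsilon}\langle e',m'\rangle,\ v\otimes\mathsf{sum}(\langle e,m_e\rangle,x))$. (B) If $t=\langle e,m_e\rangle\xrightarrow{b}\langle e',m'\rangle$: for each exit $x$ of the module of $e$, $\mathtt{Relax}(\langle\langle b,x\rangle,\hat m\rangle\xrightarrow{\varepsilon}\langle e',m'\rangle,\ \ell(t)\otimes\mathsf{sum}(\langle e,\hat m\rangle,x))$. The automaton upon termination is $\mathcal{C}_{\mathit{post}^*}$; its initial states are those of $\mathcal{C}$ plus all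 states with mark $\hat m$, its final states are those of $\mathcal{C}$. **Complexity convention.** Time is on the standard RAM; semiring operations take unit time.
   Formalization: The distance equality assumes no non-self-loop ε-transition leaves a state entered from another state (else it can fail); sum(⟨e,m⟩,x) is initialized only for exits x of e's module; the time bound assumes κ,θ_e≥1; the mark count assumes In∪En∪Ret is non-empty. *)

theory Defs
  imports Main
begin

section \<open>Idempotent semirings of finite height\<close>

text \<open>The carrier is the whole type; \<open>+\<close>, \<open>*\<close>, \<open>0\<close>, \<open>1\<close> are combine, extend and their units.
  Extend need not commute, and \<open>0 = 1\<close> is allowed.\<close>

class idem_semiring = semiring_0 + monoid_mult +
  assumes add_idem: "a + a = a"

definition sqle :: "'d::idem_semiring \<Rightarrow> 'd \<Rightarrow> bool"  (infix "\<sqsubseteq>" 50) where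
  "a \<sqsubseteq> b \<longleftrightarrow> a + b = a"

definition descending_chain :: "'d::idem_semiring list \<Rightarrow> bool" where
  "descending_chain xs \<longleftrightarrow> sorted_wrt (\<lambda>a b. b \<sqsubseteq> a \<and> b \<noteq> a) xs"

text \<open>The length of a chain is its number of elements, so the height is at least 1.\<close>

definition semiring_height :: "'d::idem_semiring itself \<Rightarrow> nat \<Rightarrow> bool" where
  "semiring_height _ H \<longleftrightarrow>
     (\<exists>xs::'d list. descending_chain xs \<and> length xs = H) \<and>
     (\<forall>xs::'d list. descending_chain xs \<longrightarrow> length xs \<le> H)"

text \<open>The combine of a possibly infinite set \<open>X\<close> is the combine of a finite subset of \<open>X\<close> that
  absorbs all of \<open>X\<close>. It exists whenever the height is finite, and it is unique.\<close>

definition is_combine :: "'d::idem_semiring set \<Rightarrow> 'd \<Rightarrow> bool" where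
  "is_combine X a \<longleftrightarrow> (\<exists>F. finite F \<and> F \<subseteq> X \<and> a = \<Sum>F \<and> (\<forall>x\<in>X. a \<sqsubseteq> x))"

definition Combine :: "'d::idem_semiring set \<Rightarrow> 'd" where
  "Combine X = (THE a. is_combine X a)"

lemma sqle_sum:
  assumes "\<And>x. x \<in> F \<Longrightarrow> a \<sqsubseteq> x" shows "a \<sqsubseteq> \<Sum>F"
  using assms
  by (induction F rule: infinite_finite_induct) (auto simp: sqle_def simp flip: add.assoc)

lemma sum_sqle:
  fixes F :: "'d::idem_semiring set"
  assumes "finite F" "x \<in> F" shows "\<Sum>F \<sqsubseteq> x"
proof -
  have "\<Sum>F = x + \<Sum>(F - {x})" using assms by (rule sum.remove)
  then show ?thesis
    unfolding sqle_def by (metis add.assoc add.commute add_idem)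
qed

lemma is_combine_unique: "is_combine X a \<Longrightarrow> is_combine X b \<Longrightarrow> a = b"
  unfolding is_combine_def by (metis add.commute sqle_def sqle_sum subset_iff)

lemma is_combine_exists:
  fixes X :: "'d::idem_semiring set"
  assumes "semiring_height TYPE('d) H"
  shows "\<exists>a. is_combine X a"
proof (rule ccontr)
  assume no: "\<nexists>a. is_combine X a"
  have "\<exists>F xs. finite F \<and> F \<subseteq> X \<and> descending_chain (xs @ [\<Sum>F]) \<and> length xs = n
          \<and> (\<forall>x\<in>set xs. \<Sum>F \<sqsubseteq> x)" for n
  proof (induction n)
    case 0
    show ?case by (rule exI[of _ "{}"], rule exI[of _ "[]"]) (simp add: descending_chain_def)
  next
    case (Suc n)
    then obtain F xs where F: "finite F" "F \<subseteq> X" "descending_chain (xs @ [\<Sum>F])"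
      "length xs = n" "\<forall>x\<in>set xs. \<Sum>F \<sqsubseteq> x" by blast
    from no F obtain x where x: "x \<in> X" "\<not> \<Sum>F \<sqsubseteq> x"
      unfolding is_combine_def by blast
    let ?F = "insert x F"
    have fx: "x \<notin> F" using x F sum_sqle by blast
    have e: "\<Sum>?F = x + \<Sum>F" using F fx by simp
    have le: "\<Sum>?F \<sqsubseteq> \<Sum>F" unfolding e sqle_def by (simp add: add.assoc add_idem)
    have ne: "\<Sum>?F \<noteq> \<Sum>F" using x e by (metis add.commute sqle_def)
    have tr: "\<Sum>?F \<sqsubseteq> y \<and> \<Sum>?F \<noteq> y" if "y \<in> set xs" for y
    proof -
      from that F have "\<Sum>F \<sqsubseteq> y" by blast
      then show ?thesis using le ne unfolding sqle_def by (metis add.assoc add.commute)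
    qed
    have "descending_chain ((xs @ [\<Sum>F]) @ [\<Sum>?F])"
      using F(3) tr le ne unfolding descending_chain_def by (auto simp: sorted_wrt_append)
    then show ?case
      using F x tr le by (intro exI[of _ ?F] exI[of _ "xs @ [\<Sum>F]"]) auto
  qed
  from this[of H] obtain F :: "'d set" and xs
    where "descending_chain (xs @ [\<Sum>F])" "length xs = H" by blast
  with assms show False unfolding semiring_height_def by fastforce
qed

lemma is_combine_Combine:
  fixes X :: "'d::idem_semiring set"
  assumes "semiring_height TYPE('d) H"
  shows "is_combine X (Combine X)"
  unfolding Combine_def
  using is_combine_exists[OF assms] is_combine_unique by (metis theI)


section \<open>Recursive state machines\<close>

text \<open>Internal, entry and exit nodes are \<open>Atom v\<close>; the call node of box \<open>b\<close> at entry \<open>e\<close>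
  is \<open>Port b e\<close> and its return node at exit \<open>x\<close> is \<open>Port b x\<close>. Modules are numbered from 0.\<close>

datatype ('b, 'v) node = Atom 'v | Port 'b 'v

record ('b, 'v, 'd) rmodule =
  boxes :: "'b set"
  callee :: "'b \<Rightarrow> nat"
  internals :: "'v set"
  entries :: "'v set"
  exits :: "'v set"
  delta :: "(('b, 'v) node \<times> ('b, 'v) node) set"
  weight :: "('b, 'v) node \<Rightarrow> ('b, 'v) node \<Rightarrow> 'd"

type_synonym ('b, 'v, 'd) rsm = "('b, 'v, 'd) rmodule list"

definition In_nodes :: "('b, 'v, 'd) rsm \<Rightarrow> nat \<Rightarrow> ('b, 'v) node set" where
  "In_nodes R i = Atom ` internals (R ! i)"

definition En_nodes :: "('b, 'v, 'd) rsm \<Rightarrow> nat \<Rightarrow> ('b, 'v) node set" where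
  "En_nodes R i = Atom ` entries (R ! i)"

definition Ex_nodes :: "('b, 'v, 'd) rsm \<Rightarrow> nat \<Rightarrow> ('b, 'v) node set" where
  "Ex_nodes R i = Atom ` exits (R ! i)"

definition Call_nodes :: "('b, 'v, 'd) rsm \<Rightarrow> nat \<Rightarrow> ('b, 'v) node set" where
  "Call_nodes R i = {Port b e | b e. b \<in> boxes (R ! i) \<and> e \<in> entries (R ! callee (R ! i) b)}"

definition Ret_nodes :: "('b, 'v, 'd) rsm \<Rightarrow> nat \<Rightarrow> ('b, 'v) node set" where
  "Ret_nodes R i = {Port b x | b x. b \<in> boxes (R ! i) \<and> x \<in> exits (R ! callee (R ! i) b)}"

definition nodes :: "('b, 'v, 'd) rsm \<Rightarrow> nat \<Rightarrow> ('b, 'v) node set" where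
  "nodes R i = In_nodes R i \<union> En_nodes R i \<union> Ex_nodes R i \<union> Call_nodes R i \<union> Ret_nodes R i"

text \<open>Sources of RSM transitions; these are also the nodes that occur in configurations.\<close>

definition src_nodes :: "('b, 'v, 'd) rsm \<Rightarrow> nat \<Rightarrow> ('b, 'v) node set" where
  "src_nodes R i = In_nodes R i \<union> En_nodes R i \<union> Ret_nodes R i"

definition all_of :: "(('b, 'v, 'd) rsm \<Rightarrow> nat \<Rightarrow> 'x set) \<Rightarrow> ('b, 'v, 'd) rsm \<Rightarrow> 'x set" where
  "all_of X R = (\<Union>i<length R. X R i)"

definition is_rsm :: "('b, 'v, 'd::idem_semiring) rsm \<Rightarrow> bool" where
  "is_rsm R \<longleftrightarrow>
     R \<noteq> [] \<and>
     (\<forall>i<length R.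
        finite (boxes (R ! i)) \<and>
        (\<forall>b\<in>boxes (R ! i). callee (R ! i) b < length R) \<and>
        finite (internals (R ! i)) \<and> finite (entries (R ! i)) \<and> finite (exits (R ! i)) \<and>
        internals (R ! i) \<inter> entries (R ! i) = {} \<and>
        internals (R ! i) \<inter> exits (R ! i) = {} \<and>
        entries (R ! i) \<inter> exits (R ! i) = {} \<and>
        delta (R ! i) \<subseteq> src_nodes R i \<times> (In_nodes R i \<union> Ex_nodes R i \<union> Call_nodes R i) \<and>
        (\<forall>(u, x)\<in>delta (R ! i). x \<in> Ex_nodes R i \<longrightarrow> weight (R ! i) u x = 1)) \<and>
     (\<forall>i<length R. \<forall>j<length R. i \<noteq> j \<longrightarrow>
        boxes (R ! i) \<inter> boxes (R ! j) = {} \<and> nodes R i \<inter> nodes R j = {})"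

definition rsm_size :: "('b, 'v, 'd) rsm \<Rightarrow> nat" where
  "rsm_size R = max (card (all_of nodes R)) (\<Sum>i<length R. card (delta (R ! i)))"

definition theta_e :: "('b, 'v, 'd) rsm \<Rightarrow> nat" where
  "theta_e R = Max ((\<lambda>i. card (En_nodes R i)) ` {..<length R})"

definition theta_x :: "('b, 'v, 'd) rsm \<Rightarrow> nat" where
  "theta_x R = Max ((\<lambda>i. card (Ex_nodes R i)) ` {..<length R})"


section \<open>Configurations and distances\<close>

type_synonym ('b, 'v) config = "('b, 'v) node \<times> 'b list"

definition is_config :: "('b, 'v, 'd) rsm \<Rightarrow> ('b, 'v) config \<Rightarrow> bool" where
  "is_config R = (\<lambda>(u, S). u \<in> all_of src_nodes R \<and>
     (\<exists>js. length js = length S \<and>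
        (\<forall>k<length S. js ! k < length R \<and> S ! k \<in> boxes (R ! (js ! k))) \<and>
        (\<forall>k. Suc k < length S \<longrightarrow> callee (R ! (js ! Suc k)) (S ! Suc k) = js ! k) \<and>
        (S \<noteq> [] \<longrightarrow> u \<in> nodes R (callee (R ! (js ! 0)) (S ! 0)))))"

inductive rsm_step ::
  "('b, 'v, 'd) rsm \<Rightarrow> ('b, 'v) config \<Rightarrow> 'd \<Rightarrow> ('b, 'v) config \<Rightarrow> bool" for R where
  internal_step: "\<lbrakk>i < length R; (u, u') \<in> delta (R ! i); u' \<in> In_nodes R i\<rbrakk>
    \<Longrightarrow> rsm_step R (u, S) (weight (R ! i) u u') (u', S)"
| call_step: "\<lbrakk>i < length R; (u, Port b e) \<in> delta (R ! i); Port b e \<in> Call_nodes R i\<rbrakk>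
    \<Longrightarrow> rsm_step R (u, S) (weight (R ! i) u (Port b e)) (Atom e, b # S)"
| return_step: "\<lbrakk>i < length R; (u, Atom x) \<in> delta (R ! i); Atom x \<in> Ex_nodes R i;
      j < length R; b \<in> boxes (R ! j); callee (R ! j) b = i\<rbrakk>
    \<Longrightarrow> rsm_step R (u, b # S) (weight (R ! i) u (Atom x)) (Port b x, S)"

text \<open>\<open>computation R c ws c'\<close>: some computation leads from \<open>c\<close> to \<open>c'\<close> with step weights \<open>ws\<close>.\<close>

inductive computation ::
  "('b, 'v, 'd) rsm \<Rightarrow> ('b, 'v) config \<Rightarrow> 'd list \<Rightarrow> ('b, 'v) config \<Rightarrow> bool" for R where
  comp_nil: "is_config R c \<Longrightarrow> computation R c [] c"
| comp_step: "\<lbrakk>computation R c ws c'; rsm_step R c' w c''\<rbrakk> \<Longrightarrow> computation R c (ws @ [w]) c''"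

definition config_dist ::
  "('b, 'v, 'd::idem_semiring) rsm \<Rightarrow> ('b, 'v) config set \<Rightarrow> ('b, 'v) config \<Rightarrow> 'd" where
  "config_dist R X c = Combine {prod_list ws | c0 ws. c0 \<in> X \<and> computation R c0 ws c}"


section \<open>Configuration automata\<close>

type_synonym ('b, 'v) state = "('b, 'v) node \<times> nat"
type_synonym ('b, 'v) edge = "('b, 'v) state \<times> 'b option \<times> ('b, 'v) state"

record ('b, 'v, 'd) raut =
  states :: "('b, 'v) state set"
  edges :: "('b, 'v) edge set"
  initial :: "('b, 'v) state set"
  final :: "('b, 'v) state set"
  wt :: "('b, 'v) edge \<Rightarrow> 'd"

definition b_edge_ok :: "('b, 'v, 'd) rsm \<Rightarrow> ('b, 'v) state \<Rightarrow> 'b \<Rightarrow> ('b, 'v) state \<Rightarrow> bool" where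
  "b_edge_ok R p b q \<longleftrightarrow> (\<exists>i<length R. b \<in> boxes (R ! i) \<and>
     fst p \<in> En_nodes R (callee (R ! i) b) \<and> fst q \<in> En_nodes R i)"

definition eps_edge_ok :: "('b, 'v, 'd) rsm \<Rightarrow> ('b, 'v) state \<Rightarrow> ('b, 'v) state \<Rightarrow> bool" where
  "eps_edge_ok R p q \<longleftrightarrow> (\<exists>i<length R. fst q \<in> En_nodes R i \<and>
     (fst p \<in> In_nodes R i \<union> Ret_nodes R i \<or> fst p = fst q))"

text \<open>The weight-1 self-loop that every entry state carries is a member of \<open>edges\<close>.\<close>

definition is_raut :: "('b, 'v, 'd) rsm \<Rightarrow> ('b, 'v, 'd::idem_semiring) raut \<Rightarrow> bool" where
  "is_raut R C \<longleftrightarrow>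
     finite (states C) \<and> states C \<subseteq> all_of src_nodes R \<times> UNIV \<and>
     initial C \<subseteq> states C \<and>
     final C \<subseteq> states C \<inter> (all_of En_nodes R \<times> UNIV) \<and>
     (\<forall>(p, a, q)\<in>edges C. p \<in> states C \<and> q \<in> states C \<and>
        (case a of Some b \<Rightarrow> b_edge_ok R p b q | None \<Rightarrow> eps_edge_ok R p q)) \<and>
     (\<forall>p\<in>states C. fst p \<in> all_of En_nodes R \<longrightarrow>
        (p, None, p) \<in> edges C \<and> wt C (p, None, p) = 1)"

fun is_run :: "('b, 'v, 'd) raut \<Rightarrow> ('b, 'v) state \<Rightarrow> ('b, 'v) edge list \<Rightarrow> ('b, 'v) state \<Rightarrow> bool"
where
  "is_run C p [] q \<longleftrightarrow> p \<in> states C \<and> p = q"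
| "is_run C p (t # ts) q \<longleftrightarrow> t \<in> edges C \<and> fst t = p \<and> is_run C (snd (snd t)) ts q"

definition run_label :: "('b, 'v) edge list \<Rightarrow> 'b list" where
  "run_label ts = concat (map (\<lambda>(p, a, q). case a of None \<Rightarrow> [] | Some b \<Rightarrow> [b]) ts)"

definition run_weight :: "('b, 'v, 'd::idem_semiring) raut \<Rightarrow> ('b, 'v) edge list \<Rightarrow> 'd" where
  "run_weight C ts = prod_list (rev (map (wt C) ts))"

definition accepting_run ::
  "('b, 'v, 'd) raut \<Rightarrow> ('b, 'v) config \<Rightarrow> ('b, 'v) edge list \<Rightarrow> bool" where
  "accepting_run C = (\<lambda>(u, S) ts.
     (\<exists>m q. (u, m) \<in> initial C \<and> q \<in> final C \<and> is_run C (u, m) ts q) \<and> run_label ts = S)"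

definition aut_value :: "('b, 'v, 'd::idem_semiring) raut \<Rightarrow> ('b, 'v) config \<Rightarrow> 'd" where
  "aut_value C c = Combine {run_weight C ts | ts. accepting_run C c ts}"

definition lang ::
  "('b, 'v, 'd) rsm \<Rightarrow> ('b, 'v, 'd::idem_semiring) raut \<Rightarrow> ('b, 'v) config set" where
  "lang R C = {c. is_config R c \<and> (\<exists>ts. accepting_run C c ts \<and> run_weight C ts \<noteq> 0)}"

definition marks :: "('b, 'v, 'd) raut \<Rightarrow> nat set" where
  "marks C = snd ` states C"

text \<open>An \<open>\<epsilon>\<close>-edge that is not a self-loop may only be preceded on a run by self-loops. Edges from
  internal and return nodes always comply, as nothing enters such a state; what is excluded is
  changing the mark at an entry node in the middle of a run. For such automata the algorithm below
  misses configurations: with \<open>(u,0) \<rightarrow>\<epsilon> (e,1) \<rightarrow>\<epsilon> (e,2) \<rightarrow>b (e',3)\<close>, only \<open>(u,0)\<close> initial, only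
  \<open>(e',3)\<close> final and the single RSM transition \<open>(u,x)\<close>, the configuration \<open>(Port b x, [])\<close> is reachable
  from the accepted \<open>(u,[b])\<close>, but the summary of \<open>x\<close> is recorded at \<open>(e,1)\<close> only, where no
  \<open>b\<close>-edge starts.\<close>

definition eps_edges_first :: "('b, 'v, 'd) raut \<Rightarrow> bool" where
  "eps_edges_first C \<longleftrightarrow> (\<forall>p a q q'. (q, None, q') \<in> edges C \<and> q \<noteq> q' \<and> (p, a, q) \<in> edges C
     \<longrightarrow> p = q \<and> a = None)"


section \<open>Nondeterministic programs with running time\<close>

text \<open>A command maps a store to its possible outcomes, each with the time spent. Assignments, tests,
  loop iterations and choices take one unit; each assignment and test used below performs a bounded
  number of table accesses and semiring operations. The sets traversed by \<open>foreach\<close> (adjacency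
  lists, nodes or entry states of a module, and the like) are available as lists on a RAM; they are
  traversed in an arbitrary order.\<close>

type_synonym 's cmd = "'s \<Rightarrow> ('s \<times> nat) set"

definition skip :: "'s cmd" where
  "skip s = {(s, 0)}"

definition assign :: "('s \<Rightarrow> 's) \<Rightarrow> 's cmd" where
  "assign f s = {(f s, 1)}"

definition seq :: "'s cmd \<Rightarrow> 's cmd \<Rightarrow> 's cmd"  (infixr ";;" 60) where
  "(c ;; d) s = {(s'', m + n) | s' s'' m n. (s', m) \<in> c s \<and> (s'', n) \<in> d s'}"

definition cond :: "('s \<Rightarrow> bool) \<Rightarrow> 's cmd \<Rightarrow> 's cmd \<Rightarrow> 's cmd" where
  "cond p c d s = {(s', Suc n) | s' n. (s', n) \<in> (if p s then c s else d s)}"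

definition pick :: "('s \<Rightarrow> 'x set) \<Rightarrow> ('x \<Rightarrow> 's cmd) \<Rightarrow> 's cmd" where
  "pick A c s = {(s', Suc n) | x s' n. x \<in> A s \<and> (s', n) \<in> c x s}"

primrec foreach_list :: "'x list \<Rightarrow> ('x \<Rightarrow> 's cmd) \<Rightarrow> 's cmd" where
  "foreach_list [] c = (\<lambda>s. {(s, 1)})"
| "foreach_list (x # xs) c =
     (\<lambda>s. {(s', Suc n) | s' n. (s', n) \<in> (c x ;; foreach_list xs c) s})"

definition foreach :: "('s \<Rightarrow> 'x set) \<Rightarrow> ('x \<Rightarrow> 's cmd) \<Rightarrow> 's cmd" where
  "foreach A c s = (\<Union>xs\<in>{xs. distinct xs \<and> set xs = A s}. foreach_list xs c s)"

text \<open>\<open>while_prefix p c s s' n\<close>: some iterations of the loop lead from \<open>s\<close> to \<open>s'\<close> in time \<open>n\<close>.\<close>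

inductive while_prefix :: "('s \<Rightarrow> bool) \<Rightarrow> 's cmd \<Rightarrow> 's \<Rightarrow> 's \<Rightarrow> nat \<Rightarrow> bool" for p c s where
  while_start: "while_prefix p c s s 0"
| while_iter: "\<lbrakk>while_prefix p c s s' n; p s'; (s'', k) \<in> c s'\<rbrakk>
    \<Longrightarrow> while_prefix p c s s'' (n + 1 + k)"

definition while :: "('s \<Rightarrow> bool) \<Rightarrow> 's cmd \<Rightarrow> 's cmd" where
  "while p c s = {(s', Suc n) | s' n. while_prefix p c s s' n \<and> \<not> p s'}"

definition while_diverges :: "('s \<Rightarrow> bool) \<Rightarrow> 's cmd \<Rightarrow> 's \<Rightarrow> bool" where
  "while_diverges p c s \<longleftrightarrow> (\<exists>f. f 0 = s \<and> (\<forall>k. p (f k) \<and> (\<exists>n. (f (Suc k), n) \<in> c (f k))))"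


section \<open>The algorithm\<close>

text \<open>\<open>seen\<close> holds the edges ever added to the worklist \<open>wl\<close>.\<close>

record ('b, 'v, 'd) store =
  aut :: "('b, 'v, 'd) raut"
  wl :: "('b, 'v) edge set"
  seen :: "('b, 'v) edge set"
  summ :: "('b, 'v) state \<Rightarrow> 'v \<Rightarrow> 'd"

definition module_of :: "('b, 'v, 'd) rsm \<Rightarrow> ('b, 'v) node \<Rightarrow> nat" where
  "module_of R u = (THE i. i < length R \<and> u \<in> nodes R i)"

definition succs :: "('b, 'v, 'd) rsm \<Rightarrow> ('b, 'v) node \<Rightarrow> ('b, 'v) node set" where
  "succs R u = {v. (u, v) \<in> delta (R ! module_of R u)}"

definition rweight :: "('b, 'v, 'd) rsm \<Rightarrow> ('b, 'v) node \<Rightarrow> ('b, 'v) node \<Rightarrow> 'd" where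
  "rweight R u v = weight (R ! module_of R u) u v"

definition add_state :: "('b, 'v) state \<Rightarrow> ('b, 'v, 'd) store cmd" where
  "add_state p = assign (\<lambda>s. s\<lparr>aut := (aut s)\<lparr>states := insert p (states (aut s)),
     initial := insert p (initial (aut s))\<rparr>\<rparr>)"

definition add_edge :: "('b, 'v) edge \<Rightarrow> 'd \<Rightarrow> ('b, 'v, 'd) store cmd" where
  "add_edge t v = assign (\<lambda>s. s\<lparr>aut := (aut s)\<lparr>edges := insert t (edges (aut s)),
     wt := (wt (aut s))(t := v)\<rparr>\<rparr>)"

definition enqueue :: "('b, 'v) edge \<Rightarrow> ('b, 'v, 'd) store cmd" where
  "enqueue t = assign (\<lambda>s. s\<lparr>wl := insert t (wl s), seen := insert t (seen s)\<rparr>)"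

definition relax ::
  "('b, 'v) edge \<Rightarrow> (('b, 'v, 'd) store \<Rightarrow> 'd) \<Rightarrow> ('b, 'v, 'd::idem_semiring) store cmd" where
  "relax t v = (\<lambda>s0. cond (\<lambda>s. wt (aut s) t \<noteq> wt (aut s) t + v s0)
     (assign (\<lambda>s. s\<lparr>aut := (aut s)\<lparr>wt := (wt (aut s))(t := wt (aut s) t + v s0)\<rparr>\<rparr>) ;; enqueue t)
     skip s0)"

definition preprocess ::
  "('b, 'v, 'd) rsm \<Rightarrow> nat \<Rightarrow> ('b, 'v, 'd::idem_semiring) store cmd" where
  "preprocess R mh =
     foreach (\<lambda>_. all_of src_nodes R) (\<lambda>u.
       add_state (u, mh) ;;
       cond (\<lambda>_. u \<in> all_of En_nodes R) (add_edge ((u, mh), None, (u, mh)) 1) skip) ;;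
     foreach (\<lambda>s. initial (aut s)) (\<lambda>(u, m).
       foreach (\<lambda>_. succs R u) (\<lambda>v. case v of
           Atom _ \<Rightarrow> skip
         | Port b e \<Rightarrow>
             foreach (\<lambda>s. {q \<in> states (aut s). fst q \<in> En_nodes R (module_of R u)}) (\<lambda>q.
               add_edge ((Atom e, mh), Some b, q) 0))) ;;
     foreach (\<lambda>s. {q \<in> states (aut s). fst q \<in> all_of En_nodes R}) (\<lambda>q.
       foreach (\<lambda>_. In_nodes R (module_of R (fst q)) \<union> Ret_nodes R (module_of R (fst q))) (\<lambda>u.
         add_edge ((u, mh), None, q) 0))"

text \<open>Only the entries \<open>summ q x\<close> with \<open>x\<close> an exit of the module of \<open>q\<close> are ever read, so only these
  are initialized; writing all of them would take time quadratic in the number of modules.\<close>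

definition initialize :: "('b, 'v, 'd) rsm \<Rightarrow> ('b, 'v, 'd::idem_semiring) store cmd" where
  "initialize R =
     foreach (\<lambda>s. initial (aut s)) (\<lambda>p.
       foreach (\<lambda>s. {t \<in> edges (aut s). fst t = p \<and> fst (snd t) = None}) (\<lambda>t.
         cond (\<lambda>s. wt (aut s) t = 1) (enqueue t) skip)) ;;
     foreach (\<lambda>s. {q \<in> states (aut s). fst q \<in> all_of En_nodes R}) (\<lambda>q.
       foreach (\<lambda>_. exits (R ! module_of R (fst q))) (\<lambda>x.
         assign (\<lambda>s. s\<lparr>summ := (summ s)(q := (summ s q)(x := 0))\<rparr>)))"

definition process_eps ::
  "('b, 'v, 'd) rsm \<Rightarrow> nat \<Rightarrow> ('b, 'v) state \<Rightarrow> ('b, 'v) state \<Rightarrow>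
   ('b, 'v, 'd::idem_semiring) store cmd" where
  "process_eps R mh p q = (let u = fst p; t = (p, None, q) in
     foreach (\<lambda>_. succs R u) (\<lambda>u'.
       cond (\<lambda>_. u' \<in> all_of In_nodes R)
         (relax ((u', mh), None, q) (\<lambda>s. wt (aut s) t * rweight R u u')) skip) ;;
     foreach (\<lambda>_. succs R u) (\<lambda>v. case v of
         Atom _ \<Rightarrow> skip
       | Port b e' \<Rightarrow>
           relax ((Atom e', mh), Some b, q) (\<lambda>s. wt (aut s) t * rweight R u v) ;;
           cond (\<lambda>s. ((Atom e', mh), None, (Atom e', mh)) \<notin> seen s)
             (enqueue ((Atom e', mh), None, (Atom e', mh))) skip) ;;
     foreach (\<lambda>_. succs R u) (\<lambda>v. case v of
         Port _ _ \<Rightarrow> skip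
       | Atom x \<Rightarrow>
           cond (\<lambda>s. v \<in> all_of Ex_nodes R \<and> \<not> summ s q x \<sqsubseteq> wt (aut s) t)
             (assign (\<lambda>s. s\<lparr>summ := (summ s)(q := (summ s q)(x := summ s q x + wt (aut s) t))\<rparr>) ;;
              foreach (\<lambda>s. {(b, q'). (q, Some b, q') \<in> edges (aut s)}) (\<lambda>(b, q').
                relax ((Port b x, mh), None, q') (\<lambda>s. wt (aut s) (q, Some b, q') * summ s q x)))
             skip))"

definition process_box ::
  "('b, 'v, 'd) rsm \<Rightarrow> nat \<Rightarrow> ('b, 'v) state \<Rightarrow> 'b \<Rightarrow> ('b, 'v) state \<Rightarrow>
   ('b, 'v, 'd::idem_semiring) store cmd" where
  "process_box R mh p b q =
     foreach (\<lambda>_. exits (R ! module_of R (fst p))) (\<lambda>x.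
       relax ((Port b x, mh), None, q)
         (\<lambda>s. wt (aut s) (p, Some b, q) * summ s (fst p, mh) x))"

definition iteration :: "('b, 'v, 'd) rsm \<Rightarrow> nat \<Rightarrow> ('b, 'v, 'd::idem_semiring) store cmd" where
  "iteration R mh = pick wl (\<lambda>t.
     assign (\<lambda>s. s\<lparr>wl := wl s - {t}\<rparr>) ;;
     (case t of (p, None, q) \<Rightarrow> process_eps R mh p q | (p, Some b, q) \<Rightarrow> process_box R mh p b q))"

definition conf_dist_setup ::
  "('b, 'v, 'd) rsm \<Rightarrow> nat \<Rightarrow> ('b, 'v, 'd::idem_semiring) store cmd" where
  "conf_dist_setup R mh = preprocess R mh ;; initialize R"

definition start_store :: "('b, 'v, 'd) raut \<Rightarrow> ('b, 'v, 'd) store" where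
  "start_store C = \<lparr>aut = C, wl = {}, seen = {}, summ = (\<lambda>_ _. undefined)\<rparr>"

text \<open>\<open>conf_dist R C mh P T\<close>: with fresh mark \<open>mh\<close>, some execution of the algorithm on \<open>R\<close> and \<open>C\<close>
  terminates after time \<open>T\<close> with the automaton \<open>P\<close>.\<close>

definition conf_dist ::
  "('b, 'v, 'd) rsm \<Rightarrow> ('b, 'v, 'd) raut \<Rightarrow> nat \<Rightarrow> ('b, 'v, 'd::idem_semiring) raut \<Rightarrow> nat \<Rightarrow> bool"
where
  "conf_dist R C mh P T \<longleftrightarrow>
     (\<exists>s. (s, T) \<in> (conf_dist_setup R mh ;; while (\<lambda>s. wl s \<noteq> {}) (iteration R mh)) (start_store C)
        \<and> P = aut s)"

definition conf_dist_diverges ::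
  "('b, 'v, 'd) rsm \<Rightarrow> ('b, 'v, 'd::idem_semiring) raut \<Rightarrow> nat \<Rightarrow> bool" where
  "conf_dist_diverges R C mh \<longleftrightarrow>
     (\<exists>(s, n)\<in>conf_dist_setup R mh (start_store C).
        while_diverges (\<lambda>s. wl s \<noteq> {}) (iteration R mh) s)"

text \<open>The constant of the time bound. It is a fixed numeral because an existentially quantified
  constant could depend on the type of the semiring, and hence on its height.\<close>

definition time_const :: nat where
  "time_const = 1000"

end

theory Submission
  imports Defs
begin

text \<open>A transition \<open>\<langle>u, mh\<rangle> \<rightarrow> q\<close> of the saturated automaton summarizes computations that never look below
  the part of the stack on which they start: from a fresh activation of the entry node of \<open>q\<close> if
  \<open>q\<close> carries the fresh mark, and otherwise from the configurations that \<open>C\<close> accepts through \<open>q\<close>.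
  Its weight is at all times a finite combine of weights of such computations, and since extend
  distributes over combine the same holds for the runs. Conversely, when the worklist is empty every
  transition has been processed with its final weight, so that a run for a configuration can be
  turned into a run for each of its successors whose weight absorbs the extended weight; this
  uses only runs consisting of one \<open>\<epsilon>\<close>-transition followed by \<open>b\<close>-transitions. For termination and
  the time bound, each transition and each summary pays its processing cost times the number of
  times it can still drop, which the height bounds.\<close>

section \<open>Idempotent semirings\<close>

text \<open>A combine of infinitely many weights exists only through a finite absorbing subset, and
  distributivity is available for finite combines alone. Soundness therefore does not bound weights
  by \<open>\<sqsubseteq>\<close>; it keeps each of them in \<open>finsums\<close> of a set of path
  weights, where the 0 of an edge not yet reached is the empty combine. The two directions meet in
  \<open>Combine_eqI\<close>.

  The obstacle to completeness is that the invariant must hold in the middle of an iteration, when a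
  weight or summary already used may drop again, even the weight of the transition being processed.
  \<open>closed X\<close> copes with this: each obligation holds, or its transition is on the
  worklist, or the pair is listed in \<open>X\<close> as pending. Box transitions of
  \<open>C\<close> keep weight 1 and are never queued; what they owe is renewed whenever a summary
  drops.

  A summary is combined only with the box transitions that leave the very state where it is stored.
  This is why runs are brought into a form in which the first box transition starts at the target of
  the only \<epsilon>-transition, and why \<open>eps_edges_first\<close> is assumed.\<close>

lemma sqle_refl [simp]: "(a::'d::idem_semiring) \<sqsubseteq> a"
  by (simp add: sqle_def add_idem)

lemma sqle_trans [trans]: "(a::'d::idem_semiring) \<sqsubseteq> b \<Longrightarrow> b \<sqsubseteq> c \<Longrightarrow> a \<sqsubseteq> c"
  unfolding sqle_def by (metis add.assoc)

lemma sqle_antisym: "(a::'d::idem_semiring) \<sqsubseteq> b \<Longrightarrow> b \<sqsubseteq> a \<Longrightarrow> a = b"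
  unfolding sqle_def by (metis add.commute)

lemma sqle_zero [simp]: "(a::'d::idem_semiring) \<sqsubseteq> 0"
  by (simp add: sqle_def)

lemma add_sqle_left [simp]: "(a::'d::idem_semiring) + b \<sqsubseteq> a"
  unfolding sqle_def by (metis add.assoc add.commute add_idem)

lemma add_sqle_right [simp]: "(a::'d::idem_semiring) + b \<sqsubseteq> b"
  unfolding sqle_def by (metis add.assoc add_idem)

lemma sqle_add: "(a::'d::idem_semiring) \<sqsubseteq> b \<Longrightarrow> a \<sqsubseteq> c \<Longrightarrow> a \<sqsubseteq> b + c"
  unfolding sqle_def by (metis add.assoc)

lemma mult_sqle_left: "(a::'d::idem_semiring) \<sqsubseteq> b \<Longrightarrow> c * a \<sqsubseteq> c * b"
  unfolding sqle_def by (metis distrib_left)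

lemma mult_sqle_right: "(a::'d::idem_semiring) \<sqsubseteq> b \<Longrightarrow> a * c \<sqsubseteq> b * c"
  unfolding sqle_def by (metis distrib_right)

lemma sqle_update_eq: "(a::'d::idem_semiring) = a + b \<longleftrightarrow> a \<sqsubseteq> b"
  by (auto simp: sqle_def)

section \<open>How often a weight can still drop\<close>

definition rank :: "'d::idem_semiring \<Rightarrow> nat" where
  "rank x = Max {length xs | xs. descending_chain (x # xs)}"

text \<open>\<open>Max\<close> in \<open>rank\<close> is meaningful: the chain \<open>[x]\<close>
  gives an element, and the height bounds all of them. The element \<open>x\<close> itself counts
  towards the height but not towards the length of the tail, hence the strict bound.\<close>

lemma rank_set:
  assumes "semiring_height TYPE('d::idem_semiring) H"
  shows "finite {length xs | xs. descending_chain ((x::'d) # xs)}" (is "finite ?L")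
    and "{length xs | xs. descending_chain (x # xs)} \<noteq> {}"
    and "\<And>n. n \<in> {length xs | xs. descending_chain (x # xs)} \<Longrightarrow> n < H"
proof -
  show bound: "\<And>n. n \<in> ?L \<Longrightarrow> n < H"
    using assms unfolding semiring_height_def by (force simp: less_eq_Suc_le)
  then have "?L \<subseteq> {..<H}" by blast
  then show "finite ?L" by (rule finite_subset) simp
  have "descending_chain [x]" by (simp add: descending_chain_def)
  then show "?L \<noteq> {}" by blast
qed

text \<open>The strictness leaves one unit below \<open>H\<close>; it pays for the presence of a
  transition on the worklist.\<close>

lemma rank_less_height:
  assumes "semiring_height TYPE('d::idem_semiring) H"
  shows "rank (x::'d) < H"
  unfolding rank_def using Max_in[OF rank_set(1,2)[OF assms, of x]] rank_set(3)[OF assms] by blast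

text \<open>A longest chain below \<open>y\<close> becomes a longer one below \<open>x\<close> by
  prepending \<open>y\<close>.\<close>

lemma rank_strict_mono:
  assumes "semiring_height TYPE('d::idem_semiring) H" "y \<sqsubseteq> x" "y \<noteq> (x::'d)"
  shows "rank y < rank x"
proof -
  have "rank y \<in> {length xs | xs. descending_chain (y # xs)}"
    unfolding rank_def using rank_set(1,2)[OF assms(1)] by (rule Max_in)
  then obtain xs where xs: "descending_chain (y # xs)" "length xs = rank y" by auto
  have "descending_chain (x # y # xs)"
    using xs(1) assms(2,3) unfolding descending_chain_def
    by (auto intro: sqle_trans dest: sqle_antisym)
  then have "length (y # xs) \<in> {length xs | xs. descending_chain (x # xs)}" by blast
  then have "length (y # xs) \<le> rank x"
    unfolding rank_def by (rule Max_ge[OF rank_set(1)[OF assms(1)]])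
  with xs(2) show ?thesis by simp
qed

text \<open>Finite combines in which summands may repeat; repetition is harmless because combine is
  idempotent. Adding one summand at a time suits products: different pairs of factors may have the
  same product, which sums over finite sets would have to account for.\<close>

inductive_set finsums :: "'d::idem_semiring set \<Rightarrow> 'd set" for X where
  finsums_zero: "0 \<in> finsums X"
| finsums_insert: "x \<in> X \<Longrightarrow> v \<in> finsums X \<Longrightarrow> x + v \<in> finsums X"

lemma finsums_incl: "x \<in> X \<Longrightarrow> x \<in> finsums X"
  using finsums_insert[OF _ finsums_zero] by fastforce

lemma finsums_add: "v \<in> finsums X \<Longrightarrow> w \<in> finsums X \<Longrightarrow> v + w \<in> finsums X"
  by (induction rule: finsums.induct) (auto simp: add.assoc intro: finsums.intros)

lemma finsums_mono: "v \<in> finsums X \<Longrightarrow> X \<subseteq> Y \<Longrightarrow> v \<in> finsums Y"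
  by (induction rule: finsums.induct) (auto intro: finsums.intros)

lemma finsums_mult_const:
  assumes "v \<in> finsums X" "\<And>x. x \<in> X \<Longrightarrow> x * c \<in> Z"
  shows "v * c \<in> finsums Z"
  using assms by (induction rule: finsums.induct) (auto simp: distrib_right intro: finsums.intros)

text \<open>Distributivity on both sides: induction on the right factor, with
  \<open>finsums_mult_const\<close> for the left one. The order of the factors is kept, as extend
  need not commute.\<close>

lemma finsums_mult:
  assumes "w \<in> finsums Y" "v \<in> finsums X" "\<And>x y. x \<in> X \<Longrightarrow> y \<in> Y \<Longrightarrow> x * y \<in> Z"
  shows "v * w \<in> finsums Z"
  using assms
proof (induction rule: finsums.induct)
  case (finsums_insert y w)
  then show ?case
    by (metis distrib_left finsums_add finsums_mult_const)
qed (simp add: finsums.finsums_zero)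

lemma sqle_finsums: "v \<in> finsums X \<Longrightarrow> (\<And>x. x \<in> X \<Longrightarrow> a \<sqsubseteq> x) \<Longrightarrow> a \<sqsubseteq> v"
  by (induction rule: finsums.induct) (auto intro: sqle_add)

text \<open>In the application \<open>A\<close> holds the weights of computations and
  \<open>B\<close> those of runs. The premises are asymmetric because each computation is absorbed
  by a single run, whereas one run stands for many computations at once.\<close>

lemma Combine_eqI:
  fixes A B :: "'d::idem_semiring set"
  assumes "semiring_height TYPE('d) H"
    and "\<And>x. x \<in> A \<Longrightarrow> \<exists>y\<in>B. y \<sqsubseteq> x"
    and "\<And>y. y \<in> B \<Longrightarrow> y \<in> finsums A"
  shows "Combine A = Combine B"
proof (rule sqle_antisym)
  have A: "is_combine A (Combine A)" and B: "is_combine B (Combine B)"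
    using is_combine_Combine[OF assms(1)] by auto
  have "Combine A \<sqsubseteq> y" if "y \<in> B" for y
    using sqle_finsums[OF assms(3)[OF that]] A unfolding is_combine_def by blast
  then show "Combine A \<sqsubseteq> Combine B"
    using B unfolding is_combine_def by (metis sqle_sum subsetD)
  have "Combine B \<sqsubseteq> x" if "x \<in> A" for x
    using assms(2)[OF that] B unfolding is_combine_def by (metis sqle_trans)
  then show "Combine B \<sqsubseteq> Combine A"
    using A unfolding is_combine_def by (metis sqle_sum subsetD)
qed


section \<open>Total correctness of timed programs\<close>

text \<open>Nonemptiness is what makes this total correctness: without it, a command with no
  outcome, such as a loop that never ends, would satisfy every postcondition.\<close>

definition spec :: "'s cmd \<Rightarrow> 's \<Rightarrow> ('s \<Rightarrow> nat \<Rightarrow> bool) \<Rightarrow> bool" where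
  "spec c s Q \<longleftrightarrow> c s \<noteq> {} \<and> (\<forall>(s', n)\<in>c s. Q s' n)"

lemma spec_mono: "spec c s Q \<Longrightarrow> (\<And>s' n. Q s' n \<Longrightarrow> Q' s' n) \<Longrightarrow> spec c s Q'"
  unfolding spec_def by blast

lemma spec_skip: "Q s 0 \<Longrightarrow> spec skip s Q"
  by (simp add: spec_def skip_def)

lemma spec_assign: "Q (f s) 1 \<Longrightarrow> spec (assign f) s Q"
  by (simp add: spec_def assign_def)

lemma spec_seq: "spec c s (\<lambda>s' m. spec d s' (\<lambda>s'' n. Q s'' (m + n))) \<Longrightarrow> spec (c ;; d) s Q"
  unfolding spec_def seq_def by fastforce

lemma spec_cond:
  "(p s \<Longrightarrow> spec c s (\<lambda>s' n. Q s' (Suc n))) \<Longrightarrow> (\<not> p s \<Longrightarrow> spec d s (\<lambda>s' n. Q s' (Suc n))) \<Longrightarrow>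
   spec (cond p c d) s Q"
  unfolding spec_def cond_def by (cases "p s") fastforce+

lemma spec_pick:
  "A s \<noteq> {} \<Longrightarrow> (\<And>x. x \<in> A s \<Longrightarrow> spec (c x) s (\<lambda>s' n. Q s' (Suc n))) \<Longrightarrow> spec (pick A c) s Q"
  unfolding spec_def pick_def by fastforce

text \<open>The invariant is indexed by the set of visited elements, since the order of traversal is
  arbitrary. The unit charged for the empty list is not counted by \<open>J\<close>, hence
  \<open>n - 1\<close>; the conjunct \<open>n > 0\<close> keeps the truncated subtraction
  exact.\<close>

lemma spec_foreach_list:
  assumes "distinct xs" "set xs \<inter> D = {}" "J D s k"
    and "\<And>x D s n. x \<in> set xs \<Longrightarrow> x \<notin> D \<Longrightarrow> J D s n \<Longrightarrow>
      spec (c x) s (\<lambda>s' m. J (insert x D) s' (n + m + 1))"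
  shows "spec (foreach_list xs c) s (\<lambda>s' n. n > 0 \<and> J (D \<union> set xs) s' (k + n - 1))"
  using assms
proof (induction xs arbitrary: D s k)
  case Nil
  then show ?case by (simp add: spec_def)
next
  case (Cons x xs)
  have "spec (c x) s (\<lambda>s' m. J (insert x D) s' (k + m + 1))"
    using Cons.prems by simp
  then have "spec (c x) s (\<lambda>s' m. spec (foreach_list xs c) s'
      (\<lambda>s'' n. n > 0 \<and> J (insert x D \<union> set xs) s'' (k + m + 1 + n - 1)))"
    by (rule spec_mono) (rule Cons.IH, use Cons.prems in auto)
  then have "spec (c x ;; foreach_list xs c) s (\<lambda>s'' n. J (insert x D \<union> set xs) s'' (k + n))"
    by (intro spec_seq) (elim spec_mono, auto simp: add.assoc)
  then show ?case
    unfolding spec_def foreach_list.simps by fastforce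
qed

lemma spec_foreach:
  assumes "finite (A s)" "J {} s 0"
    and "\<And>x D s' n. x \<in> A s \<Longrightarrow> D \<subseteq> A s \<Longrightarrow> x \<notin> D \<Longrightarrow> J D s' n \<Longrightarrow>
      spec (c x) s' (\<lambda>s'' m. J (insert x D) s'' (n + m + 1))"
    and "\<And>s' n. J (A s) s' n \<Longrightarrow> Q s' (n + 1)"
  shows "spec (foreach A c) s Q"
proof -
  have list: "spec (foreach_list xs c) s Q" if xs: "distinct xs" "set xs = A s" for xs
  proof -
    have "spec (foreach_list xs c) s
        (\<lambda>s' n. n > 0 \<and> ({} \<union> set xs \<subseteq> A s \<and> J ({} \<union> set xs) s' (0 + n - 1)))"
    proof (rule spec_foreach_list[where J = "\<lambda>D s' n. D \<subseteq> A s \<and> J D s' n"])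
      fix x D s' n assume "x \<in> set xs" "x \<notin> D" "D \<subseteq> A s \<and> J D s' n"
      then show "spec (c x) s' (\<lambda>s'' m. insert x D \<subseteq> A s \<and> J (insert x D) s'' (n + m + 1))"
        using assms(3)[of x D s' n] xs by simp
    qed (use xs assms(2) in auto)
    then show ?thesis
      by (rule spec_mono) (use assms(4) xs in force)
  qed
  obtain xs where "distinct xs" "set xs = A s"
    using finite_distinct_list[OF assms(1)] by blast
  then have "foreach A c s \<noteq> {}"
    using list[of xs] by (auto simp: spec_def foreach_def)
  then show ?thesis
    using list by (auto simp: spec_def foreach_def)
qed

text \<open>For loops whose effect does not depend on the order: the store is a function
  \<open>g\<close> of the set of visited elements, so the outcome is determined and only the time
  needs a bound per element.\<close>

lemma spec_foreach_state:
  assumes "finite (A (g {}))"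
    and "\<And>x D. x \<in> A (g {}) \<Longrightarrow> D \<subseteq> A (g {}) \<Longrightarrow> x \<notin> D \<Longrightarrow>
      spec (c x) (g D) (\<lambda>s' n. s' = g (insert x D) \<and> n \<le> f x)"
  shows "spec (foreach A c) (g {}) (\<lambda>s' n. s' = g (A (g {})) \<and> n \<le> 1 + (\<Sum>x\<in>A (g {}). 1 + f x))"
proof (rule spec_foreach[where J = "\<lambda>D s' n. s' = g D \<and> n \<le> (\<Sum>x\<in>D. 1 + f x)"])
  fix x D s' n
  assume x: "x \<in> A (g {})" "D \<subseteq> A (g {})" "x \<notin> D" "s' = g D \<and> n \<le> (\<Sum>x\<in>D. 1 + f x)"
  then have "finite D" using assms(1) finite_subset by blast
  then show "spec (c x) s' (\<lambda>s'' m. s'' = g (insert x D) \<and> n + m + 1 \<le> (\<Sum>x\<in>insert x D. 1 + f x))"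
    using assms(2)[OF x(1-3)] x(3,4) by (auto elim!: spec_mono)
qed (use assms(1) in auto)

text \<open>Since the potential prepays every iteration, it bounds the time; since it is a natural
  number that drops, it also yields a terminating execution and excludes infinite ones. The extra
  unit is the failing test that leaves the loop.\<close>

lemma while_total:
  assumes "I s"
    and step: "\<And>s. I s \<Longrightarrow> p s \<Longrightarrow> spec c s (\<lambda>s' n. I s' \<and> \<Phi> s' + n + 1 \<le> (\<Phi> s :: nat))"
  shows "spec (while p c) s (\<lambda>s' n. I s' \<and> \<not> p s' \<and> n \<le> \<Phi> s + 1)"
    and "\<not> while_diverges p c s"
proof -
  have prefix: "I s' \<and> \<Phi> s' + n \<le> \<Phi> s" if "while_prefix p c s s' n" for s' n
    using that
  proof (induction rule: while_prefix.induct)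
    case (while_iter s' n s'' k)
    then show ?case using step[of s'] unfolding spec_def by fastforce
  qed (simp add: assms(1))
  have "\<exists>s'' k. while_prefix p c s s'' k \<and> \<not> p s''" if "while_prefix p c s s' n" for s' n
    using that
  proof (induction "\<Phi> s'" arbitrary: s' n rule: less_induct)
    case less
    show ?case
    proof (cases "p s'")
      case True
      have "I s'" using less.prems prefix by blast
      with True step have "spec c s' (\<lambda>s'' k. I s'' \<and> \<Phi> s'' + k + 1 \<le> \<Phi> s')" by blast
      then obtain s'' k where s'': "(s'', k) \<in> c s'" "\<Phi> s'' + k + 1 \<le> \<Phi> s'"
        unfolding spec_def by fastforce
      have "while_prefix p c s s'' (n + 1 + k)"
        using less.prems True s''(1) by (rule while_iter)
      moreover have "\<Phi> s'' < \<Phi> s'" using s''(2) by simp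
      ultimately show ?thesis using less.hyps by blast
    qed (use less.prems in blast)
  qed
  then have "while p c s \<noteq> {}"
    unfolding while_def using while_start[of p c s] by fastforce
  then show "spec (while p c) s (\<lambda>s' n. I s' \<and> \<not> p s' \<and> n \<le> \<Phi> s + 1)"
    using prefix unfolding spec_def while_def by fastforce
  show "\<not> while_diverges p c s"
  proof
    assume "while_diverges p c s"
    then obtain f where f: "f 0 = s" "\<And>k. p (f k)" "\<And>k. \<exists>n. (f (Suc k), n) \<in> c (f k)"
      unfolding while_diverges_def by blast
    have "I (f k) \<and> \<Phi> (f k) + k \<le> \<Phi> s" for k
    proof (induction k)
      case (Suc k)
      with f step[of "f k"] show ?case unfolding spec_def by fastforce
    qed (use f assms(1) in simp)
    from this[of "Suc (\<Phi> s)"] show False by simp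
  qed
qed


section \<open>Recursive state machines\<close>

lemma node_subsets:
  "In_nodes R i \<subseteq> nodes R i" "En_nodes R i \<subseteq> nodes R i" "Ex_nodes R i \<subseteq> nodes R i"
  "Call_nodes R i \<subseteq> nodes R i" "Ret_nodes R i \<subseteq> nodes R i" "src_nodes R i \<subseteq> nodes R i"
  "In_nodes R i \<subseteq> src_nodes R i" "En_nodes R i \<subseteq> src_nodes R i" "Ret_nodes R i \<subseteq> src_nodes R i"
  by (auto simp: nodes_def src_nodes_def)

lemma all_of_mono: "(\<And>i. X R i \<subseteq> Y R i) \<Longrightarrow> all_of X R \<subseteq> all_of Y R"
  unfolding all_of_def by blast

lemma Atom_not_Call_Ret [simp]:
  "Atom v \<notin> Call_nodes R i" "Atom v \<notin> Ret_nodes R i"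
  by (auto simp: Call_nodes_def Ret_nodes_def)

lemma Port_not_Atoms [simp]:
  "Port b v \<notin> In_nodes R i" "Port b v \<notin> En_nodes R i" "Port b v \<notin> Ex_nodes R i"
  by (auto simp: In_nodes_def En_nodes_def Ex_nodes_def)

locale rsm =
  fixes R :: "('b, 'v, 'd::idem_semiring) rsm"
  assumes is_rsm: "is_rsm R"
begin

lemma nodes_inj:
  "u \<in> nodes R i \<Longrightarrow> u \<in> nodes R j \<Longrightarrow> i < length R \<Longrightarrow> j < length R \<Longrightarrow> i = j"
  using is_rsm unfolding is_rsm_def by blast

lemma callee_less: "b \<in> boxes (R ! i) \<Longrightarrow> i < length R \<Longrightarrow> callee (R ! i) b < length R"
  using is_rsm unfolding is_rsm_def by blast

lemma module_of_eq: "u \<in> nodes R i \<Longrightarrow> i < length R \<Longrightarrow> module_of R u = i"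
  unfolding module_of_def by (rule the_equality) (auto intro: nodes_inj)

lemma module_of_src:
  assumes "u \<in> all_of src_nodes R"
  shows "module_of R u < length R" "u \<in> src_nodes R (module_of R u)"
  using assms module_of_eq node_subsets(6) unfolding all_of_def by force+

lemma module_of_En:
  assumes "u \<in> all_of En_nodes R"
  shows "module_of R u < length R" "u \<in> En_nodes R (module_of R u)"
  using assms module_of_eq node_subsets(2) unfolding all_of_def by force+

lemma En_subset_src: "all_of En_nodes R \<subseteq> all_of src_nodes R"
  by (rule all_of_mono) (rule node_subsets)

lemma src_subset_nodes: "all_of src_nodes R \<subseteq> all_of nodes R"
  by (rule all_of_mono) (rule node_subsets)

lemma delta_subset:
  "i < length R \<Longrightarrow> delta (R ! i) \<subseteq> src_nodes R i \<times> (In_nodes R i \<union> Ex_nodes R i \<union> Call_nodes R i)"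
  using is_rsm unfolding is_rsm_def by blast

lemma delta_src: "(u, v) \<in> delta (R ! i) \<Longrightarrow> i < length R \<Longrightarrow> u \<in> src_nodes R i \<and> module_of R u = i"
  using delta_subset[of i] module_of_eq node_subsets(6) by blast

lemma succs_iff:
  "u \<in> src_nodes R i \<Longrightarrow> i < length R \<Longrightarrow> v \<in> succs R u \<longleftrightarrow> (u, v) \<in> delta (R ! i)"
  using module_of_eq[of u i] node_subsets(6) unfolding succs_def by blast

lemma rweight_eq: "(u, v) \<in> delta (R ! i) \<Longrightarrow> i < length R \<Longrightarrow> rweight R u v = weight (R ! i) u v"
  using delta_src unfolding rweight_def by blast

lemma succs_src:
  assumes "u \<in> all_of src_nodes R" "v \<in> succs R u"
  obtains i where "i < length R" "module_of R u = i" "u \<in> src_nodes R i" "(u, v) \<in> delta (R ! i)"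
    "v \<in> In_nodes R i \<union> Ex_nodes R i \<union> Call_nodes R i"
  using module_of_src[OF assms(1)] assms(2) delta_subset unfolding succs_def by blast

lemma finite_boxes: "i < length R \<Longrightarrow> finite (boxes (R ! i))"
  using is_rsm unfolding is_rsm_def by blast

lemma finite_exits: "i < length R \<Longrightarrow> finite (exits (R ! i))"
  using is_rsm unfolding is_rsm_def by blast

lemma finite_nodes:
  assumes "i < length R"
  shows "finite (nodes R i)"
proof -
  have fin: "finite (internals (R ! j)) \<and> finite (entries (R ! j)) \<and> finite (exits (R ! j))"
    if "j < length R" for j using is_rsm that unfolding is_rsm_def by blast
  have "Call_nodes R i = (\<Union>b\<in>boxes (R ! i). Port b ` entries (R ! callee (R ! i) b))"
    "Ret_nodes R i = (\<Union>b\<in>boxes (R ! i). Port b ` exits (R ! callee (R ! i) b))"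
    unfolding Call_nodes_def Ret_nodes_def by blast+
  then show ?thesis
    using fin assms finite_boxes callee_less
    by (auto simp: nodes_def In_nodes_def En_nodes_def Ex_nodes_def)
qed

lemma finite_all_of:
  "(\<And>i. X R i \<subseteq> nodes R i) \<Longrightarrow> finite (all_of X R)"
  unfolding all_of_def using finite_nodes finite_subset by blast

lemma finite_src: "finite (all_of src_nodes R)" and finite_En: "finite (all_of En_nodes R)"
  by (rule finite_all_of, rule node_subsets)+

lemma finite_delta: "i < length R \<Longrightarrow> finite (delta (R ! i))"
proof (rule finite_subset)
  assume i: "i < length R"
  show "delta (R ! i) \<subseteq> nodes R i \<times> nodes R i"
    using delta_subset[OF i] node_subsets[of R i] by blast
  show "finite (nodes R i \<times> nodes R i)" using finite_nodes[OF i] by simp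
qed

lemma finite_succs: "u \<in> all_of src_nodes R \<Longrightarrow> finite (succs R u)"
  using finite_delta[OF module_of_src(1), of u]
  by (rule finite_surj[where f = snd]) (auto simp: succs_def intro: rev_image_eqI)

text \<open>Modules are disjoint, internals and entries of one module are disjoint, and a return
  node is a \<open>Port\<close> while an entry is an \<open>Atom\<close>. Hence an \<epsilon>-edge
  from an internal or return node is never a self-loop, whose weight has to stay 1.\<close>

lemma En_not_In_Ret: "u \<in> En_nodes R i \<Longrightarrow> i < length R \<Longrightarrow> j < length R \<Longrightarrow>
    u \<notin> In_nodes R j \<union> Ret_nodes R j"
proof
  assume u: "u \<in> En_nodes R i" "i < length R" "j < length R" "u \<in> In_nodes R j \<union> Ret_nodes R j"
  then have "i = j" using nodes_inj node_subsets[of R] by blast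
  moreover have "internals (R ! i) \<inter> entries (R ! i) = {}"
    using is_rsm u(2) unfolding is_rsm_def by blast
  ultimately show False
    using u by (auto simp: En_nodes_def In_nodes_def Ret_nodes_def)
qed

lemma In_not_Ex: "u \<in> In_nodes R i \<Longrightarrow> i < length R \<Longrightarrow> j < length R \<Longrightarrow> u \<notin> Ex_nodes R j"
proof
  assume u: "u \<in> In_nodes R i" "i < length R" "j < length R" "u \<in> Ex_nodes R j"
  then have "i = j" using nodes_inj node_subsets[of R] by blast
  moreover have "internals (R ! i) \<inter> exits (R ! i) = {}"
    using is_rsm u(2) unfolding is_rsm_def by blast
  ultimately show False
    using u by (auto simp: Ex_nodes_def In_nodes_def)
qed

lemma exit_weight:
  "(u, v) \<in> delta (R ! i) \<Longrightarrow> i < length R \<Longrightarrow> v \<in> Ex_nodes R i \<Longrightarrow> weight (R ! i) u v = 1"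
  using is_rsm unfolding is_rsm_def by blast

lemma card_exits_le:
  assumes "i < length R"
  shows "card (exits (R ! i)) \<le> theta_x R"
proof -
  have "card (exits (R ! i)) = card (Ex_nodes R i)"
    unfolding Ex_nodes_def by (rule card_image[symmetric]) (simp add: inj_on_def)
  also have "\<dots> \<le> theta_x R"
    unfolding theta_x_def using assms by (intro Max_ge) auto
  finally show ?thesis .
qed

end

text \<open>Unlike \<open>computation\<close>, this does not ask the start to be a configuration, so
  that fragments on a cut-off stack can be composed and moved onto other stacks. The product
  replaces the list of weights.\<close>

inductive path ::
  "('b, 'v, 'd::idem_semiring) rsm \<Rightarrow> ('b, 'v) config \<Rightarrow> 'd \<Rightarrow> ('b, 'v) config \<Rightarrow> bool" for R where
  path_refl: "path R c 1 c"
| path_step: "path R c w c' \<Longrightarrow> rsm_step R c' v c'' \<Longrightarrow> path R c (w * v) c''"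

lemma path_trans: "path R c' v c'' \<Longrightarrow> path R c w c' \<Longrightarrow> path R c (w * v) c''"
  by (induction rule: path.induct) (auto intro: path.intros simp flip: mult.assoc)

lemma rsm_step_append: "rsm_step R (u, S) w (v, T) \<Longrightarrow> rsm_step R (u, S @ A) w (v, T @ A)"
  by (induction "(u, S)" w "(v, T)" rule: rsm_step.induct) (auto intro: rsm_step.intros)

text \<open>A step looks at the top of the stack only, so any stack can be put underneath.\<close>

lemma path_append: "path R (u, S) w (v, T) \<Longrightarrow> path R (u, S @ A) w (v, T @ A)"
  by (induction "(u, S)" w "(v, T)" arbitrary: v T rule: path.induct)
    (auto intro: path.intros rsm_step_append)

text \<open>\<open>computation\<close> checks well-formedness only where it starts, so a path needs
  it there and nowhere else.\<close>

lemma path_computation: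
  "path R c w c' \<Longrightarrow> is_config R c \<Longrightarrow> \<exists>ws. computation R c ws c' \<and> prod_list ws = w"
  by (induction rule: path.induct) (force intro: computation.intros)+

text \<open>The stack constrains the node only through the module called by its top box, and
  disjointness identifies that module with \<open>i\<close>.\<close>

lemma is_config_same_module:
  assumes "is_rsm R" "is_config R (v, S)" "i < length R" "v \<in> nodes R i" "u \<in> src_nodes R i"
  shows "is_config R (u, S)"
proof -
  interpret rsm R by unfold_locales fact
  obtain js where js: "length js = length S"
    "\<forall>k<length S. js ! k < length R \<and> S ! k \<in> boxes (R ! (js ! k))"
    "\<forall>k. Suc k < length S \<longrightarrow> callee (R ! (js ! Suc k)) (S ! Suc k) = js ! k"
    "S \<noteq> [] \<longrightarrow> v \<in> nodes R (callee (R ! (js ! 0)) (S ! 0))"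
    using assms(2) unfolding is_config_def by blast
  have "u \<in> nodes R (callee (R ! (js ! 0)) (S ! 0))" if "S \<noteq> []"
    using that js nodes_inj[of v i "callee (R ! (js ! 0)) (S ! 0)"] callee_less assms(3-5)
      node_subsets(6) by (metis length_greater_0_conv subsetD)
  then show ?thesis
    using js assms unfolding is_config_def all_of_def by blast
qed

lemma is_config_push:
  assumes "is_rsm R" "is_config R (v, S)" "i < length R" "v \<in> nodes R i" "b \<in> boxes (R ! i)"
    "u \<in> src_nodes R (callee (R ! i) b)"
  shows "is_config R (u, b # S)"
proof -
  interpret rsm R by unfold_locales fact
  obtain js where js: "length js = length S"
    "\<forall>k<length S. js ! k < length R \<and> S ! k \<in> boxes (R ! (js ! k))"
    "\<forall>k. Suc k < length S \<longrightarrow> callee (R ! (js ! Suc k)) (S ! Suc k) = js ! k"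
    "S \<noteq> [] \<longrightarrow> v \<in> nodes R (callee (R ! (js ! 0)) (S ! 0))"
    using assms(2) unfolding is_config_def by blast
  have top: "callee (R ! (js ! 0)) (S ! 0) = i" if "S \<noteq> []"
    using that js nodes_inj[of v i "callee (R ! (js ! 0)) (S ! 0)"] callee_less assms(3,4)
    by (metis length_greater_0_conv)
  have callee: "callee (R ! i) b < length R" using callee_less assms(3,5) by blast
  \<comment> \<open>\<open>js\<close> lists the modules that own the boxes, top first, so the new
    box contributes its own module in front.\<close>
  let ?js = "i # js"
  have "length ?js = length (b # S)" using js by simp
  moreover have "\<forall>k<length (b # S). ?js ! k < length R \<and> (b # S) ! k \<in> boxes (R ! (?js ! k))"
    using js(2) assms(3,5) by (auto simp: nth_Cons split: nat.split)
  moreover have "\<forall>k. Suc k < length (b # S) \<longrightarrow>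
      callee (R ! (?js ! Suc k)) ((b # S) ! Suc k) = ?js ! k"
    using js(3) top by (auto simp: nth_Cons split: nat.split)
  moreover have "u \<in> nodes R (callee (R ! (?js ! 0)) ((b # S) ! 0))"
    using assms(6) node_subsets(6) by auto
  moreover have "u \<in> all_of src_nodes R"
    using assms(6) callee unfolding all_of_def by blast
  ultimately show ?thesis
    unfolding is_config_def prod.case by blast
qed


section \<open>Configuration automata\<close>

lemma run_label_simps [simp]:
  "run_label [] = []"
  "run_label ((p, None, q) # ts) = run_label ts"
  "run_label ((p, Some b, q) # ts) = b # run_label ts"
  "run_label (ts @ ts') = run_label ts @ run_label ts'"
  by (simp_all add: run_label_def)

lemma run_weight_simps [simp]:
  "run_weight A [] = 1"
  "run_weight A (t # ts) = run_weight A ts * wt A t"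
  by (simp_all add: run_weight_def)

lemma is_run_append: "is_run A p ts q \<Longrightarrow> is_run A q ts' r \<Longrightarrow> is_run A p (ts @ ts') r"
  by (induction ts arbitrary: p) auto

lemma is_run_snoc:
  "is_run A p ts q \<Longrightarrow> (q, a, r) \<in> edges A \<Longrightarrow> r \<in> states A \<Longrightarrow> is_run A p (ts @ [(q, a, r)]) r"
  by (auto intro: is_run_append)

lemma run_edges: "is_run A p ts q \<Longrightarrow> set ts \<subseteq> edges A"
  by (induction ts arbitrary: p) (simp, metis insert_subset is_run.simps(2) list.set(2))

locale raut_rsm = rsm R for R :: "('b, 'v, 'd::idem_semiring) rsm" +
  fixes C :: "('b, 'v, 'd) raut"
  assumes is_raut: "is_raut R C"
begin

lemma edge_ok:
  assumes "(p, a, q) \<in> edges C"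
  shows "p \<in> states C \<and> q \<in> states C \<and>
    (case a of Some b \<Rightarrow> b_edge_ok R p b q | None \<Rightarrow> eps_edge_ok R p q)"
proof -
  have "\<forall>(p, a, q)\<in>edges C. p \<in> states C \<and> q \<in> states C \<and>
      (case a of Some b \<Rightarrow> b_edge_ok R p b q | None \<Rightarrow> eps_edge_ok R p q)"
    using is_raut unfolding is_raut_def by (elim conjE)
  from bspec[OF this assms] show ?thesis by (simp only: prod.case)
qed

lemma edge_states: "(p, a, q) \<in> edges C \<Longrightarrow> p \<in> states C \<and> q \<in> states C"
  using edge_ok by blast

lemma state_src: "p \<in> states C \<Longrightarrow> fst p \<in> all_of src_nodes R"
  using is_raut unfolding is_raut_def by auto

lemma eps_edge:
  assumes "(p, None, q) \<in> edges C"
  obtains i where "i < length R" "fst q \<in> En_nodes R i" "fst p \<in> src_nodes R i"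
    "fst p \<in> In_nodes R i \<union> Ret_nodes R i \<or> fst p = fst q"
proof -
  have "eps_edge_ok R p q" using edge_ok[OF assms] by simp
  then obtain i where i: "i < length R" "fst q \<in> En_nodes R i"
    "fst p \<in> In_nodes R i \<union> Ret_nodes R i \<or> fst p = fst q"
    unfolding eps_edge_ok_def by blast
  moreover have "fst p \<in> src_nodes R i" using i unfolding src_nodes_def by auto
  ultimately show ?thesis using that by blast
qed

lemma box_edge:
  assumes "(p, Some b, q) \<in> edges C"
  obtains i where "i < length R" "b \<in> boxes (R ! i)" "fst p \<in> En_nodes R (callee (R ! i) b)"
    "fst q \<in> En_nodes R i"
proof -
  have "b_edge_ok R p b q" using edge_ok[OF assms] by simp
  then show ?thesis using that unfolding b_edge_ok_def by blast
qed

lemma final_state: "f \<in> final C \<Longrightarrow> f \<in> states C \<and> fst f \<in> all_of En_nodes R"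
  using is_raut unfolding is_raut_def by (auto simp: mem_Times_iff)

lemma initial_state: "p \<in> initial C \<Longrightarrow> p \<in> states C"
  using is_raut unfolding is_raut_def by blast

lemma self_loop:
  "p \<in> states C \<Longrightarrow> fst p \<in> all_of En_nodes R \<Longrightarrow> (p, None, p) \<in> edges C \<and> wt C (p, None, p) = 1"
  using is_raut unfolding is_raut_def by blast

lemma finite_states: "finite (states C)"
  using is_raut unfolding is_raut_def by blast

text \<open>Read from its end, a run builds a stack: an \<epsilon>-edge stays in the module, and a
  box edge pushes its box. This certifies that the configurations read off runs of \<open>C\<close>
  belong to \<open>lang\<close>.\<close>

lemma run_config: "is_run C p ts q \<Longrightarrow> is_config R (fst p, run_label ts)"
proof (induction ts arbitrary: p)
  case Nil
  then show ?case using state_src[of p] by (auto simp: is_config_def)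
next
  case (Cons t ts)
  obtain a p' where t: "t = (p, a, p')" "(p, a, p') \<in> edges C" "is_run C p' ts q"
    using Cons.prems by (cases t) auto
  have IH: "is_config R (fst p', run_label ts)" using Cons.IH t(3) by blast
  show ?case
  proof (cases a)
    case None
    with t(2) obtain i where "i < length R" "fst p' \<in> En_nodes R i" "fst p \<in> src_nodes R i"
      by (blast elim: eps_edge)
    then show ?thesis
      using is_config_same_module[OF is_rsm IH] node_subsets(2) None t(1) by fastforce
  next
    case (Some b)
    with t(2) obtain i where "i < length R" "b \<in> boxes (R ! i)"
      "fst p \<in> En_nodes R (callee (R ! i) b)" "fst p' \<in> En_nodes R i"
      by (blast elim: box_edge)
    then show ?thesis
      using is_config_push[OF is_rsm IH, of i b "fst p"]
        subsetD[OF node_subsets(2), of "fst p'" R i]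
        subsetD[OF node_subsets(8), of "fst p" R "callee (R ! i) b"] Some t(1) by simp
  qed
qed

definition box_run :: "('b, 'v) state \<Rightarrow> ('b, 'v) edge list \<Rightarrow> ('b, 'v) state \<Rightarrow> bool" where
  "box_run p ts q \<longleftrightarrow> is_run C p ts q \<and> (\<forall>t\<in>set ts. fst (snd t) \<noteq> None)"

text \<open>Self-loops are dropped without changing the label. After a box edge,
  \<open>eps_edges_first\<close> leaves only self-loops at the new state, so the premise on
  \<open>p\<close> is inherited along the run.\<close>

lemma box_run_exists:
  assumes "eps_edges_first C" "is_run C p ts f" "\<And>q. (p, None, q) \<in> edges C \<Longrightarrow> q = p"
  shows "\<exists>us. box_run p us f \<and> run_label us = run_label ts"
  using assms(2,3)
proof (induction ts arbitrary: p)
  case Nil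
  then show ?case by (intro exI[of _ "[]"]) (auto simp: box_run_def)
next
  case (Cons t ts)
  obtain a p' where t: "t = (p, a, p')" "(p, a, p') \<in> edges C" "is_run C p' ts f"
    using Cons.prems(1) by (cases t) auto
  show ?case
  proof (cases a)
    case None
    with Cons t show ?thesis by (metis run_label_simps(2))
  next
    case (Some b)
    have "q = p'" if "(p', None, q) \<in> edges C" for q
      using assms(1) that t(2) Some unfolding eps_edges_first_def by blast
    with Cons.IH t(3) obtain us where "box_run p' us f" "run_label us = run_label ts" by blast
    then show ?thesis
      using t(1,2) Some by (intro exI[of _ "t # us"]) (auto simp: box_run_def)
  qed
qed

text \<open>Normal form of accepting runs of \<open>C\<close>: leading self-loops are removed, a
  first proper \<epsilon>-edge is kept, and a run that is empty or starts with a box edge gets the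
  self-loop of its first state in front.\<close>

lemma eps_box_run_exists:
  assumes "eps_edges_first C" "is_run C p ts f" "f \<in> final C"
  shows "\<exists>q us. (p, None, q) \<in> edges C \<and> box_run q us f \<and> run_label us = run_label ts"
  using assms(2)
proof (induction ts arbitrary: p)
  case Nil
  then show ?case
    using final_state[OF assms(3)] self_loop
    by (intro exI[of _ p] exI[of _ "[]"]) (auto simp: box_run_def)
next
  case (Cons t ts)
  obtain a p' where t: "t = (p, a, p')" "(p, a, p') \<in> edges C" "is_run C p' ts f"
    using Cons.prems(1) by (cases t) auto
  show ?case
  proof (cases "a = None \<and> p' = p")
    case True
    with Cons t show ?thesis by auto
  next
    case False
    have "q = p'" if "(p', None, q) \<in> edges C" for q
      using assms(1) that t(2) False unfolding eps_edges_first_def by blast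
    with box_run_exists[OF assms(1) t(3)] obtain us
      where us: "box_run p' us f" "run_label us = run_label ts" by blast
    show ?thesis
    proof (cases a)
      case None
      with us t show ?thesis by (intro exI[of _ p'] exI[of _ us]) simp
    next
      case (Some b)
      with t(2) obtain i where "i < length R" "b \<in> boxes (R ! i)"
        "fst p \<in> En_nodes R (callee (R ! i) b)" by (blast elim: box_edge)
      then have "fst p \<in> all_of En_nodes R"
        unfolding all_of_def using callee_less[of b i] by blast
      with t(2) have "(p, None, p) \<in> edges C" using self_loop edge_states by blast
      then show ?thesis
        using us t(1,2) Some by (intro exI[of _ p] exI[of _ "t # us"]) (auto simp: box_run_def)
    qed
  qed
qed

end


section \<open>The saturated automaton\<close>

text \<open>The stack symbols that a single edge reads; this lets \<epsilon>-edges and box edges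
  share one soundness statement.\<close>

definition option_list :: "'a option \<Rightarrow> 'a list" where
  "option_list a = (case a of None \<Rightarrow> [] | Some b \<Rightarrow> [b])"

lemma option_list_simps [simp]: "option_list None = []" "option_list (Some b) = [b]"
  by (simp_all add: option_list_def)

lemma run_label_Cons: "run_label ((p, a, q) # ts) = option_list a @ run_label ts"
  by (cases a) simp_all

lemma run_label_singleton: "run_label [(p, a, q)] = option_list a"
  by (cases a) simp_all

locale conf_dist_input = raut_rsm R C
  for R :: "('b, 'v, 'd::idem_semiring) rsm" and C :: "('b, 'v, 'd) raut" +
  fixes H mh :: nat
  assumes height: "semiring_height TYPE('d) H"
    and all_one: "\<forall>t\<in>edges C. wt C t = 1"
    and fresh: "mh \<notin> marks C"
begin

text \<open>\<open>St\<close>, \<open>Init\<close> and \<open>E\<close> describe in closed form what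
  preprocessing produces. The main loop changes weights only, so the soundness and completeness
  arguments can refer to these fixed sets.\<close>

definition St :: "('b, 'v) state set" where
  "St = states C \<union> all_of src_nodes R \<times> {mh}"

definition Init :: "('b, 'v) state set" where
  "Init = initial C \<union> all_of src_nodes R \<times> {mh}"

definition entry_states :: "('b, 'v) node \<Rightarrow> ('b, 'v) state set" where
  "entry_states u = {q \<in> St. fst q \<in> En_nodes R (module_of R u)}"

definition loops :: "('b, 'v) edge set" where
  "loops = (\<lambda>u. ((u, mh), None, (u, mh))) ` all_of En_nodes R"

definition call_edges :: "('b, 'v) node \<Rightarrow> ('b, 'v) node \<Rightarrow> ('b, 'v) edge set" where
  "call_edges u v = (case v of Atom _ \<Rightarrow> {}
     | Port b e \<Rightarrow> (\<lambda>q. ((Atom e, mh), Some b, q)) ` entry_states u)"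

definition new_box_edges :: "('b, 'v) edge set" where
  "new_box_edges = (\<Union>p\<in>Init. \<Union>v\<in>succs R (fst p). call_edges (fst p) v)"

definition inner_nodes :: "('b, 'v) state \<Rightarrow> ('b, 'v) node set" where
  "inner_nodes q = In_nodes R (module_of R (fst q)) \<union> Ret_nodes R (module_of R (fst q))"

definition new_eps_edges :: "('b, 'v) edge set" where
  "new_eps_edges = (\<Union>q\<in>{q \<in> St. fst q \<in> all_of En_nodes R}.
     (\<lambda>u. ((u, mh), None, q)) ` inner_nodes q)"

definition E :: "('b, 'v) edge set" where
  "E = edges C \<union> loops \<union> new_box_edges \<union> new_eps_edges"

section \<open>Shape of the states and edges after preprocessing\<close>

lemma C_marks: "p \<in> states C \<Longrightarrow> snd p \<noteq> mh"
  using fresh unfolding marks_def by auto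

lemma C_edge_marks: "(p, a, q) \<in> edges C \<Longrightarrow> snd p \<noteq> mh \<and> snd q \<noteq> mh"
  using edge_states C_marks by blast

lemma St_src: "p \<in> St \<Longrightarrow> fst p \<in> all_of src_nodes R"
  unfolding St_def using state_src[of p] by auto

lemma Init_subset: "Init \<subseteq> St"
  unfolding Init_def St_def using initial_state by blast

lemma finite_St: "finite St"
  unfolding St_def using finite_states finite_src by simp

lemma new_box_edges_cases:
  assumes "t \<in> new_box_edges"
  obtains i u b e q where "t = ((Atom e, mh), Some b, q)" "i < length R" "(u, Port b e) \<in> delta (R ! i)"
    "Port b e \<in> Call_nodes R i" "q \<in> St" "fst q \<in> En_nodes R i"
proof -
  obtain p v where pv: "p \<in> Init" "v \<in> succs R (fst p)" "t \<in> call_edges (fst p) v"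
    using assms unfolding new_box_edges_def by blast
  then obtain b e q where t: "v = Port b e" "t = ((Atom e, mh), Some b, q)" "q \<in> entry_states (fst p)"
    unfolding call_edges_def by (auto split: node.splits)
  have "fst p \<in> all_of src_nodes R" using pv(1) Init_subset St_src by blast
  with pv(2) obtain i where "i < length R" "module_of R (fst p) = i" "(fst p, v) \<in> delta (R ! i)"
    "v \<in> In_nodes R i \<union> Ex_nodes R i \<union> Call_nodes R i"
    by (blast elim: succs_src)
  with t that show ?thesis unfolding entry_states_def by auto
qed

text \<open>The marked copy of every source node is initial, so each call transition contributes its
  edges whatever the initial states of \<open>C\<close> are.\<close>

lemma new_box_edgesI:
  assumes "i < length R" "(u, Port b e) \<in> delta (R ! i)" "q \<in> St" "fst q \<in> En_nodes R i"
  shows "((Atom e, mh), Some b, q) \<in> E"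
proof -
  have u: "u \<in> src_nodes R i" "module_of R u = i" using delta_src assms by blast+
  then have "(u, mh) \<in> Init" using assms(1) unfolding Init_def all_of_def by blast
  moreover have "Port b e \<in> succs R (fst (u, mh))" using succs_iff u assms by simp
  moreover have "((Atom e, mh), Some b, q) \<in> call_edges (fst (u, mh)) (Port b e)"
    using assms u by (simp add: call_edges_def entry_states_def)
  ultimately show ?thesis unfolding E_def new_box_edges_def by blast
qed

lemma new_eps_edges_cases:
  assumes "t \<in> new_eps_edges"
  obtains i u q where "t = ((u, mh), None, q)" "i < length R" "u \<in> In_nodes R i \<union> Ret_nodes R i"
    "q \<in> St" "fst q \<in> En_nodes R i"
proof -
  obtain q u where "q \<in> St" "fst q \<in> all_of En_nodes R" "u \<in> inner_nodes q" "t = ((u, mh), None, q)"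
    using assms unfolding new_eps_edges_def by blast
  then show ?thesis
    using that[where u = u and i = "module_of R (fst q)" and q = q]
      module_of_En[of "fst q"] unfolding inner_nodes_def by blast
qed

lemma new_eps_edgesI:
  assumes "i < length R" "u \<in> In_nodes R i \<union> Ret_nodes R i" "q \<in> St" "fst q \<in> En_nodes R i"
  shows "((u, mh), None, q) \<in> new_eps_edges"
proof -
  have "fst q \<in> all_of En_nodes R" "module_of R (fst q) = i"
    using assms module_of_eq node_subsets(2) unfolding all_of_def by blast+
  then show ?thesis using assms unfolding new_eps_edges_def inner_nodes_def by blast
qed

lemma E_cases:
  assumes "t \<in> E"
  obtains (old) "t \<in> edges C"
  | (loop) e where "e \<in> all_of En_nodes R" "t = ((e, mh), None, (e, mh))"
  | (box) i u b e q where "t = ((Atom e, mh), Some b, q)" "i < length R"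
      "(u, Port b e) \<in> delta (R ! i)" "Port b e \<in> Call_nodes R i" "q \<in> St" "fst q \<in> En_nodes R i"
  | (eps) i u q where "t = ((u, mh), None, q)" "i < length R" "u \<in> In_nodes R i \<union> Ret_nodes R i"
      "q \<in> St" "fst q \<in> En_nodes R i"
  using assms unfolding E_def loops_def
  by (elim UnE) (blast elim: new_box_edges_cases new_eps_edges_cases)+

text \<open>Every edge added by preprocessing leaves a state with the fresh mark. The edges leaving
  other states therefore keep the weight 1 they have in \<open>C\<close>.\<close>

lemma E_mark: "(p, a, q) \<in> E \<Longrightarrow> snd p \<noteq> mh \<Longrightarrow> (p, a, q) \<in> edges C"
  by (erule E_cases) auto

lemma E_eps:
  assumes "(p, None, q) \<in> E"
  obtains i where "i < length R" "q \<in> St" "fst q \<in> En_nodes R i" "fst p \<in> src_nodes R i" "p \<in> St"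
    "fst p \<in> In_nodes R i \<union> Ret_nodes R i \<or> fst p = fst q"
  using assms
proof (cases rule: E_cases)
  case old
  then show ?thesis
    using that edge_states by (auto simp: St_def elim: eps_edge)
next
  case (loop e)
  then show ?thesis
    using that[of "module_of R e"] module_of_En[of e] En_subset_src
      node_subsets(8)[of R "module_of R e"]
    by (auto simp: St_def)
next
  case (eps i u q)
  then show ?thesis
    using that[of i] node_subsets(7,9)[of R i] by (auto simp: St_def all_of_def)
qed simp

lemma E_box:
  assumes "(p, Some b, q) \<in> E"
  obtains i where "i < length R" "b \<in> boxes (R ! i)" "fst p \<in> En_nodes R (callee (R ! i) b)"
    "q \<in> St" "fst q \<in> En_nodes R i" "p \<in> St"
  using assms
proof (cases rule: E_cases)
  case old
  then show ?thesis
    using that edge_states by (auto simp: St_def elim: box_edge)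
next
  case (box i u b' e q')
  then have "b \<in> boxes (R ! i)" and e: "Atom e \<in> En_nodes R (callee (R ! i) b)"
    by (auto simp: Call_nodes_def En_nodes_def)
  then have "callee (R ! i) b < length R" using callee_less box by blast
  then have "(Atom e, mh) \<in> St"
    using e node_subsets(8) unfolding St_def all_of_def by blast
  then show ?thesis using that[of i] box e \<open>b \<in> boxes (R ! i)\<close> by auto
qed auto

lemma E_states: "(p, a, q) \<in> E \<Longrightarrow> p \<in> St \<and> q \<in> St"
  by (cases a) (blast elim: E_eps E_box)+

lemma entry_loop: "(u, mh) \<in> St \<Longrightarrow> u \<in> En_nodes R i \<Longrightarrow> i < length R \<Longrightarrow>
    ((u, mh), None, (u, mh)) \<in> loops"
  unfolding loops_def all_of_def by blast

lemma finite_E: "finite E"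
proof -
  let ?B = "\<Union>i<length R. boxes (R ! i)"
  have "E \<subseteq> St \<times> insert None (Some ` ?B) \<times> St"
  proof
    fix t assume t: "t \<in> E"
    obtain p a q where eq: "t = (p, a, q)" by (cases t)
    have "a \<in> insert None (Some ` ?B)"
    proof (cases a)
      case (Some b)
      with t eq obtain i where "i < length R" "b \<in> boxes (R ! i)" by (blast elim: E_box)
      then show ?thesis using Some by blast
    qed simp
    then show "t \<in> St \<times> insert None (Some ` ?B) \<times> St"
      using t E_states unfolding eq by simp
  qed
  moreover have "finite (St \<times> insert None (Some ` ?B) \<times> St)"
    using finite_St finite_boxes by simp
  ultimately show ?thesis by (rule finite_subset)
qed


section \<open>Soundness\<close>

text \<open>A transition out of a marked state summarizes the paths from the configurations that the
  target state stands for: a fresh activation of its entry node, or, for the states of \<open>C\<close>, the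
  accepted configurations cut off at the point where the run reaches the state.\<close>

definition starts :: "('b, 'v) state \<Rightarrow> ('b, 'v) config set" where
  "starts q = (if snd q = mh then {(fst q, [])}
     else {(u, run_label ts) | u m ts. (u, m) \<in> initial C \<and> is_run C (u, m) ts q})"

definition reach :: "('b, 'v) state \<Rightarrow> ('b, 'v) config \<Rightarrow> 'd set" where
  "reach q c = {w. \<exists>c0\<in>starts q. path R c0 w c}"

text \<open>The exit transition itself does not appear in the weight, since transitions to exits
  weigh 1.\<close>

definition exit_reach :: "('b, 'v) state \<Rightarrow> 'v \<Rightarrow> 'd set" where
  "exit_reach q x = {w. \<exists>u i. w \<in> reach q (u, []) \<and> i < length R \<and> (u, Atom x) \<in> delta (R ! i) \<and>
     Atom x \<in> Ex_nodes R i}"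

text \<open>Edges of \<open>C\<close> need no path set of their own: they weigh 1, and passing one
  only extends the stacks in \<open>starts\<close>. For a marked source, the edge represents paths
  ending in its source node with the symbol it reads as the whole stack.\<close>

definition wt_sound :: "('b, 'v, 'd) raut \<Rightarrow> bool" where
  "wt_sound A \<longleftrightarrow> (\<forall>t\<in>edges C \<union> loops. wt A t = 1) \<and>
     (\<forall>p a q. (p, a, q) \<in> E \<longrightarrow> snd p = mh \<longrightarrow>
        wt A (p, a, q) \<in> finsums (reach q (fst p, option_list a)))"

definition skeleton :: "('b, 'v, 'd) raut \<Rightarrow> bool" where
  "skeleton A \<longleftrightarrow> states A = St \<and> edges A = E \<and> initial A = Init \<and> final A = final C"

text \<open>A run of \<open>C\<close> reads the stack from the top, so one more edge adds its symbol
  at the bottom.\<close>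

lemma starts_snoc:
  assumes "(p, a, q) \<in> edges C" "(u, L) \<in> starts p"
  shows "(u, L @ option_list a) \<in> starts q"
proof -
  have marks: "snd p \<noteq> mh" "snd q \<noteq> mh" using C_edge_marks assms(1) by blast+
  then obtain m ts where "(u, m) \<in> initial C" "is_run C (u, m) ts p" "L = run_label ts"
    using assms(2) unfolding starts_def by auto
  moreover have "is_run C (u, m) (ts @ [(p, a, q)]) q"
    using calculation(2) assms(1) edge_states by (intro is_run_snoc) blast+
  ultimately show ?thesis
    using marks(2) unfolding starts_def
    by (auto simp: run_label_singleton intro!: exI[of _ "ts @ [(p, a, q)]"] exI[of _ m])
qed

lemma reach_snoc:
  assumes "(p, a, q) \<in> edges C" "w \<in> reach p (u, S)"
  shows "w \<in> reach q (u, S @ option_list a)"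
proof -
  obtain v L where "(v, L) \<in> starts p" "path R (v, L) w (u, S)"
    using assms(2) unfolding reach_def by auto
  then show ?thesis
    using starts_snoc[OF assms(1)] path_append unfolding reach_def by blast
qed

lemma reach_step: "w \<in> reach q c \<Longrightarrow> rsm_step R c v c' \<Longrightarrow> w * v \<in> reach q c'"
  unfolding reach_def by (auto intro: path_step)

text \<open>A marked \<open>p\<close> stands for a fresh activation of its node, so a path starting
  from it on the empty stack can be replayed on top of \<open>T\<close>. The path to
  \<open>p\<close> comes earlier and gives the left factor, in agreement with the reversed order of
  run weights.\<close>

lemma reach_compose:
  assumes "w \<in> reach q (fst p, T)" "v \<in> reach p (u, S)" "snd p = mh"
  shows "w * v \<in> reach q (u, S @ T)"
proof -
  have "path R (fst p, []) v (u, S)" using assms(2,3) by (auto simp: reach_def starts_def)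
  from path_append[OF this, of T] show ?thesis
    using assms(1) path_trans unfolding reach_def append_Nil by blast
qed

lemma reach_initial: "p \<in> Init \<Longrightarrow> 1 \<in> reach p (fst p, [])"
proof -
  assume p: "p \<in> Init"
  have "(fst p, []) \<in> starts p"
  proof (cases "snd p = mh")
    case False
    with p have "p \<in> initial C" "is_run C p [] p"
      using initial_state[of p] by (auto simp: Init_def)
    with False show ?thesis
      by (cases p) (force simp: starts_def intro!: exI[of _ "[]"])
  qed (simp add: starts_def)
  then show ?thesis unfolding reach_def by (blast intro: path_refl)
qed

text \<open>The two kinds of source behave differently: after a marked state the paths are composed,
  whereas after a state of \<open>C\<close> the weight is 1 and the paths are reinterpreted with a
  longer starting stack.\<close>

lemma source_sound:
  assumes "wt_sound A" "(p, a, q) \<in> E" "v \<in> finsums (reach p (u, S))"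
  shows "wt A (p, a, q) * v \<in> finsums (reach q (u, S @ option_list a))"
proof (cases "snd p = mh")
  case True
  then have "wt A (p, a, q) \<in> finsums (reach q (fst p, option_list a))"
    using assms(1,2) unfolding wt_sound_def by blast
  from assms(3) this show ?thesis
    by (rule finsums_mult) (rule reach_compose[OF _ _ True])
next
  case False
  then have e: "(p, a, q) \<in> edges C" using E_mark assms(2) by blast
  then have "wt A (p, a, q) = 1" using assms(1) unfolding wt_sound_def by blast
  then show ?thesis
    using assms(3) reach_snoc[OF e] by (auto intro: finsums_mono)
qed

text \<open>The weight \<open>v\<close> stands for the part of the run already traversed. As run
  weights are products in reverse order, each further edge multiplies from the left.\<close>

lemma run_sound:
  assumes "wt_sound A" "skeleton A" "is_run A p ts q" "v \<in> finsums (reach p (u, S))"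
  shows "run_weight A ts * v \<in> finsums (reach q (u, S @ run_label ts))"
  using assms(3,4)
proof (induction ts arbitrary: p v S)
  case (Cons t ts)
  obtain a p' where t: "t = (p, a, p')" "(p, a, p') \<in> E" "is_run A p' ts q"
    using Cons.prems(1) assms(2) by (cases t) (auto simp: skeleton_def)
  show ?case
    using Cons.IH[OF t(3) source_sound[OF assms(1) t(2) Cons.prems(2)]] t(1)
    by (simp add: run_label_Cons mult.assoc)
qed simp

lemma accepting_run_sound:
  assumes "wt_sound A" "skeleton A" "accepting_run A (u, S) ts"
  shows "run_weight A ts \<in> finsums {prod_list ws | c0 ws. c0 \<in> lang R C \<and> computation R c0 ws (u, S)}"
\<comment> \<open>If \<open>1 = 0\<close>, no run of \<open>C\<close> has nonzero weight and the
  language is empty; but then every weight is 0, which is the empty combine.\<close>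
proof (cases "(1::'d) = 0")
  case True
  then have "run_weight A ts = 0" by (metis mult_1 mult_zero_left)
  then show ?thesis by (simp add: finsums_zero)
next
  case False
  obtain m q where run: "(u, m) \<in> Init" "q \<in> final C" "is_run A (u, m) ts q" "run_label ts = S"
    using assms(2,3) by (auto simp: accepting_run_def skeleton_def)
  have "run_weight A ts * 1 \<in> finsums (reach q (u, [] @ run_label ts))"
    by (rule run_sound[OF assms(1,2) run(3)]) (use finsums_incl[OF reach_initial[OF run(1)]] in simp)
  then have "run_weight A ts \<in> finsums (reach q (u, S))" using run(4) by simp
  then show ?thesis
  proof (rule finsums_mono, intro subsetI)
    fix w assume "w \<in> reach q (u, S)"
    then obtain c0 where c0: "c0 \<in> starts q" "path R c0 w (u, S)" unfolding reach_def by blast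
    \<comment> \<open>Final states belong to \<open>C\<close>, so what \<open>q\<close> stands for
      are accepted configurations and not a fresh activation.\<close>
    have "snd q \<noteq> mh" using final_state[OF run(2)] C_marks by blast
    then obtain u0 m0 us where c0_eq: "c0 = (u0, run_label us)" "(u0, m0) \<in> initial C"
      "is_run C (u0, m0) us q"
      using c0(1) by (auto simp: starts_def)
    have "set us \<subseteq> edges C" using run_edges[OF c0_eq(3)] .
    then have "run_weight C us = 1"
      using all_one by (induction us) auto
    moreover have "accepting_run C c0 us"
      using c0_eq run(2) unfolding accepting_run_def by blast
    ultimately have "c0 \<in> lang R C"
      using c0_eq(1) run_config[OF c0_eq(3)] False unfolding lang_def by auto
    moreover from this obtain ws where "computation R c0 ws (u, S)" "prod_list ws = w"
      using path_computation[OF c0(2)] unfolding lang_def by blast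
    ultimately show "w \<in> {prod_list ws | c0 ws. c0 \<in> lang R C \<and> computation R c0 ws (u, S)}"
      by blast
  qed
qed


section \<open>Completeness\<close>

text \<open>\<open>obligation s t v\<close>: the inequality that processing the transition \<open>t\<close> establishes for the
  RSM transition to \<open>v\<close> (if \<open>t\<close> reads nothing) or for the exit \<open>v\<close> (if \<open>t\<close> reads a box).\<close>

fun obligation :: "('b, 'v, 'd) store \<Rightarrow> ('b, 'v) edge \<Rightarrow> ('b, 'v) node \<Rightarrow> bool" where
  "obligation s (p, None, q) (Port b e) \<longleftrightarrow>
     wt (aut s) ((Atom e, mh), Some b, q) \<sqsubseteq> wt (aut s) (p, None, q) * rweight R (fst p) (Port b e)"
| "obligation s (p, None, q) (Atom x) \<longleftrightarrow>
     (if Atom x \<in> all_of In_nodes R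
      then wt (aut s) ((Atom x, mh), None, q) \<sqsubseteq> wt (aut s) (p, None, q) * rweight R (fst p) (Atom x)
      else summ s q x \<sqsubseteq> wt (aut s) (p, None, q))"
| "obligation s (p, Some b, q) (Atom x) \<longleftrightarrow>
     wt (aut s) ((Port b x, mh), None, q) \<sqsubseteq> wt (aut s) (p, Some b, q) * summ s p x"
| "obligation s (p, Some b, q) (Port _ _) \<longleftrightarrow> True"

text \<open>A non-initial source owes nothing: no simple run starts there, and \<open>wl_ok\<close>
  keeps its \<epsilon>-edges off the worklist.\<close>

fun targets :: "('b, 'v) edge \<Rightarrow> ('b, 'v) node set" where
  "targets (p, None, q) = (if p \<in> Init then succs R (fst p) else {})"
| "targets (p, Some b, q) = Atom ` exits (R ! module_of R (fst p))"

text \<open>\<open>X\<close> holds the pairs that the current iteration still has to treat; it is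
  empty between iterations. With an empty worklist as well, every obligation holds outright.\<close>

definition closed :: "(('b, 'v) edge \<times> ('b, 'v) node) set \<Rightarrow> ('b, 'v, 'd) store \<Rightarrow> bool" where
  "closed X s \<longleftrightarrow> (\<forall>t\<in>E. \<forall>v\<in>targets t. t \<in> wl s \<or> (t, v) \<in> X \<or> obligation s t v)"

text \<open>It is enough to follow runs that start with an \<open>\<epsilon>\<close>-transition and then read boxes only.\<close>

definition simple_run :: "('b, 'v, 'd) raut \<Rightarrow> ('b, 'v) config \<Rightarrow> ('b, 'v) edge list \<Rightarrow> bool" where
  "simple_run A c ts \<longleftrightarrow> (\<exists>p q us f. ts = (p, None, q) # us \<and> (p, None, q) \<in> edges A \<and> p \<in> initial A \<and>
     fst p = fst c \<and> is_run A q us f \<and> f \<in> final A \<and> run_label us = snd c \<and>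
     (\<forall>t\<in>set us. fst (snd t) \<noteq> None))"

lemma simple_runI:
  "(p, None, q) \<in> edges A \<Longrightarrow> p \<in> initial A \<Longrightarrow> fst p = fst c \<Longrightarrow> is_run A q us f \<Longrightarrow> f \<in> final A \<Longrightarrow>
   run_label us = snd c \<Longrightarrow> \<forall>t\<in>set us. fst (snd t) \<noteq> None \<Longrightarrow> simple_run A c ((p, None, q) # us)"
  unfolding simple_run_def by blast

lemma simple_run_accepting: "simple_run A c ts \<Longrightarrow> accepting_run A c ts"
  unfolding simple_run_def accepting_run_def by (cases c) fastforce

lemma simple_run_initial:
  assumes "wt_sound A" "skeleton A" "eps_edges_first C" "c \<in> lang R C"
  shows "\<exists>ts. simple_run A c ts \<and> run_weight A ts = 1"
proof -
  obtain u m f ts where run: "(u, m) \<in> initial C" "fst c = u" "f \<in> final C" "is_run C (u, m) ts f"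
    "run_label ts = snd c"
    using assms(4) unfolding lang_def accepting_run_def by (cases c) auto
  obtain q us where us: "((u, m), None, q) \<in> edges C" "box_run q us f" "run_label us = snd c"
    using eps_box_run_exists[OF assms(3) run(4,3)] run(5) by auto
  have edges: "set us \<subseteq> edges C"
    using us(2) run_edges unfolding box_run_def by blast
  have "is_run A q us f"
    using us(2) assms(2) unfolding box_run_def
    by (induction us arbitrary: q) (auto simp: skeleton_def E_def St_def)
  moreover have "run_weight A us = 1"
    using edges assms(1) by (induction us) (auto simp: wt_sound_def)
  moreover have "simple_run A c (((u, m), None, q) # us)"
    using us run assms(2) \<open>is_run A q us f\<close>
    by (intro simple_runI[where f = f]) (auto simp: box_run_def skeleton_def E_def Init_def)
  moreover have "wt A ((u, m), None, q) = 1" using us(1) assms(1) unfolding wt_sound_def by blast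
  ultimately show ?thesis by force
qed

text \<open>Only the head of the run changes. An internal step replaces the \<epsilon>-edge; a call
  replaces it by the self-loop of the entry and a new box edge; a return merges the \<epsilon>-edge
  and the first box edge into one \<epsilon>-edge. In the reversed product the head is the rightmost
  factor and thus adjacent to \<open>w\<close>, so monotonicity covers the rest of the run.\<close>

lemma simple_run_step:
  assumes inv: "skeleton (aut s)" "wt_sound (aut s)" "closed {} s" "wl s = {}"
    and run: "simple_run (aut s) c ts" and step: "rsm_step R c w c'"
  shows "\<exists>ts'. simple_run (aut s) c' ts' \<and> run_weight (aut s) ts' \<sqsubseteq> run_weight (aut s) ts * w"
proof -
  let ?A = "aut s"
  have A: "states ?A = St" "edges ?A = E" "initial ?A = Init" "final ?A = final C"
    using inv(1) unfolding skeleton_def by auto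
  have closed: "obligation s t v" if "t \<in> E" "v \<in> targets t" for t v
    using inv(3,4) that unfolding closed_def by blast
  obtain p q us f where ts: "ts = (p, None, q) # us" and e: "(p, None, q) \<in> E" and p: "p \<in> Init"
    "fst p = fst c" and us: "is_run ?A q us f" "f \<in> final C" "run_label us = snd c"
    "\<forall>t\<in>set us. fst (snd t) \<noteq> None"
    using run unfolding simple_run_def A by auto
  obtain i where i: "i < length R" "q \<in> St" "fst q \<in> En_nodes R i" "fst p \<in> src_nodes R i"
    using e by (rule E_eps)
  have module: "j = i" if "j < length R" "(fst p, v) \<in> delta (R ! j)" for j v
    using delta_src[OF that(2,1)] module_of_eq i node_subsets(6) by blast
  have target: "v \<in> targets (p, None, q)" if "(fst p, v) \<in> delta (R ! i)" for v
    using that succs_iff[OF i(4,1)] p(1) by simp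
  show ?thesis
    using step
  proof cases
    case (internal_step j u u' S)
    then have j: "j = i" using module p(2) by auto
    have u': "u' \<in> all_of In_nodes R" "(fst p, u') \<in> delta (R ! i)"
      using internal_step i j p(2) unfolding all_of_def by auto
    obtain x where x: "u' = Atom x" using internal_step by (auto simp: In_nodes_def)
    have new: "((u', mh), None, q) \<in> E"
      using new_eps_edgesI[of i u' q] internal_step i j unfolding E_def by blast
    have "wt ?A ((u', mh), None, q) \<sqsubseteq> wt ?A (p, None, q) * rweight R (fst p) u'"
      using closed[OF e target[OF u'(2)]] u'(1) x by simp
    then have "wt ?A ((u', mh), None, q) \<sqsubseteq> wt ?A (p, None, q) * w"
      using rweight_eq[OF u'(2) i(1)] internal_step j p(2) by simp
    then have "run_weight ?A (((u', mh), None, q) # us) \<sqsubseteq> run_weight ?A ts * w"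
      unfolding ts run_weight_simps mult.assoc by (rule mult_sqle_left)
    moreover have "(u', mh) \<in> Init"
      using E_states[OF new] fresh St_src unfolding Init_def by fastforce
    then have "simple_run ?A c' (((u', mh), None, q) # us)"
      using new us internal_step by (intro simple_runI[where f = f]) (auto simp: A)
    ultimately show ?thesis by blast
  next
    case (call_step j u b e' S)
    then have j: "j = i" using module p(2) by auto
    let ?v = "Port b e'" and ?e = "(Atom e', mh)"
    have d: "(fst p, ?v) \<in> delta (R ! i)" using call_step j p(2) by simp
    have new: "(?e, Some b, q) \<in> E"
      using new_box_edgesI[OF i(1) d i(2,3)] .
    have en: "Atom e' \<in> En_nodes R (callee (R ! i) b)" "callee (R ! i) b < length R"
      using call_step j callee_less by (auto simp: Call_nodes_def En_nodes_def)
    have e': "?e \<in> St" using E_states[OF new] by blast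
    then have init: "?e \<in> Init" using St_src[OF e'] unfolding Init_def by simp
    have loop: "(?e, None, ?e) \<in> loops" using entry_loop[OF e' en] .
    then have one: "wt ?A (?e, None, ?e) = 1" using inv(2) unfolding wt_sound_def by blast
    have "wt ?A (?e, Some b, q) \<sqsubseteq> wt ?A (p, None, q) * w"
      using closed[OF e target[OF d]] rweight_eq[OF d i(1)] call_step j p(2) by simp
    then have "run_weight ?A ((?e, None, ?e) # (?e, Some b, q) # us) \<sqsubseteq> run_weight ?A ts * w"
      unfolding ts run_weight_simps mult.assoc one mult_1_right by (rule mult_sqle_left)
    moreover have "simple_run ?A c' ((?e, None, ?e) # (?e, Some b, q) # us)"
      using new us call_step init loop by (intro simple_runI[where f = f]) (auto simp: A E_def)
    ultimately show ?thesis by blast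
  next
    case (return_step j u x k b S)
    then have j: "j = i" using module p(2) by auto
    have d: "(fst p, Atom x) \<in> delta (R ! i)" using return_step j p(2) by simp
    have x: "Atom x \<in> Ex_nodes R i" using return_step j by simp
    have "Atom x \<notin> all_of In_nodes R"
      using In_not_Ex[OF _ _ i(1)] x unfolding all_of_def by blast
    then have sum: "summ s q x \<sqsubseteq> wt ?A (p, None, q)"
      using closed[OF e target[OF d]] by simp
    have w: "w = 1" using exit_weight[OF d i(1) x] return_step j p(2) by simp
    have label: "run_label us = b # S" using us(3) return_step by simp
    then obtain t us' where us': "us = t # us'" by (cases us) auto
    \<comment> \<open>This is where the simple form is used: the edge reading \<open>b\<close>
      leaves \<open>q\<close> itself, the state at which the summary of \<open>x\<close> is
      stored.\<close>
    obtain q' where t: "t = (q, Some b, q')"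
      using us us' label by (cases t; cases "fst (snd t)") auto
    have eb: "(q, Some b, q') \<in> E" and run': "is_run ?A q' us' f" "run_label us' = S"
      using us(1) us' t label A by auto
    obtain l where l: "l < length R" "b \<in> boxes (R ! l)" "fst q \<in> En_nodes R (callee (R ! l) b)"
      "q' \<in> St" "fst q' \<in> En_nodes R l"
      using eb by (rule E_box)
    have "callee (R ! l) b = i"
      using nodes_inj[of "fst q"] l i callee_less node_subsets(2) by blast
    then have ret: "Port b x \<in> Ret_nodes R l"
      using x l(2) by (auto simp: Ret_nodes_def Ex_nodes_def)
    have new: "((Port b x, mh), None, q') \<in> E"
      using new_eps_edgesI[of l "Port b x" q'] ret l unfolding E_def by blast
    have init: "(Port b x, mh) \<in> Init"
      using E_states[OF new] St_src unfolding Init_def by fastforce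
    have "module_of R (fst q) = i" using module_of_eq i node_subsets(2) by blast
    then have "Atom x \<in> targets (q, Some b, q')" using x by (auto simp: Ex_nodes_def)
    then have "wt ?A ((Port b x, mh), None, q') \<sqsubseteq> wt ?A (q, Some b, q') * summ s q x"
      using closed[OF eb] by fastforce
    also have "\<dots> \<sqsubseteq> wt ?A (q, Some b, q') * wt ?A (p, None, q)"
      using sum by (rule mult_sqle_left)
    finally have "run_weight ?A (((Port b x, mh), None, q') # us') \<sqsubseteq> run_weight ?A ts * w"
      unfolding ts us' t w run_weight_simps mult.assoc mult_1_right by (rule mult_sqle_left)
    moreover have "simple_run ?A c' (((Port b x, mh), None, q') # us')"
      using new us us' run' return_step init by (intro simple_runI[where f = f]) (auto simp: A)
    ultimately show ?thesis by blast
  qed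
qed

lemma computation_complete:
  assumes "skeleton (aut s)" "wt_sound (aut s)" "closed {} s" "wl s = {}" "eps_edges_first C"
    and "computation R c0 ws c" "c0 \<in> lang R C"
  shows "\<exists>ts. simple_run (aut s) c ts \<and> run_weight (aut s) ts \<sqsubseteq> prod_list ws"
  using assms(6,7)
proof (induction rule: computation.induct)
  case (comp_nil c)
  then obtain ts where "simple_run (aut s) c ts" "run_weight (aut s) ts = 1"
    using simple_run_initial[OF assms(2,1,5)] by blast
  then show ?case by (intro exI[of _ ts]) simp
next
  case (comp_step c ws c' w c'')
  then obtain ts where ts: "simple_run (aut s) c' ts" "run_weight (aut s) ts \<sqsubseteq> prod_list ws" by blast
  obtain ts' where "simple_run (aut s) c'' ts'" "run_weight (aut s) ts' \<sqsubseteq> run_weight (aut s) ts * w"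
    using simple_run_step[OF assms(1-4) ts(1) comp_step(2)] by blast
  moreover have "run_weight (aut s) ts * w \<sqsubseteq> prod_list (ws @ [w])"
    using mult_sqle_right[OF ts(2)] by simp
  ultimately show ?case by (blast intro: sqle_trans)
qed

lemma aut_value_eq_dist:
  assumes "skeleton (aut s)" "wt_sound (aut s)" "closed {} s" "wl s = {}" "eps_edges_first C"
  shows "config_dist R (lang R C) c = aut_value (aut s) c"
  unfolding config_dist_def aut_value_def
proof (rule Combine_eqI[OF height])
  fix w assume "w \<in> {prod_list ws | c0 ws. c0 \<in> lang R C \<and> computation R c0 ws c}"
  then obtain c0 ws where "c0 \<in> lang R C" "computation R c0 ws c" "w = prod_list ws" by blast
  then obtain ts where "simple_run (aut s) c ts" "run_weight (aut s) ts \<sqsubseteq> w"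
    using computation_complete[OF assms] by blast
  then show "\<exists>v\<in>{run_weight (aut s) ts | ts. accepting_run (aut s) c ts}. v \<sqsubseteq> w"
    using simple_run_accepting by blast
next
  fix v assume "v \<in> {run_weight (aut s) ts | ts. accepting_run (aut s) c ts}"
  then obtain ts where ts: "v = run_weight (aut s) ts" "accepting_run (aut s) c ts" by blast
  obtain u S where c: "c = (u, S)" by (cases c)
  show "v \<in> finsums {prod_list ws | c0 ws. c0 \<in> lang R C \<and> computation R c0 ws c}"
    using accepting_run_sound[OF assms(2,1) ts(2)[unfolded c]] unfolding ts(1) c .
qed

end


section \<open>The main loop\<close>

context conf_dist_input
begin

text \<open>These are the summaries that get initialized; the invariant says nothing about the
  others, which may be \<open>undefined\<close>.\<close>

definition exit_pairs :: "(('b, 'v) state \<times> 'v) set" where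
  "exit_pairs = (SIGMA q:{q \<in> St. fst q \<in> all_of En_nodes R}. exits (R ! module_of R (fst q)))"

text \<open>The mark condition on box edges is what makes reading the summary at
  \<open>(fst p, mh)\<close> the same as reading it at \<open>p\<close>.\<close>

definition wl_ok :: "('b, 'v, 'd) store \<Rightarrow> bool" where
  "wl_ok s \<longleftrightarrow> wl s \<subseteq> E \<and> (\<forall>(p, a, q)\<in>wl s. p \<in> Init \<and> (a \<noteq> None \<longrightarrow> snd p = mh))"

text \<open>\<open>loops \<subseteq> seen s\<close> says that the self-loops of all marked entries
  have already been queued, so that a call never has to queue one.\<close>

definition inv :: "(('b, 'v) edge \<times> ('b, 'v) node) set \<Rightarrow> ('b, 'v, 'd) store \<Rightarrow> bool" where
  "inv X s \<longleftrightarrow> skeleton (aut s) \<and> wt_sound (aut s) \<and>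
     (\<forall>(q, x)\<in>exit_pairs. summ s q x \<in> finsums (exit_reach q x)) \<and>
     wl_ok s \<and> loops \<subseteq> seen s \<and> closed X s"

definition box_succs :: "('b, 'v) state \<Rightarrow> ('b \<times> ('b, 'v) state) set" where
  "box_succs q = {(b, q'). (q, Some b, q') \<in> E}"

text \<open>Three units of each constant are the loop iteration, the choice and the removal from the
  worklist; the rest are the ends of the traversals, three for an \<epsilon>-edge and one for a box
  edge. The three traversals charge 5, 5 and 4 units per successor, rounded up to 15; an exit costs
  its loop step and at most 3 units of relaxing.\<close>

definition cost :: "('b, 'v) edge \<Rightarrow> nat" where
  "cost t = (case fst (snd t) of None \<Rightarrow> 6 + 15 * card (succs R (fst (fst t)))
     | Some b \<Rightarrow> 4 + 4 * theta_x R)"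

text \<open>A transition is extracted from the worklist at most once more than its weight drops, and each
  summary triggers the traversal of its \<open>b\<close>-transitions only when it drops.\<close>

definition potential :: "('b, 'v, 'd) store \<Rightarrow> nat" where
  "potential s = (\<Sum>t\<in>E. cost t * (rank (wt (aut s) t) + of_bool (t \<in> wl s))) +
     (\<Sum>(q, x)\<in>exit_pairs. 4 * card (box_succs q) * rank (summ s q x))"

section \<open>Preservation of the invariant under updates\<close>

lemma finite_exit_pairs: "finite exit_pairs"
  unfolding exit_pairs_def using finite_St finite_exits module_of_En by (intro finite_SigmaI) auto

lemma finite_box_succs: "finite (box_succs q)"
proof -
  have "box_succs q \<subseteq> (\<lambda>(p, a, q'). (the a, q')) ` E"
    unfolding box_succs_def by force
  then show ?thesis using finite_E finite_surj by blast
qed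

lemma marked_Init: "p \<in> St \<Longrightarrow> snd p = mh \<Longrightarrow> p \<in> Init"
  using St_src[of p] by (cases p) (simp add: Init_def)

lemma exit_pairsI:
  assumes "q \<in> St" "fst q \<in> En_nodes R i" "i < length R" "Atom x \<in> Ex_nodes R i"
  shows "(q, x) \<in> exit_pairs"
  using assms module_of_eq[of "fst q" i] subsetD[OF node_subsets(2)]
  by (auto simp: exit_pairs_def all_of_def Ex_nodes_def)

text \<open>Left-hand sides may drop freely. The right-hand side has to stay put, which is ensured
  by fixing the weight of \<open>t\<close> and, for a box edge, the summary it is multiplied
  with.\<close>

lemma obligation_mono:
  assumes "obligation s t v"
    and "\<And>t'. wt (aut s') t' \<sqsubseteq> wt (aut s) t'" "\<And>q x. summ s' q x \<sqsubseteq> summ s q x"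
    and "wt (aut s') t = wt (aut s) t"
    and "\<And>b x. fst (snd t) = Some b \<Longrightarrow> v = Atom x \<Longrightarrow> summ s' (fst t) x = summ s (fst t) x"
  shows "obligation s' t v"
  using assms(1,4,5) by (cases "(s, t, v)" rule: obligation.cases)
    (auto intro: sqle_trans[OF assms(2)] sqle_trans[OF assms(3)])

text \<open>An edge whose weight changed has to be on the worklist, while a changed summary makes
  the box edges that use it pending.\<close>

lemma closed_mono:
  assumes "closed X s" "X \<subseteq> Y" "wl s \<subseteq> wl s'"
    and "\<And>t'. wt (aut s') t' \<sqsubseteq> wt (aut s) t'" "\<And>q x. summ s' q x \<sqsubseteq> summ s q x"
    and "\<And>t. t \<in> E \<Longrightarrow> wt (aut s') t = wt (aut s) t \<or> t \<in> wl s'"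
    and "\<And>p b q x. (p, Some b, q) \<in> E \<Longrightarrow>
      summ s' p x = summ s p x \<or> ((p, Some b, q), Atom x) \<in> Y"
  shows "closed Y s'"
  unfolding closed_def
proof (intro ballI)
  fix t v assume t: "t \<in> E" "v \<in> targets t"
  with assms(1) consider "t \<in> wl s" | "(t, v) \<in> X" | "obligation s t v"
    unfolding closed_def by blast
  then show "t \<in> wl s' \<or> (t, v) \<in> Y \<or> obligation s' t v"
  proof cases
    case 3
    show ?thesis
    proof (cases "t \<in> wl s' \<or> (t, v) \<in> Y")
      case False
      have "obligation s' t v"
      proof (rule obligation_mono[OF 3 assms(4,5)])
        show "wt (aut s') t = wt (aut s) t" using assms(6)[OF t(1)] False by blast
        fix b x assume "fst (snd t) = Some b" "v = Atom x"
        then show "summ s' (fst t) x = summ s (fst t) x"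
          using assms(7)[of "fst t" b "snd (snd t)" x] t(1) False by (cases t) auto
      qed
      then show ?thesis by blast
    qed blast
  qed (use assms(2,3) in blast)+
qed

lemma closed_discharge:
  assumes "closed X s"
    and "\<And>t v. (t, v) \<in> X \<Longrightarrow> (t, v) \<notin> Y \<Longrightarrow> v \<in> targets t \<Longrightarrow> t \<in> wl s \<or> obligation s t v"
  shows "closed Y s"
  using assms unfolding closed_def by blast

lemma inv_discharge:
  assumes "inv X s"
    and "\<And>t v. (t, v) \<in> X \<Longrightarrow> (t, v) \<notin> Y \<Longrightarrow> v \<in> targets t \<Longrightarrow> t \<in> wl s \<or> obligation s t v"
  shows "inv Y s"
  using assms(1) closed_discharge[of X s Y] assms(2) unfolding inv_def by blast

lemma inv_mono: "inv X s \<Longrightarrow> X \<subseteq> Y \<Longrightarrow> inv Y s"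
  by (erule inv_discharge) blast

lemma wt_soundD:
  "wt_sound A \<Longrightarrow> (p, a, q) \<in> E \<Longrightarrow> snd p = mh \<Longrightarrow>
    wt A (p, a, q) \<in> finsums (reach q (fst p, option_list a))"
  unfolding wt_sound_def by blast

lemma source_wt_sound:
  assumes "wt_sound A" "p \<in> Init" "(p, None, q) \<in> E"
  shows "wt A (p, None, q) \<in> finsums (reach q (fst p, []))"
  using source_sound[OF assms(1,3) finsums_incl[OF reach_initial[OF assms(2)]]] by simp

text \<open>With \<open>b\<close> put underneath, a path reaching the exit transition is continued
  by a return step of weight 1. A marked \<open>q\<close> contributes the paths that its box edge
  stands for in front; at a state of \<open>C\<close> the box edge weighs 1 and merely supplies
  \<open>b\<close> at the bottom of the stack.\<close>

lemma exit_sound: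
  assumes "wt_sound A" "(q, Some b, q') \<in> E" "(q, x) \<in> exit_pairs" "v \<in> finsums (exit_reach q x)"
  shows "wt A (q, Some b, q') * v \<in> finsums (reach q' (Port b x, []))"
proof -
  obtain j where j: "j < length R" "b \<in> boxes (R ! j)" "fst q \<in> En_nodes R (callee (R ! j) b)"
    using assms(2) by (rule E_box)
  have callee: "callee (R ! j) b < length R" using callee_less j by blast
  then have "module_of R (fst q) = callee (R ! j) b"
    using module_of_eq j(3) node_subsets(2) by blast
  then have x: "Atom x \<in> Ex_nodes R (callee (R ! j) b)"
    using assms(3) by (auto simp: exit_pairs_def Ex_nodes_def)
  have return: "w \<in> reach q' (Port b x, [])"
    if "w \<in> reach q' (u, [b])" "i < length R" "(u, Atom x) \<in> delta (R ! i)" "Atom x \<in> Ex_nodes R i"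
    for w u i
  proof -
    have i: "i = callee (R ! j) b"
      using nodes_inj[of "Atom x" i] that x callee node_subsets(3) by blast
    have "rsm_step R (u, [b]) (weight (R ! i) u (Atom x)) (Port b x, [])"
      using that j i by (intro return_step) auto
    then show ?thesis
      using reach_step[OF that(1)] exit_weight[OF that(3,2,4)] by fastforce
  qed
  show ?thesis
  proof (cases "snd q = mh")
    case True
    then have "wt A (q, Some b, q') \<in> finsums (reach q' (fst q, [b]))"
      using wt_soundD[OF assms(1,2)] by simp
    with assms(4) show ?thesis
    proof (rule finsums_mult)
      fix w w' assume w: "w \<in> reach q' (fst q, [b])" "w' \<in> exit_reach q x"
      then obtain u i where u: "w' \<in> reach q (u, [])" "i < length R" "(u, Atom x) \<in> delta (R ! i)"
        "Atom x \<in> Ex_nodes R i" unfolding exit_reach_def by blast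
      have "w * w' \<in> reach q' (u, [b])" using reach_compose[OF w(1) u(1) True] by simp
      then show "w * w' \<in> reach q' (Port b x, [])" using return u(2-4) by blast
    qed
  next
    case False
    then have e: "(q, Some b, q') \<in> edges C" using E_mark assms(2) by blast
    then have "wt A (q, Some b, q') = 1" using assms(1) unfolding wt_sound_def by blast
    moreover have "exit_reach q x \<subseteq> reach q' (Port b x, [])"
      using return reach_snoc[OF e] unfolding exit_reach_def by fastforce
    ultimately show ?thesis using assms(4) finsums_mono by fastforce
  qed
qed

text \<open>The offered value is read in the store before the update, also when it depends on the
  relaxed weight. A failed test takes 1 unit; a successful one is followed by two
  assignments.\<close>

lemma spec_relax:
  fixes s :: "('b, 'v, 'd) store"
  assumes "wt (aut s) t \<sqsubseteq> v s \<Longrightarrow> Q s 1"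
    and "\<not> wt (aut s) t \<sqsubseteq> v s \<Longrightarrow> Q (s\<lparr>aut := (aut s)\<lparr>wt := (wt (aut s))(t := wt (aut s) t + v s)\<rparr>,
      wl := insert t (wl s), seen := insert t (seen s)\<rparr>) 3"
  shows "spec (relax t v) s Q"
proof -
  have "spec (cond (\<lambda>s. wt (aut s) t \<noteq> wt (aut s) t + v s0)
      (assign (\<lambda>s. s\<lparr>aut := (aut s)\<lparr>wt := (wt (aut s))(t := wt (aut s) t + v s0)\<rparr>\<rparr>) ;; enqueue t)
      skip) s Q" if "s0 = s" for s0
    unfolding enqueue_def using assms that
    by (intro spec_cond spec_seq spec_assign spec_skip) (auto simp: sqle_update_eq numeral_3_eq_3)
  then show ?thesis unfolding spec_def relax_def by blast
qed

text \<open>The relaxed edge is the left-hand side of the obligation of \<open>t'\<close> towards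
  \<open>y\<close>, so relaxing it settles this pair. Excluding \<open>loops\<close> keeps their
  weights fixed at 1.\<close>

lemma relax_spec:
  assumes inv: "inv X s" and t: "(p, a, q) \<in> E" "snd p = mh" "(p, a, q) \<notin> loops"
    and v: "v s \<in> finsums (reach q (fst p, option_list a))"
    and ob: "\<And>s'. summ s' = summ s \<Longrightarrow> wt (aut s') t' = wt (aut s) t' \<Longrightarrow>
      wt (aut s') (p, a, q) \<sqsubseteq> v s \<Longrightarrow> obligation s' t' y"
  shows "spec (relax (p, a, q) v) s
    (\<lambda>s' n. inv (X - {(t', y)}) s' \<and> potential s' + n \<le> potential s + 3)"
proof -
  let ?t = "(p, a, q)"
  have parts: "skeleton (aut s)" "wt_sound (aut s)" "wl_ok s" "loops \<subseteq> seen s" "closed X s"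
    "\<forall>(q, x)\<in>exit_pairs. summ s q x \<in> finsums (exit_reach q x)"
    using inv unfolding inv_def by auto
  show ?thesis
  proof (cases "wt (aut s) ?t \<sqsubseteq> v s")
    case True
    have "inv (X - {(t', y)}) s"
      using ob[of s] True by (intro inv_discharge[OF inv]) auto
    then show ?thesis
      by (intro spec_relax) (use True in auto)
  next
    case False
    define w where "w = wt (aut s) ?t + v s"
    define s1 where "s1 = s\<lparr>aut := (aut s)\<lparr>wt := (wt (aut s))(?t := w)\<rparr>,
      wl := insert ?t (wl s), seen := insert ?t (seen s)\<rparr>"
    have w: "w \<sqsubseteq> wt (aut s) ?t" "w \<sqsubseteq> v s" "w \<noteq> wt (aut s) ?t"
      using False sqle_update_eq[of "wt (aut s) ?t" "v s"] by (auto simp: w_def)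
    have wt: "wt (aut s1) t'' = (if t'' = ?t then w else wt (aut s) t'')" for t''
      by (simp add: s1_def)
    have fields: "summ s1 = summ s" "wl s1 = insert ?t (wl s)" "seen s1 = insert ?t (seen s)"
      by (simp_all add: s1_def)
    have C: "?t \<notin> edges C" using C_edge_marks t(2) by blast
    have "wt_sound (aut s1)"
      unfolding wt_sound_def
    proof (intro conjI allI impI ballI)
      fix t'' assume "t'' \<in> edges C \<union> loops"
      then show "wt (aut s1) t'' = 1"
        using parts(2) C t(3) wt unfolding wt_sound_def by auto
    next
      fix p' a' q' assume *: "(p', a', q') \<in> E" "snd p' = mh"
      then have old: "wt (aut s) (p', a', q') \<in> finsums (reach q' (fst p', option_list a'))"
        using parts(2) unfolding wt_sound_def by blast
      show "wt (aut s1) (p', a', q') \<in> finsums (reach q' (fst p', option_list a'))"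
      proof (cases "(p', a', q') = ?t")
        case True
        then show ?thesis using finsums_add[OF old] v wt unfolding w_def by simp
      qed (use old wt in auto)
    qed
    moreover have "skeleton (aut s1)" using parts(1) by (simp add: skeleton_def s1_def)
    moreover have "p \<in> Init" using marked_Init E_states t(1,2) by blast
    then have "wl_ok s1" using parts(3) t by (auto simp: wl_ok_def fields)
    moreover have "closed X s1"
      by (rule closed_mono[OF parts(5)]) (use w in \<open>auto simp: fields wt\<close>)
    ultimately have "inv X s1" using parts unfolding inv_def fields by auto
    then have "inv (X - {(t', y)}) s1"
    proof (rule inv_discharge)
      fix t'' y' assume "(t'', y') \<in> X" "(t'', y') \<notin> X - {(t', y)}"
      then have "t'' = t'" "y' = y" by auto
      \<comment> \<open>A transition may relax itself, for instance along an internal step from a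
        node to itself. Its right-hand side then changes as well, but it is back on the
        worklist.\<close>
      moreover have "t' \<in> wl s1 \<or> obligation s1 t' y"
        using ob[of s1] w(2) fields wt by (cases "t' = ?t") auto
      ultimately show "t'' \<in> wl s1 \<or> obligation s1 t'' y'" by simp
    qed
    moreover have "potential s1 \<le> potential s"
    proof -
      \<comment> \<open>The drop of at least one pays for the edge joining the worklist, so a
        relaxation never raises the potential.\<close>
      have "rank w < rank (wt (aut s) ?t)" using rank_strict_mono[OF height w(1,3)] .
      then have "rank (wt (aut s1) t'') + of_bool (t'' \<in> wl s1) \<le>
          rank (wt (aut s) t'') + of_bool (t'' \<in> wl s)" for t''
        by (cases "t'' = ?t") (auto simp: wt fields)
      then have "(\<Sum>t\<in>E. cost t * (rank (wt (aut s1) t) + of_bool (t \<in> wl s1)))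
          \<le> (\<Sum>t\<in>E. cost t * (rank (wt (aut s) t) + of_bool (t \<in> wl s)))"
        by (intro sum_mono mult_le_mono2)
      then show ?thesis unfolding potential_def fields by simp
    qed
    ultimately show ?thesis
      by (intro spec_relax) (use False in \<open>auto simp: s1_def w_def\<close>)
  qed
qed

section \<open>Processing an \<epsilon>-transition\<close>

abbreviation visit_internal ::
  "('b, 'v) state \<Rightarrow> ('b, 'v) state \<Rightarrow> ('b, 'v) node \<Rightarrow> ('b, 'v, 'd) store cmd" where
  "visit_internal p q \<equiv> (\<lambda>u'. cond (\<lambda>_. u' \<in> all_of In_nodes R)
     (relax ((u', mh), None, q) (\<lambda>s. wt (aut s) (p, None, q) * rweight R (fst p) u')) skip)"

abbreviation visit_call ::
  "('b, 'v) state \<Rightarrow> ('b, 'v) state \<Rightarrow> ('b, 'v) node \<Rightarrow> ('b, 'v, 'd) store cmd" where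
  "visit_call p q \<equiv> (\<lambda>v. case v of Atom _ \<Rightarrow> skip
     | Port b e' \<Rightarrow>
         relax ((Atom e', mh), Some b, q) (\<lambda>s. wt (aut s) (p, None, q) * rweight R (fst p) v) ;;
         cond (\<lambda>s. ((Atom e', mh), None, (Atom e', mh)) \<notin> seen s)
           (enqueue ((Atom e', mh), None, (Atom e', mh))) skip)"

abbreviation update_summary ::
  "('b, 'v) state \<Rightarrow> ('b, 'v) state \<Rightarrow> 'v \<Rightarrow> ('b, 'v, 'd) store cmd" where
  "update_summary p q x \<equiv>
     cond (\<lambda>s. Atom x \<in> all_of Ex_nodes R \<and> \<not> summ s q x \<sqsubseteq> wt (aut s) (p, None, q))
       (assign (\<lambda>s. s\<lparr>summ := (summ s)(q := (summ s q)(x := summ s q x + wt (aut s) (p, None, q)))\<rparr>) ;;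
        foreach (\<lambda>s. {(b, q'). (q, Some b, q') \<in> edges (aut s)}) (\<lambda>(b, q').
          relax ((Port b x, mh), None, q') (\<lambda>s. wt (aut s) (q, Some b, q') * summ s q x)))
       skip"

abbreviation visit_exit ::
  "('b, 'v) state \<Rightarrow> ('b, 'v) state \<Rightarrow> ('b, 'v) node \<Rightarrow> ('b, 'v, 'd) store cmd" where
  "visit_exit p q \<equiv> (\<lambda>v. case v of Port _ _ \<Rightarrow> skip
     | Atom x \<Rightarrow>
         cond (\<lambda>s. v \<in> all_of Ex_nodes R \<and> \<not> summ s q x \<sqsubseteq> wt (aut s) (p, None, q))
           (assign (\<lambda>s. s\<lparr>summ := (summ s)(q := (summ s q)(x := summ s q x + wt (aut s) (p, None, q)))\<rparr>) ;;
            foreach (\<lambda>s. {(b, q'). (q, Some b, q') \<in> edges (aut s)}) (\<lambda>(b, q').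
              relax ((Port b x, mh), None, q') (\<lambda>s. wt (aut s) (q, Some b, q') * summ s q x)))
           skip)"

text \<open>Each visited internal successor leaves the pending set. The 5 units per successor are
  the loop step, the test for an internal node and at most 3 for relaxing.\<close>

lemma process_internal:
  assumes t: "(p, None, q) \<in> E" "p \<in> Init" and inv: "inv ({(p, None, q)} \<times> succs R (fst p)) s"
  shows "spec (foreach (\<lambda>_. succs R (fst p)) (visit_internal p q)) s
    (\<lambda>s' n. inv ({(p, None, q)} \<times> {v \<in> succs R (fst p). v \<notin> all_of In_nodes R}) s' \<and>
      potential s' + n \<le> potential s + 5 * card (succs R (fst p)) + 1)"
proof (rule spec_foreach[where J = "\<lambda>D s' n.
      inv ({(p, None, q)} \<times> {v \<in> succs R (fst p). \<not> (v \<in> all_of In_nodes R \<and> v \<in> D)}) s' \<and>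
      potential s' + n \<le> potential s + 5 * card D"])
  let ?u = "fst p" and ?t = "(p, None, q)" and ?In = "all_of In_nodes R"
  have u: "?u \<in> all_of src_nodes R" using t(2) Init_subset St_src by blast
  show fin: "finite (succs R ?u)" using finite_succs[OF u] .
  fix u' D s' n
  assume u': "u' \<in> succs R ?u" and D: "D \<subseteq> succs R ?u" "u' \<notin> D"
    and J: "inv ({?t} \<times> {v \<in> succs R ?u. \<not> (v \<in> ?In \<and> v \<in> D)}) s' \<and>
      potential s' + n \<le> potential s + 5 * card D"
  have card: "card (insert u' D) = Suc (card D)"
    using D fin finite_subset by (metis card_insert_disjoint)
  show "spec (visit_internal p q u') s'
    (\<lambda>s'' m. inv ({?t} \<times> {v \<in> succs R ?u. \<not> (v \<in> ?In \<and> v \<in> insert u' D)}) s'' \<and>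
      potential s'' + (n + m + 1) \<le> potential s + 5 * card (insert u' D))"
  proof (rule spec_cond)
    assume In: "u' \<in> ?In"
    obtain i where i: "i < length R" "module_of R ?u = i" "?u \<in> src_nodes R i" "(?u, u') \<in> delta (R ! i)"
      "u' \<in> In_nodes R i \<union> Ex_nodes R i \<union> Call_nodes R i"
      using u u' by (rule succs_src)
    obtain k where k: "k < length R" "u' \<in> In_nodes R k" using In unfolding all_of_def by blast
    then have "k = i" using nodes_inj[of u' k i] i node_subsets[of R] by blast
    with k have Ini: "u' \<in> In_nodes R i" by simp
    obtain x where x: "u' = Atom x" using Ini by (auto simp: In_nodes_def)
    obtain j where j: "j < length R" "q \<in> St" "fst q \<in> En_nodes R j" "?u \<in> src_nodes R j"
      using t(1) by (rule E_eps)
    then have ji: "j = i" using nodes_inj[of ?u j i] i node_subsets(6) by blast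
    have new: "((u', mh), None, q) \<in> E"
      using new_eps_edgesI[OF i(1), of u' q] Ini j ji unfolding E_def by blast
    have "((u', mh), None, q) \<notin> loops"
      using En_not_In_Ret[of u' _ i] i(1) Ini unfolding loops_def all_of_def by blast
    moreover have "wt (aut s') ?t * rweight R ?u u' \<in> finsums (reach q (fst (u', mh), option_list None))"
    proof (rule finsums_mult_const)
      show "wt (aut s') ?t \<in> finsums (reach q (?u, []))"
        using source_wt_sound[OF _ t(2,1)] J unfolding inv_def by blast
      show "w * rweight R ?u u' \<in> reach q (fst (u', mh), option_list None)"
        if "w \<in> reach q (?u, [])" for w
        using reach_step[OF that internal_step[OF i(1,4) Ini]] rweight_eq[OF i(4,1)] by simp
    qed
    ultimately have "spec (relax ((u', mh), None, q) (\<lambda>s. wt (aut s) ?t * rweight R ?u u')) s'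
      (\<lambda>s'' m. inv ({?t} \<times> {v \<in> succs R ?u. \<not> (v \<in> ?In \<and> v \<in> D)} - {(?t, u')}) s'' \<and>
        potential s'' + m \<le> potential s' + 3)"
      using J new In x by (intro relax_spec) auto
    then show "spec (relax ((u', mh), None, q) (\<lambda>s. wt (aut s) ?t * rweight R ?u u')) s'
      (\<lambda>s'' m. inv ({?t} \<times> {v \<in> succs R ?u. \<not> (v \<in> ?In \<and> v \<in> insert u' D)}) s'' \<and>
        potential s'' + (n + Suc m + 1) \<le> potential s + 5 * card (insert u' D))"
      by (rule spec_mono) (use J card in \<open>auto elim!: inv_mono\<close>)
  next
    assume "u' \<notin> ?In"
    then show "spec skip s'
      (\<lambda>s'' m. inv ({?t} \<times> {v \<in> succs R ?u. \<not> (v \<in> ?In \<and> v \<in> insert u' D)}) s'' \<and>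
        potential s'' + (n + Suc m + 1) \<le> potential s + 5 * card (insert u' D))"
      by (intro spec_skip conjI) (use J card in \<open>auto elim!: inv_mono\<close>)
  qed
next
  fix s' n
  assume "inv ({(p, None, q)} \<times> {v \<in> succs R (fst p).
      \<not> (v \<in> all_of In_nodes R \<and> v \<in> succs R (fst p))}) s' \<and>
    potential s' + n \<le> potential s + 5 * card (succs R (fst p))"
  then show "inv ({(p, None, q)} \<times> {v \<in> succs R (fst p). v \<notin> all_of In_nodes R}) s' \<and>
    potential s' + (n + 1) \<le> potential s + 5 * card (succs R (fst p)) + 1"
    by (auto elim!: inv_mono)
qed (use inv in simp)

end


context conf_dist_input
begin

lemma process_calls:
  assumes t: "(p, None, q) \<in> E" "p \<in> Init"
    and inv: "inv ({(p, None, q)} \<times> {v \<in> succs R (fst p). v \<notin> all_of In_nodes R}) s"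
  shows "spec (foreach (\<lambda>_. succs R (fst p)) (visit_call p q)) s
    (\<lambda>s' n. inv ({(p, None, q)} \<times> {v \<in> succs R (fst p). v \<notin> all_of In_nodes R \<and> v \<in> range Atom}) s' \<and>
      potential s' + n \<le> potential s + 5 * card (succs R (fst p)) + 1)"
proof (rule spec_foreach[where J = "\<lambda>D s' n.
      inv ({(p, None, q)} \<times> {v \<in> succs R (fst p). v \<notin> all_of In_nodes R \<and> (v \<in> range Atom \<or> v \<notin> D)}) s' \<and>
      potential s' + n \<le> potential s + 5 * card D"])
  let ?u = "fst p" and ?t = "(p, None, q)" and ?In = "all_of In_nodes R"
  let ?X = "\<lambda>D. {?t} \<times> {v \<in> succs R ?u. v \<notin> ?In \<and> (v \<in> range Atom \<or> v \<notin> D)}"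
  have u: "?u \<in> all_of src_nodes R" using t(2) Init_subset St_src by blast
  show fin: "finite (succs R ?u)" using finite_succs[OF u] .
  fix v D s' n
  assume v: "v \<in> succs R ?u" and D: "D \<subseteq> succs R ?u" "v \<notin> D"
    and J: "inv (?X D) s' \<and> potential s' + n \<le> potential s + 5 * card D"
  have card: "card (insert v D) = Suc (card D)"
    using D fin finite_subset by (metis card_insert_disjoint)
  show "spec (visit_call p q v) s'
    (\<lambda>s'' m. inv (?X (insert v D)) s'' \<and>
      potential s'' + (n + m + 1) \<le> potential s + 5 * card (insert v D))"
  proof (cases v)
    case (Atom x)
    have "inv (?X (insert v D)) s'"
      by (rule inv_mono[of "?X D"]) (use J Atom in auto)
    then show ?thesis unfolding Atom node.case
      by (intro spec_skip) (use J card Atom in auto)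
  next
    case (Port b e)
    obtain i where i: "i < length R" "module_of R ?u = i" "?u \<in> src_nodes R i" "(?u, v) \<in> delta (R ! i)"
      "v \<in> In_nodes R i \<union> Ex_nodes R i \<union> Call_nodes R i"
      using u v by (rule succs_src)
    have call: "Port b e \<in> Call_nodes R i" using i(5) Port by simp
    obtain j where j: "j < length R" "q \<in> St" "fst q \<in> En_nodes R j" "?u \<in> src_nodes R j"
      using t(1) by (rule E_eps)
    then have ji: "j = i" using nodes_inj[of ?u j i] i node_subsets(6) by blast
    have new: "((Atom e, mh), Some b, q) \<in> E"
      using new_box_edgesI[OF i(1), of ?u b e q] i(4) j ji Port by simp
    have en: "Atom e \<in> En_nodes R (callee (R ! i) b)" "callee (R ! i) b < length R"
      using call i(1) callee_less by (auto simp: Call_nodes_def En_nodes_def)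
    have "(Atom e, mh) \<in> St" using E_states[OF new] by blast
    then have loop: "((Atom e, mh), None, (Atom e, mh)) \<in> loops" using entry_loop en by blast
    have "((Atom e, mh), Some b, q) \<notin> loops" unfolding loops_def by auto
    moreover have "wt (aut s') ?t * rweight R ?u v \<in> finsums (reach q (fst (Atom e, mh), option_list (Some b)))"
    proof (rule finsums_mult_const)
      show "wt (aut s') ?t \<in> finsums (reach q (?u, []))"
        using source_wt_sound[OF _ t(2,1)] J unfolding inv_def by blast
      show "w * rweight R ?u v \<in> reach q (fst (Atom e, mh), option_list (Some b))"
        if "w \<in> reach q (?u, [])" for w
        using reach_step[OF that call_step[OF i(1) i(4)[unfolded Port] call]] rweight_eq[OF i(4,1)]
        unfolding Port by simp
    qed
    ultimately have relax: "spec (relax ((Atom e, mh), Some b, q) (\<lambda>s. wt (aut s) ?t * rweight R ?u v)) s'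
      (\<lambda>s'' m. inv (?X D - {(?t, v)}) s'' \<and> potential s'' + m \<le> potential s' + 3)"
      using J new Port by (intro relax_spec) auto
    show ?thesis
      unfolding Port node.case
    proof (rule spec_seq, rule spec_mono[OF relax[unfolded Port]])
      fix s1 m1
      assume s1: "inv (?X D - {(?t, Port b e)}) s1 \<and> potential s1 + m1 \<le> potential s' + 3"
      \<comment> \<open>The self-loop was queued during initialization, so the enqueuing branch is
        never taken.\<close>
      then have seen: "((Atom e, mh), None, (Atom e, mh)) \<in> seen s1"
        using loop unfolding inv_def by blast
      have "inv (?X (insert (Port b e) D)) s1"
        by (rule inv_mono[of "?X D - {(?t, Port b e)}"]) (use s1 in auto)
      then show "spec (cond (\<lambda>s. ((Atom e, mh), None, (Atom e, mh)) \<notin> seen s)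
            (enqueue ((Atom e, mh), None, (Atom e, mh))) skip) s1
        (\<lambda>s'' m2. inv (?X (insert (Port b e) D)) s'' \<and>
          potential s'' + (n + (m1 + m2) + 1) \<le> potential s + 5 * card (insert (Port b e) D))"
        by (intro spec_cond spec_skip) (use s1 J card seen Port in auto)
    qed
  qed
next
  fix s' n
  assume "inv ({(p, None, q)} \<times> {v \<in> succs R (fst p).
      v \<notin> all_of In_nodes R \<and> (v \<in> range Atom \<or> v \<notin> succs R (fst p))}) s' \<and>
    potential s' + n \<le> potential s + 5 * card (succs R (fst p))"
  then show "inv ({(p, None, q)} \<times> {v \<in> succs R (fst p).
      v \<notin> all_of In_nodes R \<and> v \<in> range Atom}) s' \<and>
    potential s' + (n + 1) \<le> potential s + 5 * card (succs R (fst p)) + 1"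
    by (auto elim!: inv_mono)
qed (use inv in simp)

text \<open>Serves both occasions on which a return edge is relaxed: the drop of a summary and the
  processing of a box edge.\<close>

lemma relax_return:
  assumes "inv X s" "(q, Some b, q') \<in> E" "(q, x) \<in> exit_pairs"
  shows "spec (relax ((Port b x, mh), None, q') (\<lambda>s. wt (aut s) (q, Some b, q') * summ s q x)) s
    (\<lambda>s' n. inv (X - {((q, Some b, q'), Atom x)}) s' \<and> potential s' + n \<le> potential s + 3)"
proof (rule relax_spec[OF assms(1)])
  obtain l where l: "l < length R" "b \<in> boxes (R ! l)" "fst q \<in> En_nodes R (callee (R ! l) b)"
    "q' \<in> St" "fst q' \<in> En_nodes R l"
    using assms(2) by (rule E_box)
  then have "module_of R (fst q) = callee (R ! l) b"
    using module_of_eq callee_less node_subsets(2) by blast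
  then have "Port b x \<in> Ret_nodes R l"
    using assms(3) l(2) by (auto simp: Ret_nodes_def exit_pairs_def)
  then show "((Port b x, mh), None, q') \<in> E"
    using new_eps_edgesI[of l "Port b x" q'] l unfolding E_def by blast
  show "((Port b x, mh), None, q') \<notin> loops"
    unfolding loops_def all_of_def by (auto simp: En_nodes_def)
  have "wt_sound (aut s)" "summ s q x \<in> finsums (exit_reach q x)"
    using assms(1,3) unfolding inv_def by auto
  from exit_sound[OF this(1) assms(2,3) this(2)]
  show "wt (aut s) (q, Some b, q') * summ s q x
    \<in> finsums (reach q' (fst (Port b x, mh), option_list None))" by simp
qed auto

text \<open>A lower summary raises the demand on every box edge leaving \<open>q\<close>, including
  those of \<open>C\<close>, so all of them become pending for this exit. The drop in rank releases
  4 units for each of them, enough to relax its return edge.\<close>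

lemma summ_update:
  assumes inv: "inv X s" and t: "(p, None, q) \<in> E" "p \<in> Init"
    and x: "Atom x \<in> succs R (fst p)" "Atom x \<notin> all_of In_nodes R"
    and less: "\<not> summ s q x \<sqsubseteq> wt (aut s) (p, None, q)"
    and s': "s' = s\<lparr>summ := (summ s)(q := (summ s q)(x := summ s q x + wt (aut s) (p, None, q)))\<rparr>"
  shows "(q, x) \<in> exit_pairs"
    and "inv (X - {((p, None, q), Atom x)} \<union> (\<lambda>(b, q'). ((q, Some b, q'), Atom x)) ` box_succs q) s'"
    and "potential s' + 4 * card (box_succs q) \<le> potential s"
proof -
  let ?t = "(p, None, q)"
  let ?Y = "X \<union> (\<lambda>(b, q'). ((q, Some b, q'), Atom x)) ` box_succs q"
  define w where "w = summ s q x + wt (aut s) ?t"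
  have parts: "skeleton (aut s)" "wt_sound (aut s)" "wl_ok s" "loops \<subseteq> seen s" "closed X s"
    "\<forall>(q, x)\<in>exit_pairs. summ s q x \<in> finsums (exit_reach q x)"
    using inv unfolding inv_def by auto
  have fields: "aut s' = aut s" "wl s' = wl s" "seen s' = seen s"
    "summ s' q' x' = (if q' = q \<and> x' = x then w else summ s q' x')" for q' x'
    unfolding s' w_def by auto
  have w: "w \<sqsubseteq> summ s q x" "w \<sqsubseteq> wt (aut s) ?t" "w \<noteq> summ s q x"
    using less sqle_update_eq[of "summ s q x" "wt (aut s) ?t"] by (auto simp: w_def)
  have u: "fst p \<in> all_of src_nodes R" using t(2) Init_subset St_src by blast
  obtain i where i: "i < length R" "module_of R (fst p) = i" "fst p \<in> src_nodes R i"
    "(fst p, Atom x) \<in> delta (R ! i)" "Atom x \<in> In_nodes R i \<union> Ex_nodes R i \<union> Call_nodes R i"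
    using u x(1) by (rule succs_src)
  have ex: "Atom x \<in> Ex_nodes R i" using i x(2) unfolding all_of_def by auto
  obtain j where j: "j < length R" "q \<in> St" "fst q \<in> En_nodes R j" "fst p \<in> src_nodes R j"
    using t(1) by (rule E_eps)
  then have ji: "j = i" using nodes_inj[of "fst p" j i] i node_subsets(6) by blast
  show pair: "(q, x) \<in> exit_pairs" using exit_pairsI j ji i(1) ex by blast
  have "wt (aut s) ?t \<in> finsums (reach q (fst p, []))"
    using source_wt_sound[OF parts(2) t(2,1)] .
  moreover have "reach q (fst p, []) \<subseteq> exit_reach q x"
    using i(1,4) ex unfolding exit_reach_def by blast
  ultimately have "wt (aut s) ?t \<in> finsums (exit_reach q x)" by (rule finsums_mono)
  then have "w \<in> finsums (exit_reach q x)"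
    unfolding w_def using parts(6) pair by (intro finsums_add) auto
  then have sound: "\<forall>(q, x)\<in>exit_pairs. summ s' q x \<in> finsums (exit_reach q x)"
    using parts(6) by (auto simp: fields)
  have "closed ?Y s'"
  proof (rule closed_mono[OF parts(5)])
    fix p' b q' x' assume "(p', Some b, q') \<in> E"
    then show "summ s' p' x' = summ s p' x' \<or> ((p', Some b, q'), Atom x') \<in> ?Y"
      by (cases "p' = q \<and> x' = x") (force simp: fields box_succs_def)+
  qed (use w in \<open>auto simp: fields\<close>)
  then have "inv ?Y s'"
    using parts sound unfolding inv_def wl_ok_def fields by blast
  then show "inv (X - {(?t, Atom x)} \<union> (\<lambda>(b, q'). ((q, Some b, q'), Atom x)) ` box_succs q) s'"
  proof (rule inv_discharge)
    fix t' v
    assume "(t', v) \<in> ?Y"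
      "(t', v) \<notin> X - {(?t, Atom x)} \<union> (\<lambda>(b, q'). ((q, Some b, q'), Atom x)) ` box_succs q"
    then have "t' = ?t" "v = Atom x" by auto
    then show "t' \<in> wl s' \<or> obligation s' t' v"
      using w(2) x(2) by (simp add: fields)
  qed
  have rank: "rank w + 1 \<le> rank (summ s q x)" using rank_strict_mono[OF height w(1,3)] by simp
  define f where "f s'' = (\<lambda>(q', x'). 4 * card (box_succs q') * rank (summ s'' q' x'))"
    for s'' :: "('b, 'v, 'd) store"
  have split: "sum (f s'') exit_pairs = f s'' (q, x) + sum (f s'') (exit_pairs - {(q, x)})" for s''
    using finite_exit_pairs pair by (rule sum.remove)
  have "f s' (q, x) + 4 * card (box_succs q) \<le> f s (q, x)"
    using mult_le_mono2[OF rank, of "4 * card (box_succs q)"] by (simp add: f_def fields algebra_simps)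
  moreover have "sum (f s') (exit_pairs - {(q, x)}) = sum (f s) (exit_pairs - {(q, x)})"
  proof (rule sum.cong)
    fix z assume z: "z \<in> exit_pairs - {(q, x)}"
    obtain q' x' where "z = (q', x')" by (cases z)
    moreover from this z have "summ s' q' x' = summ s q' x'" unfolding fields by auto
    ultimately show "f s' z = f s z" by (simp add: f_def)
  qed simp
  ultimately have "sum (f s') exit_pairs + 4 * card (box_succs q) \<le> sum (f s) exit_pairs"
    unfolding split by linarith
  then show "potential s' + 4 * card (box_succs q) \<le> potential s"
    unfolding potential_def f_def fields by simp
qed

text \<open>The 3 units cover the test, the assignment and the end of the traversal; the relaxations
  themselves are paid for by the drop of the summary.\<close>

lemma process_exit:
  assumes inv: "inv X s" and t: "(p, None, q) \<in> E" "p \<in> Init"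
    and x: "Atom x \<in> succs R (fst p)" "Atom x \<notin> all_of In_nodes R"
  shows "spec (update_summary p q x) s
    (\<lambda>s' n. inv (X - {((p, None, q), Atom x)}) s' \<and> potential s' + n \<le> potential s + 3)"
proof (rule spec_cond)
  let ?t = "(p, None, q)"
  define s1 where "s1 = s\<lparr>summ := (summ s)(q := (summ s q)(x := summ s q x + wt (aut s) ?t))\<rparr>"
  let ?X = "X - {(?t, Atom x)}" and ?e = "\<lambda>(b, q'). ((q, Some b, q'), Atom x)"
  assume "Atom x \<in> all_of Ex_nodes R \<and> \<not> summ s q x \<sqsubseteq> wt (aut s) ?t"
  then have "\<not> summ s q x \<sqsubseteq> wt (aut s) ?t" by blast
  note s1 = summ_update[OF inv t x this s1_def]
  have edges: "{(b, q'). (q, Some b, q') \<in> edges (aut s1)} = box_succs q"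
    using s1(2) unfolding inv_def skeleton_def box_succs_def by blast
  show "spec (assign (\<lambda>s. s\<lparr>summ := (summ s)(q := (summ s q)(x := summ s q x + wt (aut s) ?t))\<rparr>) ;;
       foreach (\<lambda>s. {(b, q'). (q, Some b, q') \<in> edges (aut s)}) (\<lambda>(b, q').
         relax ((Port b x, mh), None, q') (\<lambda>s. wt (aut s) (q, Some b, q') * summ s q x))) s
    (\<lambda>s' n. inv ?X s' \<and> potential s' + Suc n \<le> potential s + 3)"
    unfolding s1_def[symmetric]
  proof (intro spec_seq spec_assign, fold s1_def, rule spec_foreach[where J = "\<lambda>D s' n.
      inv (?X \<union> ?e ` (box_succs q - D)) s' \<and> potential s' + n \<le> potential s1 + 4 * card D"],
      unfold edges)
    show "finite (box_succs q)" by (rule finite_box_succs)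
    show "inv (?X \<union> ?e ` (box_succs q - {})) s1 \<and> potential s1 + 0 \<le> potential s1 + 4 * card {}"
      using s1(2) by simp
  next
    fix z D s' n
    assume z: "z \<in> box_succs q" "D \<subseteq> box_succs q" "z \<notin> D"
      and J: "inv (?X \<union> ?e ` (box_succs q - D)) s' \<and> potential s' + n \<le> potential s1 + 4 * card D"
    obtain b q' where bq: "z = (b, q')" by (cases z)
    have card: "card (insert z D) = Suc (card D)"
      using z finite_box_succs finite_subset by (metis card_insert_disjoint)
    have "(q, Some b, q') \<in> E" using z(1) bq unfolding box_succs_def by simp
    from relax_return[OF conjunct1[OF J] this s1(1)]
    show "spec (case z of (b, q') \<Rightarrow>
         relax ((Port b x, mh), None, q') (\<lambda>s. wt (aut s) (q, Some b, q') * summ s q x)) s'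
      (\<lambda>s'' m. inv (?X \<union> ?e ` (box_succs q - insert z D)) s'' \<and>
        potential s'' + (n + m + 1) \<le> potential s1 + 4 * card (insert z D))"
      unfolding bq prod.case
    proof (rule spec_mono)
      fix s'' m
      assume s'': "inv (?X \<union> ?e ` (box_succs q - D) - {((q, Some b, q'), Atom x)}) s'' \<and>
        potential s'' + m \<le> potential s' + 3"
      have "inv (?X \<union> ?e ` (box_succs q - insert (b, q') D)) s''"
        by (rule inv_mono[OF conjunct1[OF s'']]) auto
      then show "inv (?X \<union> ?e ` (box_succs q - insert (b, q') D)) s'' \<and>
        potential s'' + (n + m + 1) \<le> potential s1 + 4 * card (insert (b, q') D)"
        using s'' J card bq by simp
    qed
  next
    fix s' n
    assume "inv (?X \<union> ?e ` (box_succs q - box_succs q)) s' \<and>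
      potential s' + n \<le> potential s1 + 4 * card (box_succs q)"
    then show "inv ?X s' \<and> potential s' + Suc (1 + (n + 1)) \<le> potential s + 3"
      using s1(3) by simp
  qed
next
  let ?t = "(p, None, q)"
  assume "\<not> (Atom x \<in> all_of Ex_nodes R \<and> \<not> summ s q x \<sqsubseteq> wt (aut s) ?t)"
  \<comment> \<open>A successor that is an \<open>Atom\<close> but not internal must be an exit, so
    the test can only have failed because the summary already absorbs the weight.\<close>
  moreover have "Atom x \<in> all_of Ex_nodes R"
  proof -
    have u: "fst p \<in> all_of src_nodes R" using t(2) Init_subset St_src by blast
    obtain i where "i < length R" "Atom x \<in> In_nodes R i \<union> Ex_nodes R i \<union> Call_nodes R i"
      using u x(1) by (rule succs_src)
    then show ?thesis using x(2) unfolding all_of_def by auto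
  qed
  ultimately have "summ s q x \<sqsubseteq> wt (aut s) ?t" by blast
  then have "inv (X - {(?t, Atom x)}) s"
    by (intro inv_discharge[OF inv]) (use x(2) in auto)
  then show "spec skip s (\<lambda>s' n. inv (X - {(?t, Atom x)}) s' \<and> potential s' + Suc n \<le> potential s + 3)"
    by (intro spec_skip) simp
qed

lemma process_exits:
  assumes t: "(p, None, q) \<in> E" "p \<in> Init"
    and inv: "inv ({(p, None, q)} \<times> {v \<in> succs R (fst p). v \<notin> all_of In_nodes R \<and> v \<in> range Atom}) s"
  shows "spec (foreach (\<lambda>_. succs R (fst p)) (visit_exit p q)) s
    (\<lambda>s' n. inv {} s' \<and> potential s' + n \<le> potential s + 4 * card (succs R (fst p)) + 1)"
proof (rule spec_foreach[where J = "\<lambda>D s' n.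
      inv ({(p, None, q)} \<times> {v \<in> succs R (fst p). v \<notin> all_of In_nodes R \<and> v \<in> range Atom \<and> v \<notin> D}) s' \<and>
      potential s' + n \<le> potential s + 4 * card D"])
  let ?u = "fst p" and ?t = "(p, None, q)" and ?In = "all_of In_nodes R"
  let ?X = "\<lambda>D. {?t} \<times> {v \<in> succs R ?u. v \<notin> ?In \<and> v \<in> range Atom \<and> v \<notin> D}"
  have u: "?u \<in> all_of src_nodes R" using t(2) Init_subset St_src by blast
  show fin: "finite (succs R ?u)" using finite_succs[OF u] .
  fix v D s' n
  assume v: "v \<in> succs R ?u" and D: "D \<subseteq> succs R ?u" "v \<notin> D"
    and J: "inv (?X D) s' \<and> potential s' + n \<le> potential s + 4 * card D"
  have card: "card (insert v D) = Suc (card D)"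
    using D fin finite_subset by (metis card_insert_disjoint)
  show "spec (visit_exit p q v) s'
    (\<lambda>s'' m. inv (?X (insert v D)) s'' \<and>
      potential s'' + (n + m + 1) \<le> potential s + 4 * card (insert v D))"
  proof (cases v)
    case (Port b e)
    have "inv (?X (insert v D)) s'"
      by (rule inv_mono[of "?X D"]) (use J Port in auto)
    then show ?thesis unfolding Port node.case
      by (intro spec_skip) (use J card Port in auto)
  next
    case (Atom x)
    show ?thesis
    proof (cases "Atom x \<in> ?In")
      case True
      \<comment> \<open>Internal nodes are skipped by this traversal and are no longer
        pending.\<close>
      then obtain k where k: "k < length R" "Atom x \<in> In_nodes R k" unfolding all_of_def by blast
      then have "Atom x \<notin> all_of Ex_nodes R"
        using In_not_Ex unfolding all_of_def by blast
      moreover have "inv (?X (insert v D)) s'"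
        by (rule inv_mono[of "?X D"]) (use J Atom True in auto)
      ultimately show ?thesis unfolding Atom node.case
        by (intro spec_cond spec_skip) (use J card Atom in auto)
    next
      case False
      have "spec (update_summary p q x) s'
        (\<lambda>s'' m. inv (?X D - {(?t, Atom x)}) s'' \<and> potential s'' + m \<le> potential s' + 3)"
        using process_exit[OF conjunct1[OF J] t _ False] v Atom by simp
      then show ?thesis unfolding Atom node.case
      proof (rule spec_mono)
        fix s'' m
        assume s'': "inv (?X D - {(?t, Atom x)}) s'' \<and> potential s'' + m \<le> potential s' + 3"
        have "inv (?X (insert (Atom x) D)) s''"
          by (rule inv_mono[OF conjunct1[OF s'']]) auto
        then show "inv (?X (insert (Atom x) D)) s'' \<and>
            potential s'' + (n + m + 1) \<le> potential s + 4 * card (insert (Atom x) D)"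
          using s'' J card Atom by simp
      qed
    qed
  qed
next
  fix s' n
  assume "inv ({(p, None, q)} \<times> {v \<in> succs R (fst p).
      v \<notin> all_of In_nodes R \<and> v \<in> range Atom \<and> v \<notin> succs R (fst p)}) s' \<and>
    potential s' + n \<le> potential s + 4 * card (succs R (fst p))"
  then show "inv {} s' \<and> potential s' + (n + 1) \<le> potential s + 4 * card (succs R (fst p)) + 1"
    by (auto elim!: inv_mono)
qed (use inv in simp)

lemma process_eps_spec:
  assumes t: "(p, None, q) \<in> E" "p \<in> Init" and inv: "inv ({(p, None, q)} \<times> succs R (fst p)) s"
  shows "spec (process_eps R mh p q) s
    (\<lambda>s' n. inv {} s' \<and> potential s' + n \<le> potential s + 14 * card (succs R (fst p)) + 3)"
  unfolding process_eps_def Let_def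
proof (rule spec_seq, rule spec_mono[OF process_internal[OF t inv]], rule spec_seq)
  fix s1 n1
  assume s1: "inv ({(p, None, q)} \<times> {v \<in> succs R (fst p). v \<notin> all_of In_nodes R}) s1 \<and>
      potential s1 + n1 \<le> potential s + 5 * card (succs R (fst p)) + 1"
  show "spec (foreach (\<lambda>_. succs R (fst p)) (visit_call p q)) s1
    (\<lambda>s2 n2. spec (foreach (\<lambda>_. succs R (fst p)) (visit_exit p q)) s2
      (\<lambda>s' n. inv {} s' \<and>
        potential s' + (n1 + (n2 + n)) \<le> potential s + 14 * card (succs R (fst p)) + 3))"
  proof (rule spec_mono[OF process_calls[OF t conjunct1[OF s1]]])
    fix s2 n2
    assume s2: "inv ({(p, None, q)} \<times> {v \<in> succs R (fst p). v \<notin> all_of In_nodes R \<and> v \<in> range Atom}) s2 \<and>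
      potential s2 + n2 \<le> potential s1 + 5 * card (succs R (fst p)) + 1"
    show "spec (foreach (\<lambda>_. succs R (fst p)) (visit_exit p q)) s2
      (\<lambda>s' n. inv {} s' \<and>
        potential s' + (n1 + (n2 + n)) \<le> potential s + 14 * card (succs R (fst p)) + 3)"
      by (rule spec_mono[OF process_exits[OF t conjunct1[OF s2]]]) (use s1 s2 in simp)
  qed
qed

section \<open>Processing a box transition, and one full iteration\<close>

lemma process_box_spec:
  assumes t: "(p, Some b, q) \<in> E" "snd p = mh"
    and inv: "inv ({(p, Some b, q)} \<times> targets (p, Some b, q)) s"
  shows "spec (process_box R mh p b q) s
    (\<lambda>s' n. inv {} s' \<and> potential s' + n \<le> potential s + 4 * theta_x R + 1)"
  unfolding process_box_def
proof (rule spec_foreach[where J = "\<lambda>D s' n.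
      inv ({(p, Some b, q)} \<times> Atom ` (exits (R ! module_of R (fst p)) - D)) s' \<and>
      potential s' + n \<le> potential s + 4 * card D"])
  let ?t = "(p, Some b, q)" and ?ex = "exits (R ! module_of R (fst p))"
  obtain i where i: "i < length R" "b \<in> boxes (R ! i)" "fst p \<in> En_nodes R (callee (R ! i) b)"
    "p \<in> St" using t(1) by (rule E_box)
  then have len: "callee (R ! i) b < length R" using callee_less by blast
  then have mod: "module_of R (fst p) = callee (R ! i) b"
    using module_of_eq i(3) node_subsets(2) by blast
  show fin: "finite ?ex" using finite_exits len mod by simp
  \<comment> \<open>The program reads the summary at the marked copy of the entry, the obligation
    reads it at \<open>p\<close>; they agree as queued box edges have marked sources.\<close>
  have p: "(fst p, mh) = p" using t(2) by (cases p) simp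
  {
    fix x D s' n
    assume x: "x \<in> ?ex" "D \<subseteq> ?ex" "x \<notin> D"
      and J: "inv ({?t} \<times> Atom ` (?ex - D)) s' \<and> potential s' + n \<le> potential s + 4 * card D"
    have card: "card (insert x D) = Suc (card D)"
      using x fin finite_subset by (metis card_insert_disjoint)
    have "(p, x) \<in> exit_pairs"
      using exit_pairsI[OF i(4,3) len] x(1) mod by (simp add: Ex_nodes_def)
    from relax_return[OF conjunct1[OF J] t(1) this]
    show "spec (relax ((Port b x, mh), None, q)
        (\<lambda>s. wt (aut s) ?t * summ s (fst p, mh) x)) s'
      (\<lambda>s'' m. inv ({?t} \<times> Atom ` (?ex - insert x D)) s'' \<and>
        potential s'' + (n + m + 1) \<le> potential s + 4 * card (insert x D))"
      unfolding p
    proof (rule spec_mono)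
      fix s'' m
      assume s'': "inv ({?t} \<times> Atom ` (?ex - D) - {(?t, Atom x)}) s'' \<and>
        potential s'' + m \<le> potential s' + 3"
      have "inv ({?t} \<times> Atom ` (?ex - insert x D)) s''"
        by (rule inv_mono[OF conjunct1[OF s'']]) auto
      then show "inv ({?t} \<times> Atom ` (?ex - insert x D)) s'' \<and>
          potential s'' + (n + m + 1) \<le> potential s + 4 * card (insert x D)"
        using s'' J card by simp
    qed
  }
  fix s' n
  have "card ?ex \<le> theta_x R" using card_exits_le len mod by simp
  moreover assume "inv ({?t} \<times> Atom ` (?ex - ?ex)) s' \<and> potential s' + n \<le> potential s + 4 * card ?ex"
  ultimately show "inv {} s' \<and> potential s' + (n + 1) \<le> potential s + 4 * theta_x R + 1"
    by simp
qed (use inv in simp)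

text \<open>Leaving the worklist turns everything \<open>t\<close> owes into pending pairs and
  releases \<open>cost t\<close>, the budget for processing it.\<close>

lemma extract_transition:
  assumes inv: "inv {} s" and t: "t \<in> wl s" and s': "s' = s\<lparr>wl := wl s - {t}\<rparr>"
  shows "inv ({t} \<times> targets t) s'" and "potential s' + cost t \<le> potential s"
proof -
  have parts: "skeleton (aut s)" "wt_sound (aut s)" "wl_ok s" "loops \<subseteq> seen s" "closed {} s"
    "\<forall>(q, x)\<in>exit_pairs. summ s q x \<in> finsums (exit_reach q x)"
    using inv unfolding inv_def by auto
  have fields: "aut s' = aut s" "wl s' = wl s - {t}" "seen s' = seen s" "summ s' = summ s"
    unfolding s' by simp_all
  have same: "obligation s' = obligation s"
  proof (intro ext)
    show "obligation s' t v = obligation s t v" for t v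
      by (cases "(s, t, v)" rule: obligation.cases) (auto simp: fields)
  qed
  have "closed ({t} \<times> targets t) s'"
    using parts(5) unfolding closed_def fields same by blast
  moreover have "wl_ok s'" using parts(3) unfolding wl_ok_def fields by blast
  ultimately show "inv ({t} \<times> targets t) s'" using parts unfolding inv_def fields by blast
  have E: "t \<in> E" using parts(3) t unfolding wl_ok_def by blast
  define f where "f s'' = (\<lambda>t. cost t * (rank (wt (aut s'') t) + of_bool (t \<in> wl s'')))"
    for s'' :: "('b, 'v, 'd) store"
  have split: "sum (f s'') E = f s'' t + sum (f s'') (E - {t})" for s''
    using finite_E E by (rule sum.remove)
  have "f s' t + cost t = f s t" using t by (simp add: f_def fields algebra_simps)
  moreover have "sum (f s') (E - {t}) = sum (f s) (E - {t})"
    by (rule sum.cong) (auto simp: f_def fields)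
  ultimately have "sum (f s') E + cost t = sum (f s) E" unfolding split by linarith
  then show "potential s' + cost t \<le> potential s"
    unfolding potential_def f_def fields by simp
qed

lemma iteration_spec:
  assumes inv: "inv {} s" and ne: "wl s \<noteq> {}"
  shows "spec (iteration R mh) s (\<lambda>s' n. inv {} s' \<and> potential s' + n + 1 \<le> potential s)"
  unfolding iteration_def
proof (rule spec_pick[where A = wl, OF ne], intro spec_seq spec_assign)
  fix t assume t: "t \<in> wl s"
  define s1 where "s1 = s\<lparr>wl := wl s - {t}\<rparr>"
  note s1 = extract_transition[OF inv t s1_def]
  obtain p a q where pq: "t = (p, a, q)" by (cases t)
  have wl: "t \<in> E" "p \<in> Init" "a \<noteq> None \<Longrightarrow> snd p = mh"
    using inv t pq unfolding inv_def wl_ok_def by auto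
  have "spec (case t of (p, None, q) \<Rightarrow> process_eps R mh p q
      | (p, Some b, q) \<Rightarrow> process_box R mh p b q) s1
    (\<lambda>s' n. inv {} s' \<and> potential s' + Suc (1 + n) + 1 \<le> potential s)"
  proof (cases a)
    case None
    have "inv ({(p, None, q)} \<times> succs R (fst p)) s1" using s1(1) wl(2) pq None by simp
    from process_eps_spec[OF _ wl(2) this] wl(1) pq None
    have "spec (process_eps R mh p q) s1
      (\<lambda>s' n. inv {} s' \<and> potential s' + n \<le> potential s1 + 14 * card (succs R (fst p)) + 3)"
      by simp
    then show ?thesis unfolding pq None prod.case option.case
      by (rule spec_mono) (use s1(2) pq None in \<open>simp add: cost_def\<close>)
  next
    case (Some b)
    from process_box_spec[of p b q s1] s1(1) wl pq Some
    have "spec (process_box R mh p b q) s1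
      (\<lambda>s' n. inv {} s' \<and> potential s' + n \<le> potential s1 + 4 * theta_x R + 1)"
      by simp
    then show ?thesis unfolding pq Some prod.case option.case
      by (rule spec_mono) (use s1(2) pq Some in \<open>simp add: cost_def\<close>)
  qed
  then show "spec (case t of (p, None, q) \<Rightarrow> process_eps R mh p q
      | (p, Some b, q) \<Rightarrow> process_box R mh p b q) (s\<lparr>wl := wl s - {t}\<rparr>)
    (\<lambda>s' n. inv {} s' \<and> potential s' + Suc (1 + n) + 1 \<le> potential s)"
    unfolding s1_def .
qed

end


section \<open>Preprocessing and initialization\<close>

context conf_dist_input
begin

text \<open>Self-loops are distinct from all other added edges, so one function gives the weight of
  each added edge independently of the order of insertion.\<close>

definition start_wt :: "('b, 'v) edge \<Rightarrow> 'd" where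
  "start_wt t = (if t \<in> loops then 1 else 0)"

text \<open>This and the next three operations give the effect of a whole set of updates at once;
  nested loops over arbitrary orders thereby reduce to unions.\<close>

definition with_marks :: "('b, 'v) node set \<Rightarrow> ('b, 'v, 'd) store \<Rightarrow> ('b, 'v, 'd) store" where
  "with_marks D s = s\<lparr>aut := (aut s)\<lparr>states := states (aut s) \<union> D \<times> {mh},
     initial := initial (aut s) \<union> D \<times> {mh}\<rparr>\<rparr>"

definition with_edges :: "('b, 'v) edge set \<Rightarrow> ('b, 'v, 'd) store \<Rightarrow> ('b, 'v, 'd) store" where
  "with_edges X s = s\<lparr>aut := (aut s)\<lparr>edges := edges (aut s) \<union> X,
     wt := (\<lambda>t. if t \<in> X then start_wt t else wt (aut s) t)\<rparr>\<rparr>"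

definition with_queue :: "('b, 'v) edge set \<Rightarrow> ('b, 'v, 'd) store \<Rightarrow> ('b, 'v, 'd) store" where
  "with_queue X s = s\<lparr>wl := wl s \<union> X, seen := seen s \<union> X\<rparr>"

definition with_zeros :: "(('b, 'v) state \<times> 'v) set \<Rightarrow> ('b, 'v, 'd) store \<Rightarrow> ('b, 'v, 'd) store" where
  "with_zeros X s = s\<lparr>summ := (\<lambda>q x. if (q, x) \<in> X then 0 else summ s q x)\<rparr>"

lemma with_empty [simp]:
  "with_marks {} s = s" "with_edges {} s = s" "with_queue {} s = s" "with_zeros {} s = s"
  by (simp_all add: with_marks_def with_edges_def with_queue_def with_zeros_def)

lemma add_edge_spec:
  assumes "start_wt t = v"
  shows "spec (add_edge t v) (with_edges Y s)
    (\<lambda>s' n. s' = with_edges (Y \<union> {t}) s \<and> n \<le> 1)"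
proof -
  have "with_edges (Y \<union> {t}) s = (with_edges Y s)\<lparr>aut := (aut (with_edges Y s))
    \<lparr>edges := insert t (edges (aut (with_edges Y s))),
     wt := (wt (aut (with_edges Y s)))(t := v)\<rparr>\<rparr>"
    using assms by (auto simp: with_edges_def fun_eq_iff)
  then show ?thesis
    unfolding add_edge_def by (intro spec_assign) simp
qed

text \<open>Adding edges does not influence what is traversed, which is the first premise. The set
  \<open>Y\<close> of edges already present is arbitrary, so the rule applies again inside the loop
  body.\<close>

lemma foreach_edges_spec:
  assumes "\<And>Y. A (with_edges Y s) = B" "finite B"
    and "\<And>x Y. x \<in> B \<Longrightarrow> spec (c x) (with_edges Y s)
      (\<lambda>s' n. s' = with_edges (Y \<union> F x) s \<and> n \<le> f x)"
  shows "spec (foreach A c) (with_edges Y s)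
    (\<lambda>s' n. s' = with_edges (Y \<union> (\<Union>x\<in>B. F x)) s \<and> n \<le> 1 + (\<Sum>x\<in>B. 1 + f x))"
proof -
  let ?g = "\<lambda>D. with_edges (Y \<union> (\<Union>x\<in>D. F x)) s"
  have "spec (foreach A c) (?g {})
    (\<lambda>s' n. s' = ?g (A (?g {})) \<and> n \<le> 1 + (\<Sum>x\<in>A (?g {}). 1 + f x))"
  proof (rule spec_foreach_state)
    fix x D assume "x \<in> A (?g {})"
    then have "x \<in> B" using assms(1) by simp
    from assms(3)[OF this, of "Y \<union> (\<Union>x\<in>D. F x)"]
    show "spec (c x) (?g D) (\<lambda>s' n. s' = ?g (insert x D) \<and> n \<le> f x)"
      by (simp add: Un_ac)
  qed (use assms(1,2) in simp)
  then show ?thesis using assms(1) by simp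
qed

definition loops_at :: "('b, 'v) node set \<Rightarrow> ('b, 'v) edge set" where
  "loops_at D = (\<lambda>u. ((u, mh), None, (u, mh))) ` (D \<inter> all_of En_nodes R)"

lemma add_marks_spec:
  "spec (foreach (\<lambda>_. all_of src_nodes R) (\<lambda>u.
       add_state (u, mh) ;;
       cond (\<lambda>_. u \<in> all_of En_nodes R) (add_edge ((u, mh), None, (u, mh)) 1) skip)) s
    (\<lambda>s' n. s' = with_edges loops (with_marks (all_of src_nodes R) s) \<and>
      n \<le> 1 + (\<Sum>u\<in>all_of src_nodes R. 1 + 3))"
proof -
  let ?g = "\<lambda>D. with_edges (loops_at D) (with_marks D s)"
  let ?c = "\<lambda>u. add_state (u, mh) ;;
       cond (\<lambda>_. u \<in> all_of En_nodes R) (add_edge ((u, mh), None, (u, mh)) 1) skip"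
  have "spec (foreach (\<lambda>_. all_of src_nodes R) ?c) (?g {})
    (\<lambda>s' n. s' = ?g (all_of src_nodes R) \<and> n \<le> 1 + (\<Sum>u\<in>all_of src_nodes R. 1 + 3))"
  proof (rule spec_foreach_state)
    fix u :: "('b, 'v) node" and D :: "('b, 'v) node set"
    let ?t = "((u, mh), None, (u, mh))"
    \<comment> \<open>Adding a state commutes with adding the self-loops of earlier nodes.\<close>
    have step: "(?g D)\<lparr>aut := (aut (?g D))\<lparr>states := insert (u, mh) (states (aut (?g D))),
        initial := insert (u, mh) (initial (aut (?g D)))\<rparr>\<rparr>
      = with_edges (loops_at D) (with_marks (insert u D) s)"
      by (rule store.equality, rule raut.equality) (simp_all add: with_edges_def with_marks_def cong: if_cong)
    show "spec (?c u) (?g D) (\<lambda>s' n. s' = ?g (insert u D) \<and> n \<le> 3)"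
      unfolding add_state_def
    proof (intro spec_seq spec_assign, unfold step, rule spec_cond)
      assume u: "u \<in> all_of En_nodes R"
      then have one: "start_wt ?t = 1" by (simp add: start_wt_def loops_def)
      have "loops_at (insert u D) = loops_at D \<union> {?t}" using u by (auto simp: loops_at_def)
      then show "spec (add_edge ?t 1) (with_edges (loops_at D) (with_marks (insert u D) s))
          (\<lambda>s' n. s' = ?g (insert u D) \<and> 1 + Suc n \<le> 3)"
        by (intro spec_mono[OF add_edge_spec[OF one]]) auto
    next
      assume "u \<notin> all_of En_nodes R"
      then have "loops_at (insert u D) = loops_at D" by (simp add: loops_at_def)
      then show "spec skip (with_edges (loops_at D) (with_marks (insert u D) s))
          (\<lambda>s' n. s' = ?g (insert u D) \<and> 1 + Suc n \<le> 3)"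
        by (intro spec_skip) simp
    qed
  qed (rule finite_src)
  moreover have "loops_at {} = {}" "with_marks {} s = s" by (simp_all add: loops_at_def)
  moreover have "loops_at (all_of src_nodes R) = loops"
    using En_subset_src by (simp add: loops_at_def loops_def Int_absorb1)
  ultimately show ?thesis by simp
qed

definition marked_store :: "('b, 'v, 'd) store" where
  "marked_store = with_marks (all_of src_nodes R) (start_store C)"

lemma marked_store_simps [simp]:
  "states (aut (with_edges Y marked_store)) = St"
  "initial (aut (with_edges Y marked_store)) = Init"
  "final (aut (with_edges Y marked_store)) = final C"
  "edges (aut (with_edges Y marked_store)) = edges C \<union> Y"
  "wt (aut (with_edges Y marked_store)) t = (if t \<in> Y then start_wt t else wt C t)"
  "wl (with_edges Y marked_store) = {}"
  "seen (with_edges Y marked_store) = {}"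
  by (simp_all add: marked_store_def with_edges_def with_marks_def start_store_def St_def Init_def)

lemma Init_src: "p \<in> Init \<Longrightarrow> fst p \<in> all_of src_nodes R"
  using Init_subset St_src by blast

lemma finite_Init: "finite Init"
  using Init_subset finite_St by (rule finite_subset)

lemma finite_entry_states: "finite (entry_states u)"
  unfolding entry_states_def using finite_St by simp

lemma add_box_edges_spec:
  "spec (foreach (\<lambda>s. initial (aut s)) (\<lambda>(u, m).
       foreach (\<lambda>_. succs R u) (\<lambda>v. case v of
           Atom _ \<Rightarrow> skip
         | Port b e \<Rightarrow>
             foreach (\<lambda>s. {q \<in> states (aut s). fst q \<in> En_nodes R (module_of R u)}) (\<lambda>q.
               add_edge ((Atom e, mh), Some b, q) 0)))) (with_edges Y marked_store)
    (\<lambda>s' n. s' = with_edges (Y \<union> new_box_edges) marked_store \<and>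
      n \<le> 1 + (\<Sum>p\<in>Init. 1 + (1 + (\<Sum>v\<in>succs R (fst p). 1 + (1 + (\<Sum>q\<in>entry_states (fst p). 1 + 1))))))"
  unfolding new_box_edges_def
proof (rule foreach_edges_spec)
  fix p Y assume p: "p \<in> Init"
  obtain u m where um: "p = (u, m)" by (cases p)
  have "spec (foreach (\<lambda>_. succs R u) (\<lambda>v. case v of
           Atom _ \<Rightarrow> skip
         | Port b e \<Rightarrow>
             foreach (\<lambda>s. {q \<in> states (aut s). fst q \<in> En_nodes R (module_of R u)}) (\<lambda>q.
               add_edge ((Atom e, mh), Some b, q) 0))) (with_edges Y marked_store)
    (\<lambda>s' n. s' = with_edges (Y \<union> (\<Union>v\<in>succs R u. call_edges u v)) marked_store \<and>
      n \<le> 1 + (\<Sum>v\<in>succs R u. 1 + (1 + (\<Sum>q\<in>entry_states u. 1 + 1))))"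
  proof (rule foreach_edges_spec)
    show "finite (succs R u)" using finite_succs Init_src[OF p] um by simp
    fix v Y assume "v \<in> succs R u"
    show "spec (case v of Atom _ \<Rightarrow> skip
         | Port b e \<Rightarrow>
             foreach (\<lambda>s. {q \<in> states (aut s). fst q \<in> En_nodes R (module_of R u)}) (\<lambda>q.
               add_edge ((Atom e, mh), Some b, q) 0)) (with_edges Y marked_store)
      (\<lambda>s' n. s' = with_edges (Y \<union> call_edges u v) marked_store \<and>
        n \<le> 1 + (\<Sum>q\<in>entry_states u. 1 + 1))"
    proof (cases v)
      case (Atom x)
      then show ?thesis by (auto simp: call_edges_def intro: spec_skip)
    next
      case (Port b e)
      have call: "call_edges u v = (\<Union>q\<in>entry_states u. {((Atom e, mh), Some b, q)})"
        unfolding call_edges_def Port by auto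
      show ?thesis unfolding call unfolding Port node.case
      proof (rule foreach_edges_spec)
        show "spec (add_edge ((Atom e, mh), Some b, q) 0) (with_edges Y marked_store)
          (\<lambda>s' n. s' = with_edges (Y \<union> {((Atom e, mh), Some b, q)}) marked_store \<and> n \<le> 1)" for q Y
          by (rule add_edge_spec) (auto simp: start_wt_def loops_def)
      qed (simp_all add: entry_states_def finite_St)
    qed
  qed simp
  then show "spec (case p of (u, m) \<Rightarrow> foreach (\<lambda>_. succs R u) (\<lambda>v. case v of
           Atom _ \<Rightarrow> skip
         | Port b e \<Rightarrow>
             foreach (\<lambda>s. {q \<in> states (aut s). fst q \<in> En_nodes R (module_of R u)}) (\<lambda>q.
               add_edge ((Atom e, mh), Some b, q) 0))) (with_edges Y marked_store)
    (\<lambda>s' n. s' = with_edges (Y \<union> (\<Union>v\<in>succs R (fst p). call_edges (fst p) v)) marked_store \<and>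
      n \<le> 1 + (\<Sum>v\<in>succs R (fst p). 1 + (1 + (\<Sum>q\<in>entry_states (fst p). 1 + 1))))"
    unfolding um by simp
qed (simp_all add: finite_Init)

abbreviation St_entries :: "('b, 'v) state set" where
  "St_entries \<equiv> {q \<in> St. fst q \<in> all_of En_nodes R}"

lemma finite_inner_nodes: "q \<in> St_entries \<Longrightarrow> finite (inner_nodes q)"
  unfolding inner_nodes_def using finite_nodes[OF module_of_En(1), of "fst q"]
  by (auto intro: finite_subset[OF node_subsets(1)] finite_subset[OF node_subsets(5)])

lemma add_eps_edges_spec:
  "spec (foreach (\<lambda>s. {q \<in> states (aut s). fst q \<in> all_of En_nodes R}) (\<lambda>q.
       foreach (\<lambda>_. In_nodes R (module_of R (fst q)) \<union> Ret_nodes R (module_of R (fst q))) (\<lambda>u.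
         add_edge ((u, mh), None, q) 0))) (with_edges Y marked_store)
    (\<lambda>s' n. s' = with_edges (Y \<union> new_eps_edges) marked_store \<and>
      n \<le> 1 + (\<Sum>q\<in>St_entries. 1 + (1 + (\<Sum>u\<in>inner_nodes q. 1 + 1))))"
  unfolding new_eps_edges_def
proof (rule foreach_edges_spec)
  fix q Y assume q: "q \<in> St_entries"
  then have len: "module_of R (fst q) < length R" using module_of_En by blast
  have image: "(\<lambda>u. ((u, mh), None, q)) ` inner_nodes q = (\<Union>u\<in>inner_nodes q. {((u, mh), None, q)})"
    by auto
  show "spec (foreach (\<lambda>_. In_nodes R (module_of R (fst q)) \<union> Ret_nodes R (module_of R (fst q))) (\<lambda>u.
         add_edge ((u, mh), None, q) 0)) (with_edges Y marked_store)
    (\<lambda>s' n. s' = with_edges (Y \<union> (\<lambda>u. ((u, mh), None, q)) ` inner_nodes q) marked_store \<and>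
      n \<le> 1 + (\<Sum>u\<in>inner_nodes q. 1 + 1))"
    unfolding image
  proof (rule foreach_edges_spec)
    fix u Y assume "u \<in> inner_nodes q"
    \<comment> \<open>Hence the weight 0 is never written to a self-loop.\<close>
    then have "u \<notin> all_of En_nodes R"
      using En_not_In_Ret[OF _ _ len] unfolding all_of_def inner_nodes_def by blast
    then show "spec (add_edge ((u, mh), None, q) 0) (with_edges Y marked_store)
      (\<lambda>s' n. s' = with_edges (Y \<union> {((u, mh), None, q)}) marked_store \<and> n \<le> 1)"
      by (intro add_edge_spec) (auto simp: start_wt_def loops_def)
  qed (use q finite_inner_nodes in \<open>simp_all add: inner_nodes_def\<close>)
qed (simp_all add: finite_St)

definition preprocessed :: "('b, 'v, 'd) store" where
  "preprocessed = with_edges (loops \<union> new_box_edges \<union> new_eps_edges) marked_store"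

lemma preprocessed_simps [simp]:
  "states (aut preprocessed) = St" "initial (aut preprocessed) = Init" "edges (aut preprocessed) = E"
  "final (aut preprocessed) = final C" "wl preprocessed = {}" "seen preprocessed = {}"
  by (simp_all add: preprocessed_def E_def Un_assoc)

definition preprocess_time :: nat where
  "preprocess_time = 1 + (\<Sum>u\<in>all_of src_nodes R. 1 + 3) +
     (1 + (\<Sum>p\<in>Init. 1 + (1 + (\<Sum>v\<in>succs R (fst p). 1 + (1 + (\<Sum>q\<in>entry_states (fst p). 1 + 1)))))) +
     (1 + (\<Sum>q\<in>St_entries. 1 + (1 + (\<Sum>u\<in>inner_nodes q. 1 + 1))))"

lemma preprocess_spec:
  "spec (preprocess R mh) (start_store C) (\<lambda>s n. s = preprocessed \<and> n \<le> preprocess_time)"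
  unfolding preprocess_def
  apply (rule spec_seq)
  apply (rule spec_mono[OF add_marks_spec])
  apply (elim conjE)
  apply (simp only: marked_store_def[symmetric])
  apply (rule spec_seq)
  apply (rule spec_mono[OF add_box_edges_spec])
  apply (elim conjE)
  apply (simp only:)
  apply (rule spec_mono[OF add_eps_edges_spec])
  apply (simp add: preprocessed_def preprocess_time_def)
  done

section \<open>The initial worklist and the initial summaries\<close>

definition queued :: "('b, 'v) edge set" where
  "queued = {t \<in> E. fst t \<in> Init \<and> fst (snd t) = None \<and> wt (aut preprocessed) t = 1}"

definition eps_from :: "('b, 'v) state \<Rightarrow> ('b, 'v) edge set" where
  "eps_from p = {t \<in> E. fst t = p \<and> fst (snd t) = None}"

lemma finite_eps_from: "finite (eps_from p)"
  unfolding eps_from_def using finite_E by simp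

lemma init_queue_spec:
  "spec (foreach (\<lambda>s. initial (aut s)) (\<lambda>p.
       foreach (\<lambda>s. {t \<in> edges (aut s). fst t = p \<and> fst (snd t) = None}) (\<lambda>t.
         cond (\<lambda>s. wt (aut s) t = 1) (enqueue t) skip))) preprocessed
    (\<lambda>s' n. s' = with_queue queued preprocessed \<and> n \<le> 1 + (\<Sum>p\<in>Init. 1 + (1 + (\<Sum>t\<in>eps_from p. 1 + 2))))"
proof -
  \<comment> \<open>Queuing does not touch the automaton, so the test in the loop can be replaced by
    intersecting with a fixed set.\<close>
  let ?W = "{t. wt (aut preprocessed) t = 1}"
  let ?g = "\<lambda>D. with_queue ((\<Union>p\<in>D. eps_from p) \<inter> ?W) preprocessed"
  let ?h = "\<lambda>D D'. with_queue (((\<Union>p\<in>D. eps_from p) \<union> D') \<inter> ?W) preprocessed"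
  have queue: "aut (with_queue X preprocessed) = aut preprocessed" for X by (simp add: with_queue_def)
  have inner: "spec (foreach (\<lambda>s. {t \<in> edges (aut s). fst t = p \<and> fst (snd t) = None}) (\<lambda>t.
         cond (\<lambda>s. wt (aut s) t = 1) (enqueue t) skip)) (?h D {})
    (\<lambda>s' n. s' = ?h D ({t \<in> edges (aut (?h D {})). fst t = p \<and> fst (snd t) = None}) \<and>
      n \<le> 1 + (\<Sum>t\<in>{t \<in> edges (aut (?h D {})). fst t = p \<and> fst (snd t) = None}. 1 + 2))" for p D
  proof (rule spec_foreach_state)
    show "finite {t \<in> edges (aut (?h D {})). fst t = p \<and> fst (snd t) = None}"
      unfolding queue using finite_E by simp
    fix t D'
    show "spec (cond (\<lambda>s. wt (aut s) t = 1) (enqueue t) skip) (?h D D')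
        (\<lambda>s' n. s' = ?h D (insert t D') \<and> n \<le> 2)"
      unfolding enqueue_def
    proof (intro spec_cond spec_assign spec_skip)
      assume "wt (aut (?h D D')) t = 1"
      then have "((\<Union>p\<in>D. eps_from p) \<union> insert t D') \<inter> ?W = insert t (((\<Union>p\<in>D. eps_from p) \<union> D') \<inter> ?W)"
        unfolding queue by auto
      then show "(?h D D')\<lparr>wl := insert t (wl (?h D D')), seen := insert t (seen (?h D D'))\<rparr> =
          ?h D (insert t D') \<and> Suc 1 \<le> 2"
        by (simp add: with_queue_def)
    next
      assume "wt (aut (?h D D')) t \<noteq> 1"
      then have "((\<Union>p\<in>D. eps_from p) \<union> insert t D') \<inter> ?W = ((\<Union>p\<in>D. eps_from p) \<union> D') \<inter> ?W"
        unfolding queue by auto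
      then show "?h D D' = ?h D (insert t D') \<and> Suc 0 \<le> 2" by simp
    qed
  qed
  have "spec (foreach (\<lambda>s. initial (aut s)) (\<lambda>p.
       foreach (\<lambda>s. {t \<in> edges (aut s). fst t = p \<and> fst (snd t) = None}) (\<lambda>t.
         cond (\<lambda>s. wt (aut s) t = 1) (enqueue t) skip))) (?g {})
    (\<lambda>s' n. s' = ?g (initial (aut (?g {}))) \<and>
      n \<le> 1 + (\<Sum>p\<in>initial (aut (?g {})). 1 + (1 + (\<Sum>t\<in>eps_from p. 1 + 2))))"
  proof (rule spec_foreach_state)
    show "finite (initial (aut (?g {})))" unfolding queue by (simp add: finite_Init)
    fix p D
    show "spec (foreach (\<lambda>s. {t \<in> edges (aut s). fst t = p \<and> fst (snd t) = None}) (\<lambda>t.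
         cond (\<lambda>s. wt (aut s) t = 1) (enqueue t) skip)) (?g D)
      (\<lambda>s' n. s' = ?g (insert p D) \<and> n \<le> 1 + (\<Sum>t\<in>eps_from p. 1 + 2))"
      using inner[of p D] unfolding queue by (simp add: eps_from_def Un_ac)
  qed
  moreover have "(\<Union>p\<in>Init. eps_from p) \<inter> ?W = queued"
    by (auto simp: eps_from_def queued_def)
  ultimately show ?thesis unfolding queue by simp
qed

lemma init_summ_spec:
  assumes states: "states (aut s) = St"
  shows "spec (foreach (\<lambda>s. {q \<in> states (aut s). fst q \<in> all_of En_nodes R}) (\<lambda>q.
       foreach (\<lambda>_. exits (R ! module_of R (fst q))) (\<lambda>x.
         assign (\<lambda>s. s\<lparr>summ := (summ s)(q := (summ s q)(x := 0))\<rparr>)))) s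
    (\<lambda>s' n. s' = with_zeros exit_pairs s \<and>
      n \<le> 1 + (\<Sum>q\<in>St_entries. 1 + (1 + (\<Sum>x\<in>exits (R ! module_of R (fst q)). 1 + 1))))"
proof -
  let ?ex = "\<lambda>q. exits (R ! module_of R (fst q))"
  let ?g = "\<lambda>D. with_zeros (Sigma D ?ex) s"
  let ?h = "\<lambda>D q D'. with_zeros (Sigma D ?ex \<union> {q} \<times> D') s"
  have zeros: "aut (with_zeros X s) = aut s" for X by (simp add: with_zeros_def)
  have inner: "spec (foreach (\<lambda>_. ?ex q) (\<lambda>x.
         assign (\<lambda>s. s\<lparr>summ := (summ s)(q := (summ s q)(x := 0))\<rparr>))) (?h D q {})
    (\<lambda>s' n. s' = ?h D q (?ex q) \<and> n \<le> 1 + (\<Sum>x\<in>?ex q. 1 + 1))" if "q \<in> St_entries" for q D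
  proof (rule spec_foreach_state)
    show "finite (?ex q)" using that finite_exits module_of_En by blast
    show "spec (assign (\<lambda>s. s\<lparr>summ := (summ s)(q := (summ s q)(x := 0))\<rparr>)) (?h D q D')
      (\<lambda>s' n. s' = ?h D q (insert x D') \<and> n \<le> 1)" for x D'
      by (rule spec_assign)
        (auto simp: with_zeros_def intro!: arg_cong[where f = "\<lambda>z. s\<lparr>summ := z\<rparr>"] ext)
  qed
  have "spec (foreach (\<lambda>s. {q \<in> states (aut s). fst q \<in> all_of En_nodes R}) (\<lambda>q.
       foreach (\<lambda>_. ?ex q) (\<lambda>x.
         assign (\<lambda>s. s\<lparr>summ := (summ s)(q := (summ s q)(x := 0))\<rparr>)))) (?g {})
    (\<lambda>s' n. s' = ?g {q \<in> states (aut (?g {})). fst q \<in> all_of En_nodes R} \<and>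
      n \<le> 1 + (\<Sum>q\<in>{q \<in> states (aut (?g {})). fst q \<in> all_of En_nodes R}.
        1 + (1 + (\<Sum>x\<in>?ex q. 1 + 1))))"
  proof (rule spec_foreach_state)
    show "finite {q \<in> states (aut (?g {})). fst q \<in> all_of En_nodes R}"
      unfolding zeros states using finite_St by simp
    fix q D assume "q \<in> {q \<in> states (aut (?g {})). fst q \<in> all_of En_nodes R}"
    then have "q \<in> St_entries" unfolding zeros states .
    moreover have "Sigma (insert q D) ?ex = Sigma D ?ex \<union> {q} \<times> ?ex q" by auto
    ultimately show "spec (foreach (\<lambda>_. ?ex q) (\<lambda>x.
         assign (\<lambda>s. s\<lparr>summ := (summ s)(q := (summ s q)(x := 0))\<rparr>))) (?g D)
      (\<lambda>s' n. s' = ?g (insert q D) \<and> n \<le> 1 + (\<Sum>x\<in>?ex q. 1 + 1))"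
      using inner[of q D] by simp
  qed
  then show ?thesis unfolding zeros states exit_pairs_def by simp
qed

definition initialized :: "('b, 'v, 'd) store" where
  "initialized = with_zeros exit_pairs (with_queue queued preprocessed)"

definition setup_time :: nat where
  "setup_time = preprocess_time + (1 + (\<Sum>p\<in>Init. 1 + (1 + (\<Sum>t\<in>eps_from p. 1 + 2)))) +
     (1 + (\<Sum>q\<in>St_entries. 1 + (1 + (\<Sum>x\<in>exits (R ! module_of R (fst q)). 1 + 1))))"

lemma setup_spec:
  "spec (conf_dist_setup R mh) (start_store C) (\<lambda>s n. s = initialized \<and> n \<le> setup_time)"
  unfolding conf_dist_setup_def initialize_def
  apply (rule spec_seq)
  apply (rule spec_mono[OF preprocess_spec])
  apply (elim conjE)
  apply (simp only:)
  apply (rule spec_seq)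
  apply (rule spec_mono[OF init_queue_spec])
  apply (elim conjE)
  apply (simp only:)
  apply (rule spec_mono[OF init_summ_spec])
   apply (simp add: with_queue_def)
  apply (simp add: initialized_def setup_time_def)
  done

section \<open>Invariant and potential at the start of the main loop\<close>

lemma initialized_simps [simp]:
  "aut initialized = aut preprocessed" "wl initialized = queued" "seen initialized = queued"
  "(q, x) \<in> exit_pairs \<Longrightarrow> summ initialized q x = 0"
  by (simp_all add: initialized_def with_zeros_def with_queue_def)

lemma new_edges_marked: "(p, a, q) \<in> loops \<union> new_box_edges \<union> new_eps_edges \<Longrightarrow> snd p = mh"
  by (auto simp: loops_def elim: new_box_edges_cases new_eps_edges_cases)

text \<open>No edge of \<open>C\<close> is overwritten, because all added edges have marked
  sources.\<close>

lemma preprocessed_wt: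
  assumes "t \<in> E"
  shows "wt (aut preprocessed) t = (if t \<in> edges C \<union> loops then 1 else 0)"
proof (cases "t \<in> edges C")
  case True
  obtain p a q where t: "t = (p, a, q)" by (cases t)
  then have "t \<notin> loops \<union> new_box_edges \<union> new_eps_edges"
    using True C_edge_marks new_edges_marked by blast
  then show ?thesis using True all_one by (simp add: preprocessed_def)
next
  case False
  then have "t \<in> loops \<union> new_box_edges \<union> new_eps_edges" using assms unfolding E_def by blast
  then show ?thesis using False by (simp add: preprocessed_def start_wt_def)
qed

lemma loops_queued: "loops \<subseteq> queued"
proof
  fix t assume t: "t \<in> loops"
  then have "t \<in> E" unfolding E_def by blast
  moreover have "fst t \<in> Init" "fst (snd t) = None"
    using t En_subset_src unfolding loops_def Init_def by auto
  ultimately show "t \<in> queued" using t preprocessed_wt unfolding queued_def by simp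
qed

text \<open>An \<epsilon>-edge with initial source either weighs 1 and is queued, or weighs 0 and
  owes nothing since 0 is the top of the order. Box edges, even those of weight 1, owe nothing
  because all summaries are 0.\<close>

lemma inv_initialized: "inv {} initialized"
proof -
  have "wt_sound (aut initialized)"
    unfolding wt_sound_def
  proof (intro conjI allI impI ballI)
    show "wt (aut initialized) t = 1" if "t \<in> edges C \<union> loops" for t
      using that preprocessed_wt[of t] unfolding E_def by auto
    fix p a q assume e: "(p, a, q) \<in> E" "snd p = mh"
    show "wt (aut initialized) (p, a, q) \<in> finsums (reach q (fst p, option_list a))"
    proof (cases "(p, a, q) \<in> loops")
      case True
      then have "q = p" "a = None" unfolding loops_def by auto
      moreover have "p \<in> Init" using E_states e marked_Init by blast
      ultimately show ?thesis
        using True finsums_incl[OF reach_initial] preprocessed_wt[OF e(1)] by simp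
    next
      case False
      then have "(p, a, q) \<notin> edges C \<union> loops" using C_edge_marks e(2) by blast
      then show ?thesis using preprocessed_wt[OF e(1)] by (simp add: finsums_zero)
    qed
  qed
  moreover have "closed {} initialized"
    unfolding closed_def
  proof (intro ballI)
    fix t v assume t: "t \<in> E" "v \<in> targets t"
    obtain p a q where pq: "t = (p, a, q)" by (cases t)
    show "t \<in> wl initialized \<or> (t, v) \<in> {} \<or> obligation initialized t v"
    proof (cases a)
      case None
      then have p: "p \<in> Init" using t(2) pq by (auto split: if_splits)
      show ?thesis
      proof (cases "t \<in> edges C \<union> loops")
        case True
        then show ?thesis using t(1) p pq None preprocessed_wt[OF t(1)] by (simp add: queued_def)
      next
        case False
        then have zero: "wt (aut preprocessed) (p, None, q) = 0"
          using preprocessed_wt[OF t(1)] pq None by simp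
        show ?thesis
          unfolding pq None by (cases v) (simp_all add: zero)
      qed
    next
      case (Some b)
      then obtain x where x: "v = Atom x" "x \<in> exits (R ! module_of R (fst p))" using t(2) pq by auto
      obtain i where i: "i < length R" "b \<in> boxes (R ! i)" "fst p \<in> En_nodes R (callee (R ! i) b)"
        "p \<in> St" using t(1) unfolding pq Some by (rule E_box)
      have "fst p \<in> all_of En_nodes R" using i callee_less unfolding all_of_def by blast
      then have "(p, x) \<in> exit_pairs" using x(2) i(4) unfolding exit_pairs_def by simp
      then show ?thesis using x pq Some by simp
    qed
  qed
  moreover have "wl_ok initialized"
    unfolding wl_ok_def by (auto simp: queued_def)
  ultimately show ?thesis
    using loops_queued unfolding inv_def by (auto simp: skeleton_def finsums_zero)
qed

lemma height_pos: "0 < H"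
  using rank_less_height[OF height, of 0] by simp

text \<open>The potential with every rank, together with the worklist unit, replaced by 1; the
  height is thereby factored out.\<close>

definition potential_bound :: nat where
  "potential_bound = (\<Sum>t\<in>E. cost t) + (\<Sum>(q, x)\<in>exit_pairs. 4 * card (box_succs q))"

lemma potential_initialized: "potential initialized \<le> H * potential_bound"
proof -
  have "rank (wt (aut initialized) t) + of_bool (t \<in> wl initialized) \<le> H" for t
    using rank_less_height[OF height, of "wt (aut initialized) t"] by (simp add: Suc_le_eq)
  then have "(\<Sum>t\<in>E. cost t * (rank (wt (aut initialized) t) + of_bool (t \<in> wl initialized)))
      \<le> (\<Sum>t\<in>E. cost t * H)"
    by (intro sum_mono mult_le_mono2)
  moreover have "rank (summ initialized q x) \<le> H" for q x
    using rank_less_height[OF height, of "summ initialized q x"] by simp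
  then have "(\<Sum>(q, x)\<in>exit_pairs. 4 * card (box_succs q) * rank (summ initialized q x))
      \<le> (\<Sum>(q, x)\<in>exit_pairs. 4 * card (box_succs q) * H)"
    by (intro sum_mono) (auto simp del: initialized_simps)
  ultimately have "potential initialized \<le>
      (\<Sum>t\<in>E. cost t * H) + (\<Sum>(q, x)\<in>exit_pairs. 4 * card (box_succs q) * H)"
    unfolding potential_def by (rule add_mono)
  also have "\<dots> = H * potential_bound"
    by (simp add: potential_bound_def distrib_left sum_distrib_left mult.commute
        case_prod_unfold)
  finally show ?thesis .
qed

lemma conf_dist_spec:
  "spec (conf_dist_setup R mh ;; while (\<lambda>s. wl s \<noteq> {}) (iteration R mh)) (start_store C)
    (\<lambda>s n. inv {} s \<and> wl s = {} \<and> n \<le> setup_time + H * potential_bound + 1)"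
proof (rule spec_seq, rule spec_mono[OF setup_spec])
  fix s m assume s: "s = initialized \<and> m \<le> setup_time"
  have "spec (while (\<lambda>s. wl s \<noteq> {}) (iteration R mh)) s
      (\<lambda>s' n. inv {} s' \<and> \<not> wl s' \<noteq> {} \<and> n \<le> potential s + 1)"
    by (rule while_total(1)) (use s inv_initialized iteration_spec in auto)
  then show "spec (while (\<lambda>s. wl s \<noteq> {}) (iteration R mh)) s
      (\<lambda>s' n. inv {} s' \<and> wl s' = {} \<and> m + n \<le> setup_time + H * potential_bound + 1)"
    by (rule spec_mono) (use s potential_initialized in auto)
qed

lemma no_divergence: "\<not> conf_dist_diverges R C mh"
proof -
  have "\<not> while_diverges (\<lambda>s. wl s \<noteq> {}) (iteration R mh) initialized"
    by (rule while_total(2)[where I = "inv {}" and \<Phi> = potential])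
      (use inv_initialized iteration_spec in auto)
  then show ?thesis
    using setup_spec unfolding conf_dist_diverges_def spec_def by auto
qed

end


section \<open>The time bound\<close>

context conf_dist_input
begin

definition n_marks :: nat where
  "n_marks = card (marks C) + 1"

lemma card_insert_marks: "finite (insert mh (marks C))" "card (insert mh (marks C)) = n_marks"
  using finite_states fresh unfolding marks_def n_marks_def by simp_all

lemma St_subset: "St \<subseteq> all_of src_nodes R \<times> insert mh (marks C)"
  unfolding St_def marks_def using state_src by force

text \<open>The source of every factor \<open>theta_e R * n_marks\<close> below: an edge out of a
  given node has its target among the entry states of one module.\<close>

lemma card_entry_states:
  assumes "u \<in> all_of nodes R"
  shows "card (entry_states u) \<le> theta_e R * n_marks"
proof -
  have len: "module_of R u < length R" using assms module_of_eq unfolding all_of_def by auto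
  have "entry_states u \<subseteq> En_nodes R (module_of R u) \<times> insert mh (marks C)"
    unfolding entry_states_def using St_subset by auto
  moreover have fin: "finite (En_nodes R (module_of R u))"
    using finite_subset[OF node_subsets(2) finite_nodes[OF len]] .
  ultimately have "card (entry_states u) \<le> card (En_nodes R (module_of R u) \<times> insert mh (marks C))"
    using card_insert_marks(1) by (intro card_mono) auto
  also have "\<dots> = card (En_nodes R (module_of R u)) * n_marks"
    using card_cartesian_product card_insert_marks(2) by metis
  also have "\<dots> \<le> theta_e R * n_marks"
    unfolding theta_e_def using len by (intro mult_le_mono1 Max_ge) auto
  finally show ?thesis .
qed

lemma sum_entry_states:
  "(\<Sum>u\<in>all_of nodes R. card (entry_states u)) \<le> rsm_size R * (theta_e R * n_marks)"
proof -
  have "(\<Sum>u\<in>all_of nodes R. card (entry_states u)) \<le> card (all_of nodes R) * (theta_e R * n_marks)"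
    using sum_bounded_above[of "all_of nodes R" "\<lambda>u. card (entry_states u)"] card_entry_states by simp
  also have "\<dots> \<le> rsm_size R * (theta_e R * n_marks)"
    unfolding rsm_size_def by (intro mult_le_mono1) simp
  finally show ?thesis .
qed

lemma card_src: "card (all_of src_nodes R) \<le> rsm_size R"
proof -
  have "card (all_of src_nodes R) \<le> card (all_of nodes R)"
    using src_subset_nodes finite_all_of[of nodes] by (intro card_mono) auto
  then show ?thesis unfolding rsm_size_def by simp
qed

lemma sum_succs: "(\<Sum>u\<in>all_of src_nodes R. card (succs R u)) \<le> rsm_size R"
proof -
  have "(\<Sum>u\<in>all_of src_nodes R. card (succs R u)) = card (Sigma (all_of src_nodes R) (succs R))"
    using finite_src finite_succs by simp
  also have "\<dots> \<le> card (\<Union>i<length R. delta (R ! i))"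
  proof (rule card_mono)
    show "finite (\<Union>i<length R. delta (R ! i))" using finite_delta by blast
    show "Sigma (all_of src_nodes R) (succs R) \<subseteq> (\<Union>i<length R. delta (R ! i))"
      using module_of_src(1) unfolding succs_def by blast
  qed
  also have "\<dots> \<le> (\<Sum>i<length R. card (delta (R ! i)))" by (rule card_UN_le) simp
  finally show ?thesis unfolding rsm_size_def by simp
qed

lemma sum_states:
  assumes "S \<subseteq> St"
  shows "(\<Sum>p\<in>S. f (fst p)) \<le> n_marks * (\<Sum>u\<in>all_of src_nodes R. f u :: nat)"
proof -
  have "(\<Sum>p\<in>S. f (fst p)) \<le> (\<Sum>p\<in>all_of src_nodes R \<times> insert mh (marks C). f (fst p))"
    using assms St_subset card_insert_marks(1) finite_src by (intro sum_mono2) auto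
  also have "\<dots> = (\<Sum>u\<in>all_of src_nodes R. \<Sum>m\<in>insert mh (marks C). f u)"
    unfolding sum.cartesian_product by (rule sum.cong) auto
  also have "\<dots> = n_marks * (\<Sum>u\<in>all_of src_nodes R. f u)"
    using card_insert_marks(2) by (simp add: sum_distrib_left)
  finally show ?thesis .
qed

text \<open>\<open>rsm_size R\<close> dominates both the number of nodes and the number of
  transitions, so a cost that is linear in the out-degree sums to a multiple of it for each
  mark.\<close>

lemma sum_states_linear:
  assumes "S \<subseteq> St"
  shows "(\<Sum>p\<in>S. c + d * card (succs R (fst p))) \<le> n_marks * (rsm_size R * (c + d))"
proof -
  have "(\<Sum>p\<in>S. c + d * card (succs R (fst p)))
      \<le> n_marks * (\<Sum>u\<in>all_of src_nodes R. c + d * card (succs R u))"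
    by (rule sum_states[OF assms])
  also have "(\<Sum>u\<in>all_of src_nodes R. c + d * card (succs R u))
      = c * card (all_of src_nodes R) + d * (\<Sum>u\<in>all_of src_nodes R. card (succs R u))"
    by (simp add: sum.distrib sum_distrib_left)
  also have "\<dots> \<le> c * rsm_size R + d * rsm_size R"
    by (intro add_mono mult_le_mono2 card_src sum_succs)
  finally show ?thesis by (simp add: algebra_simps)
qed

lemma card_states: "S \<subseteq> St \<Longrightarrow> card S \<le> n_marks * rsm_size R"
  using sum_states_linear[of S 1 0] by simp

lemma St_entries_subset: "St_entries \<subseteq> St"
  by blast

lemma card_eps_from:
  assumes "p \<in> St"
  shows "card (eps_from p) \<le> theta_e R * n_marks"
proof -
  have "eps_from p \<subseteq> (\<lambda>q. (p, None, q)) ` entry_states (fst p)"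
  proof
    fix t assume "t \<in> eps_from p"
    then obtain q where t: "t = (p, None, q)" "(p, None, q) \<in> E"
      unfolding eps_from_def by (cases t) auto
    from t(2) obtain i where i: "i < length R" "q \<in> St" "fst q \<in> En_nodes R i" "fst p \<in> src_nodes R i"
      by (rule E_eps)
    then have "module_of R (fst p) = i" using module_of_eq node_subsets(6) by blast
    then show "t \<in> (\<lambda>q. (p, None, q)) ` entry_states (fst p)"
      using t(1) i unfolding entry_states_def by simp
  qed
  then have "card (eps_from p) \<le> card (entry_states (fst p))"
    using finite_entry_states by (rule surj_card_le[rotated])
  also have "\<dots> \<le> theta_e R * n_marks"
    using assms St_src src_subset_nodes by (intro card_entry_states) blast
  finally show ?thesis .
qed

text \<open>Double counting: the pairs are grouped by the inner node and no longer by the entry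
  state. Bounding each \<open>inner_nodes q\<close> by the size of the RSM would lead to a quadratic
  bound.\<close>

lemma sum_inner_nodes: "(\<Sum>q\<in>St_entries. card (inner_nodes q)) \<le> rsm_size R * (theta_e R * n_marks)"
proof -
  have fin: "finite (all_of nodes R)" by (rule finite_all_of) simp
  have "(\<Sum>q\<in>St_entries. card (inner_nodes q)) = card (Sigma St_entries inner_nodes)"
    using finite_St finite_inner_nodes by simp
  also have "\<dots> \<le> card (Sigma (all_of nodes R) entry_states)"
  proof (rule card_inj_on_le[where f = prod.swap])
    show "prod.swap ` Sigma St_entries inner_nodes \<subseteq> Sigma (all_of nodes R) entry_states"
    proof (intro image_subsetI)
      fix z assume "z \<in> Sigma St_entries inner_nodes"
      then obtain e m u where z: "z = ((e, m), u)"
        and q: "(e, m) \<in> St" "e \<in> all_of En_nodes R" "u \<in> inner_nodes (e, m)" by auto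
      then have i: "module_of R e < length R" "e \<in> En_nodes R (module_of R e)"
        using module_of_En by auto
      have u: "u \<in> nodes R (module_of R e)"
        using q(3) unfolding inner_nodes_def nodes_def by auto
      then have "u \<in> all_of nodes R" using i(1) unfolding all_of_def by blast
      moreover have "(e, m) \<in> entry_states u"
        using q(1) i module_of_eq[OF u i(1)] unfolding entry_states_def by simp
      ultimately show "prod.swap z \<in> Sigma (all_of nodes R) entry_states" using z by simp
    qed
    show "finite (Sigma (all_of nodes R) entry_states)" using fin finite_entry_states by simp
  qed (rule inj_swap)
  also have "\<dots> = (\<Sum>u\<in>all_of nodes R. card (entry_states u))"
    using fin finite_entry_states by simp
  finally show ?thesis using sum_entry_states by linarith
qed

text \<open>The same double counting, with the pairs grouped by the exit node.\<close>

lemma card_exit_pairs: "card exit_pairs \<le> rsm_size R * (theta_e R * n_marks)"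
proof -
  have fin: "finite (all_of nodes R)" by (rule finite_all_of) simp
  have "card exit_pairs \<le> card (Sigma (all_of nodes R) entry_states)"
  proof (rule card_inj_on_le[where f = "\<lambda>(q, x). (Atom x, q)"])
    show "(\<lambda>(q, x). (Atom x, q)) ` exit_pairs \<subseteq> Sigma (all_of nodes R) entry_states"
    proof (intro image_subsetI)
      fix z assume "z \<in> exit_pairs"
      then obtain e m x where z: "z = ((e, m), x)"
        and e: "(e, m) \<in> St" "e \<in> all_of En_nodes R" "x \<in> exits (R ! module_of R e)"
        unfolding exit_pairs_def by auto
      then have i: "module_of R e < length R" "e \<in> En_nodes R (module_of R e)"
        using module_of_En by auto
      have u: "Atom x \<in> nodes R (module_of R e)"
        using e(3) by (simp add: nodes_def Ex_nodes_def)
      then have "Atom x \<in> all_of nodes R" using i(1) unfolding all_of_def by blast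
      moreover have "(e, m) \<in> entry_states (Atom x)"
        using e(1) i module_of_eq[OF u i(1)] unfolding entry_states_def by simp
      ultimately show "(\<lambda>(q, x). (Atom x, q)) z \<in> Sigma (all_of nodes R) entry_states" using z by simp
    qed
    show "finite (Sigma (all_of nodes R) entry_states)" using fin finite_entry_states by simp
  qed (auto simp: inj_on_def)
  also have "\<dots> = (\<Sum>u\<in>all_of nodes R. card (entry_states u))"
    using fin finite_entry_states by simp
  finally show ?thesis using sum_entry_states by linarith
qed

lemma setup_time_le:
  "setup_time \<le> 5 + 4 * rsm_size R + n_marks * (rsm_size R * (4 + 2 * (theta_e R * n_marks))) +
     4 * (n_marks * rsm_size R) + 4 * (rsm_size R * (theta_e R * n_marks)) +
     n_marks * rsm_size R * (2 + 3 * (theta_e R * n_marks))"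
proof -
  have "(\<Sum>u\<in>all_of src_nodes R. 1 + 3) \<le> 4 * rsm_size R" using card_src by simp
  moreover have "(\<Sum>p\<in>Init. 1 + (1 + (\<Sum>v\<in>succs R (fst p). 1 + (1 + (\<Sum>q\<in>entry_states (fst p). 1 + 1)))))
      \<le> n_marks * (rsm_size R * (4 + 2 * (theta_e R * n_marks)))"
  proof -
    have "(\<Sum>p\<in>Init. 1 + (1 + (\<Sum>v\<in>succs R (fst p). 1 + (1 + (\<Sum>q\<in>entry_states (fst p). 1 + 1)))))
        \<le> (\<Sum>p\<in>Init. 2 + (2 + 2 * (theta_e R * n_marks)) * card (succs R (fst p)))"
    proof (rule sum_mono)
      fix p assume "p \<in> Init"
      then have "card (entry_states (fst p)) \<le> theta_e R * n_marks"
        using Init_src src_subset_nodes by (intro card_entry_states) blast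
      then have "card (succs R (fst p)) * (2 + 2 * card (entry_states (fst p)))
          \<le> card (succs R (fst p)) * (2 + 2 * (theta_e R * n_marks))"
        by (intro mult_le_mono2) simp
      moreover have "1 + (1 + (\<Sum>v\<in>succs R (fst p). 1 + (1 + (\<Sum>q\<in>entry_states (fst p). 1 + 1))))
          = 2 + card (succs R (fst p)) * (2 + 2 * card (entry_states (fst p)))"
        by (simp add: algebra_simps)
      ultimately show "1 + (1 + (\<Sum>v\<in>succs R (fst p). 1 + (1 + (\<Sum>q\<in>entry_states (fst p). 1 + 1))))
          \<le> 2 + (2 + 2 * (theta_e R * n_marks)) * card (succs R (fst p))"
        unfolding mult.commute[of _ "card (succs R (fst p))"] by linarith
    qed
    also have "\<dots> \<le> n_marks * (rsm_size R * (2 + (2 + 2 * (theta_e R * n_marks))))"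
      by (rule sum_states_linear[OF Init_subset])
    also have "\<dots> = n_marks * (rsm_size R * (4 + 2 * (theta_e R * n_marks)))"
      by (simp add: distrib_left)
    finally show ?thesis .
  qed
  moreover have "(\<Sum>q\<in>St_entries. 1 + (1 + (\<Sum>u\<in>inner_nodes q. 1 + 1)))
      \<le> 2 * (n_marks * rsm_size R) + 2 * (rsm_size R * (theta_e R * n_marks))"
  proof -
    have "(\<Sum>q\<in>St_entries. 1 + (1 + (\<Sum>u\<in>inner_nodes q. 1 + 1)))
        = (\<Sum>q\<in>St_entries. 2 + 2 * card (inner_nodes q))"
      by (rule sum.cong) simp_all
    also have "\<dots> = 2 * card St_entries + 2 * (\<Sum>q\<in>St_entries. card (inner_nodes q))"
      unfolding sum.distrib sum_distrib_left by simp
    finally show ?thesis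
      using card_states[OF St_entries_subset] sum_inner_nodes by linarith
  qed
  moreover have "(\<Sum>p\<in>Init. 1 + (1 + (\<Sum>t\<in>eps_from p. 1 + 2))) \<le> n_marks * rsm_size R * (2 + 3 * (theta_e R * n_marks))"
  proof -
    have "(\<Sum>p\<in>Init. 1 + (1 + (\<Sum>t\<in>eps_from p. 1 + 2))) \<le> (\<Sum>p\<in>Init. 2 + 3 * (theta_e R * n_marks))"
    proof (rule sum_mono)
      fix p assume "p \<in> Init"
      then show "1 + (1 + (\<Sum>t\<in>eps_from p. 1 + 2)) \<le> 2 + 3 * (theta_e R * n_marks)"
        using card_eps_from[of p] Init_subset by auto
    qed
    also have "\<dots> = card Init * (2 + 3 * (theta_e R * n_marks))" by simp
    also have "\<dots> \<le> n_marks * rsm_size R * (2 + 3 * (theta_e R * n_marks))"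
      by (rule mult_le_mono1[OF card_states[OF Init_subset]])
    finally show ?thesis .
  qed
  moreover have "(\<Sum>q\<in>St_entries. 1 + (1 + (\<Sum>x\<in>exits (R ! module_of R (fst q)). 1 + 1)))
      \<le> 2 * (n_marks * rsm_size R) + 2 * (rsm_size R * (theta_e R * n_marks))"
  proof -
    have pairs: "(\<Sum>q\<in>St_entries. card (exits (R ! module_of R (fst q)))) = card exit_pairs"
      unfolding exit_pairs_def using finite_St finite_exits module_of_En by (subst card_SigmaI) auto
    have "(\<Sum>q\<in>St_entries. 1 + (1 + (\<Sum>x\<in>exits (R ! module_of R (fst q)). 1 + 1)))
        = (\<Sum>q\<in>St_entries. 2 + 2 * card (exits (R ! module_of R (fst q))))"
      by (rule sum.cong) simp_all
    also have "\<dots> = 2 * card St_entries + 2 * (\<Sum>q\<in>St_entries. card (exits (R ! module_of R (fst q))))"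
      unfolding sum.distrib sum_distrib_left by simp
    finally show ?thesis
      using card_states[OF St_entries_subset] card_exit_pairs pairs by linarith
  qed
  ultimately show ?thesis unfolding setup_time_def preprocess_time_def by linarith
qed

section \<open>Total cost of the main loop\<close>

definition eps_edges :: "('b, 'v) edge set" where
  "eps_edges = {t \<in> E. fst (snd t) = None}"

definition box_edges :: "('b, 'v) edge set" where
  "box_edges = {t \<in> E. fst (snd t) \<noteq> None}"

lemma finite_eps_box_edges: "finite eps_edges" "finite box_edges"
  using finite_E by (auto simp: eps_edges_def box_edges_def)

text \<open>Edges are grouped by their source, since the cost depends on its out-degree only. The 21
  is 6 + 15, the two constants of \<open>cost\<close>.\<close>

lemma sum_eps_cost: "(\<Sum>t\<in>eps_edges. cost t) \<le> theta_e R * n_marks * (n_marks * (rsm_size R * 21))"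
proof -
  have union: "eps_edges = (\<Union>p\<in>St. eps_from p)"
    using E_states by (fastforce simp: eps_edges_def eps_from_def)
  have "(\<Sum>t\<in>eps_edges. cost t) = (\<Sum>p\<in>St. \<Sum>t\<in>eps_from p. cost t)"
    unfolding union using finite_St finite_eps_from
    by (intro sum.UNION_disjoint) (auto simp: eps_from_def)
  also have "\<dots> \<le> (\<Sum>p\<in>St. theta_e R * n_marks * (6 + 15 * card (succs R (fst p))))"
  proof (rule sum_mono)
    fix p assume p: "p \<in> St"
    have "(\<Sum>t\<in>eps_from p. cost t) = (\<Sum>t\<in>eps_from p. 6 + 15 * card (succs R (fst p)))"
      by (rule sum.cong) (auto simp: eps_from_def cost_def)
    also have "\<dots> = card (eps_from p) * (6 + 15 * card (succs R (fst p)))" by simp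
    also have "\<dots> \<le> theta_e R * n_marks * (6 + 15 * card (succs R (fst p)))"
      by (rule mult_le_mono1[OF card_eps_from[OF p]])
    finally show "(\<Sum>t\<in>eps_from p. cost t) \<le> theta_e R * n_marks * (6 + 15 * card (succs R (fst p)))" .
  qed
  also have "\<dots> = theta_e R * n_marks * (\<Sum>p\<in>St. 6 + 15 * card (succs R (fst p)))"
    by (rule sum_distrib_left[symmetric])
  also have "\<dots> \<le> theta_e R * n_marks * (n_marks * (rsm_size R * (6 + 15)))"
    by (intro mult_le_mono2 sum_states_linear) simp
  finally show ?thesis by simp
qed

text \<open>The box and the entry at which an edge starts form a call node; together with the source
  mark and the target they determine the edge. This is where the factor for the call nodes comes
  from.\<close>

lemma card_box_edges: "card box_edges \<le> card (all_of Call_nodes R) * (n_marks * (theta_e R * n_marks))"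
proof -
  let ?A = "Sigma (all_of Call_nodes R) (\<lambda>c. insert mh (marks C) \<times> entry_states c)"
  \<comment> \<open>The value at \<open>Atom\<close> is a default; call nodes are always
    \<open>Port\<close>s.\<close>
  let ?f = "\<lambda>(c, m, q). case c of Atom x \<Rightarrow> ((c, m), None, q) | Port b e \<Rightarrow> ((Atom e, m), Some b, q)"
  have fin: "finite (all_of Call_nodes R)" by (rule finite_all_of, rule node_subsets)
  have finA: "finite ?A" using fin card_insert_marks(1) finite_entry_states by auto
  have "box_edges \<subseteq> ?f ` ?A"
  proof
    fix t assume "t \<in> box_edges"
    then obtain p b q where t: "t = (p, Some b, q)" "(p, Some b, q) \<in> E"
      unfolding box_edges_def by (cases t) auto
    from t(2) obtain i where i: "i < length R" "b \<in> boxes (R ! i)"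
      "fst p \<in> En_nodes R (callee (R ! i) b)" "q \<in> St" "fst q \<in> En_nodes R i" "p \<in> St"
      by (rule E_box)
    then obtain e where e: "fst p = Atom e" "e \<in> entries (R ! callee (R ! i) b)"
      by (auto simp: En_nodes_def)
    have call: "Port b e \<in> Call_nodes R i" using i(2) e(2) by (simp add: Call_nodes_def)
    then have "module_of R (Port b e) = i" using module_of_eq i(1) node_subsets(4) by blast
    then have "q \<in> entry_states (Port b e)" using i(4,5) unfolding entry_states_def by simp
    moreover have "snd p \<in> insert mh (marks C)" using i(6) St_subset by auto
    ultimately have "(Port b e, snd p, q) \<in> ?A"
      using call i(1) unfolding all_of_def by blast
    moreover have "t = ?f (Port b e, snd p, q)" using t(1) e(1) by (cases p) simp
    ultimately show "t \<in> ?f ` ?A" by blast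
  qed
  then have "card box_edges \<le> card ?A" using finA by (rule surj_card_le[rotated])
  also have "\<dots> = (\<Sum>c\<in>all_of Call_nodes R. card (insert mh (marks C) \<times> entry_states c))"
    using fin card_insert_marks(1) finite_entry_states by (intro card_SigmaI) auto
  also have "\<dots> \<le> (\<Sum>c\<in>all_of Call_nodes R. n_marks * (theta_e R * n_marks))"
  proof (rule sum_mono)
    fix c assume "c \<in> all_of Call_nodes R"
    then have "c \<in> all_of nodes R" using node_subsets(4) unfolding all_of_def by blast
    from card_entry_states[OF this]
    show "card (insert mh (marks C) \<times> entry_states c) \<le> n_marks * (theta_e R * n_marks)"
      unfolding card_cartesian_product card_insert_marks(2) by (rule mult_le_mono2)
  qed
  finally show ?thesis by simp
qed

text \<open>Each box edge is counted once for every exit of the module of its source, hence at most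
  \<open>theta_x R\<close> times.\<close>

lemma sum_exit_pairs: "(\<Sum>(q, x)\<in>exit_pairs. 4 * card (box_succs q)) \<le> 4 * theta_x R * card box_edges"
proof -
  let ?ex = "\<lambda>q. exits (R ! module_of R (fst q))"
  have fin: "finite St_entries" using finite_St by simp
  have "(\<Sum>(q, x)\<in>exit_pairs. 4 * card (box_succs q)) = (\<Sum>q\<in>St_entries. \<Sum>x\<in>?ex q. 4 * card (box_succs q))"
    unfolding exit_pairs_def using fin finite_exits module_of_En by (subst sum.Sigma) auto
  also have "\<dots> \<le> (\<Sum>q\<in>St_entries. 4 * theta_x R * card (box_succs q))"
  proof (rule sum_mono)
    fix q assume "q \<in> St_entries"
    then have len: "module_of R (fst q) < length R" using module_of_En by blast
    from card_exits_le[OF len]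
    have "card (?ex q) * (4 * card (box_succs q)) \<le> theta_x R * (4 * card (box_succs q))"
      by (rule mult_le_mono1)
    then show "(\<Sum>x\<in>?ex q. 4 * card (box_succs q)) \<le> 4 * theta_x R * card (box_succs q)"
      by (simp add: mult.assoc mult.left_commute)
  qed
  also have "\<dots> = 4 * theta_x R * (\<Sum>q\<in>St_entries. card (box_succs q))"
    by (rule sum_distrib_left[symmetric])
  also have "(\<Sum>q\<in>St_entries. card (box_succs q)) = card (Sigma St_entries box_succs)"
    using fin finite_box_succs by simp
  also have "\<dots> \<le> card box_edges"
  proof (rule card_inj_on_le[where f = "\<lambda>(q, b, q'). (q, Some b, q')"])
    show "(\<lambda>(q, b, q'). (q, Some b, q')) ` Sigma St_entries box_succs \<subseteq> box_edges"
      unfolding box_succs_def box_edges_def by auto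
  qed (auto simp: inj_on_def finite_eps_box_edges)
  finally show ?thesis by simp
qed

text \<open>The 8 is 4 for processing box edges plus 4 for propagating summaries along them.\<close>

lemma potential_bound_le:
  "potential_bound \<le> theta_e R * n_marks * (n_marks * (rsm_size R * 21)) +
     (4 + 8 * theta_x R) * (card (all_of Call_nodes R) * (n_marks * (theta_e R * n_marks)))"
proof -
  have "E = eps_edges \<union> box_edges" "eps_edges \<inter> box_edges = {}"
    by (auto simp: eps_edges_def box_edges_def)
  then have "(\<Sum>t\<in>E. cost t) = (\<Sum>t\<in>eps_edges. cost t) + (\<Sum>t\<in>box_edges. cost t)"
    using finite_eps_box_edges by (simp add: sum.union_disjoint)
  moreover have "(\<Sum>t\<in>box_edges. cost t) = (4 + 4 * theta_x R) * card box_edges"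
  proof -
    have "(\<Sum>t\<in>box_edges. cost t) = (\<Sum>t\<in>box_edges. 4 + 4 * theta_x R)"
      by (rule sum.cong) (auto simp: box_edges_def cost_def)
    then show ?thesis by (simp add: mult.commute)
  qed
  ultimately have "potential_bound \<le> theta_e R * n_marks * (n_marks * (rsm_size R * 21)) +
      (4 + 4 * theta_x R) * card box_edges + 4 * theta_x R * card box_edges"
    unfolding potential_bound_def using sum_eps_cost sum_exit_pairs by linarith
  also have "\<dots> = theta_e R * n_marks * (n_marks * (rsm_size R * 21)) + (4 + 8 * theta_x R) * card box_edges"
    by (simp add: algebra_simps)
  also have "\<dots> \<le> theta_e R * n_marks * (n_marks * (rsm_size R * 21)) +
      (4 + 8 * theta_x R) * (card (all_of Call_nodes R) * (n_marks * (theta_e R * n_marks)))"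
    by (intro add_left_mono mult_le_mono2 card_box_edges)
  finally show ?thesis .
qed

lemma card_Call: "card (all_of Call_nodes R) \<le> rsm_size R"
proof -
  have "all_of Call_nodes R \<subseteq> all_of nodes R" by (rule all_of_mono) (rule node_subsets)
  then have "card (all_of Call_nodes R) \<le> card (all_of nodes R)"
    by (rule card_mono[rotated]) (rule finite_all_of, simp)
  then show ?thesis unfolding rsm_size_def by simp
qed

text \<open>An entry is a node, so the main term is large enough to absorb additive
  constants.\<close>

lemma rsm_size_pos:
  assumes "1 \<le> theta_e R"
  shows "1 \<le> rsm_size R"
proof -
  have ne: "R \<noteq> []" using is_rsm unfolding is_rsm_def by blast
  have "theta_e R \<in> (\<lambda>i. card (En_nodes R i)) ` {..<length R}"
    unfolding theta_e_def using ne by (intro Max_in) auto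
  then obtain i where i: "i < length R" "1 \<le> card (En_nodes R i)" using assms by auto
  then have "card (En_nodes R i) \<le> card (all_of src_nodes R)"
    using finite_src node_subsets(8) unfolding all_of_def by (intro card_mono) blast+
  with i(2) card_src show ?thesis by linarith
qed

lemma time_le:
  fixes \<kappa> :: nat
  assumes "\<kappa> = card (marks C)" "1 \<le> \<kappa>" "1 \<le> theta_e R"
  shows "setup_time + H * potential_bound + 1 \<le> time_const * (H * (rsm_size R * theta_e R * \<kappa> ^ 2
    + card (all_of Call_nodes R) * theta_e R * theta_x R * \<kappa> ^ 3))"
proof -
  let ?N = "rsm_size R" and ?e = "theta_e R" and ?x = "theta_x R" and ?c = "card (all_of Call_nodes R)"
  define B where "B = ?N * ?e * \<kappa> ^ 2"
  define D where "D = ?c * ?e * ?x * \<kappa> ^ 3"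
  \<comment> \<open>Here \<open>1 \<le> \<kappa>\<close> absorbs the fresh mark.\<close>
  have n_marks: "n_marks \<le> 2 * \<kappa>" using assms(1,2) by (simp add: n_marks_def)
  have N: "1 \<le> ?N" using rsm_size_pos assms(3) .
  have kk: "\<kappa> \<le> \<kappa> ^ 2" "\<kappa> ^ 2 \<le> \<kappa> ^ 3" "1 \<le> \<kappa> ^ 2"
    using assms(2) by (simp_all add: power2_eq_square power3_eq_cube)
  have NkB: "?N * \<kappa> \<le> B" and NekB: "?N * (?e * \<kappa>) \<le> B"
  proof -
    have "?N * (1 * \<kappa>) \<le> ?N * (?e * \<kappa> ^ 2)" "?N * (?e * \<kappa>) \<le> ?N * (?e * \<kappa> ^ 2)"
      using kk assms(3) by (intro mult_le_mono; simp)+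
    then show "?N * \<kappa> \<le> B" "?N * (?e * \<kappa>) \<le> B" by (simp_all add: B_def mult.assoc)
  qed
  have NB: "?N \<le> B" using NkB assms(2) by (metis le_trans mult_le_mono2 nat_mult_1_right)
  have b1: "n_marks * ?N \<le> 2 * B"
  proof -
    have "n_marks * ?N \<le> 2 * \<kappa> * ?N" by (rule mult_le_mono1[OF n_marks])
    also have "\<dots> = 2 * (?N * \<kappa>)" by (simp only: mult_ac)
    finally show ?thesis using NkB by linarith
  qed
  have b2: "?N * (?e * n_marks) \<le> 2 * B"
  proof -
    have "?N * ?e * n_marks \<le> ?N * ?e * (2 * \<kappa>)" by (rule mult_le_mono2[OF n_marks])
    also have "\<dots> = 2 * (?N * (?e * \<kappa>))" by (simp only: mult_ac)
    finally show ?thesis using NekB unfolding mult.assoc by linarith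
  qed
  have kk4: "n_marks * n_marks \<le> 4 * \<kappa> ^ 2"
    using mult_le_mono[OF n_marks n_marks] by (simp add: power2_eq_square mult.assoc mult.left_commute)
  have b3: "n_marks * ?N * (?e * n_marks) \<le> 4 * B"
    using mult_le_mono2[OF kk4, of "?N * ?e"] by (simp add: B_def algebra_simps)
  \<comment> \<open>The part of the box edge cost without \<open>theta_x\<close> cannot go into
    \<open>D\<close>, which vanishes if there are no exits; it goes into \<open>B\<close> because
    call nodes are nodes.\<close>
  have b4: "?c * (n_marks * (?e * n_marks)) \<le> 4 * B"
  proof -
    have "?c * (n_marks * (?e * n_marks)) \<le> ?N * (n_marks * (?e * n_marks))"
      by (rule mult_le_mono1[OF card_Call])
    also have "\<dots> = n_marks * ?N * (?e * n_marks)" by (simp only: mult_ac)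
    finally show ?thesis using b3 by linarith
  qed
  have b5: "?x * (?c * (n_marks * (?e * n_marks))) \<le> 4 * D"
  proof -
    have "?x * (?c * (n_marks * (?e * n_marks))) = ?c * ?e * ?x * (n_marks * n_marks)"
      by (simp add: algebra_simps)
    also have "\<dots> \<le> ?c * ?e * ?x * (4 * \<kappa> ^ 3)"
      using kk4 kk(2) by (intro mult_le_mono2) linarith
    finally show ?thesis by (simp add: D_def)
  qed
  have "setup_time \<le> 5 + 4 * ?N + (4 * (n_marks * ?N) + 2 * (n_marks * ?N * (?e * n_marks))) +
     4 * (n_marks * ?N) + 4 * (?N * (?e * n_marks)) + (2 * (n_marks * ?N) + 3 * (n_marks * ?N * (?e * n_marks)))"
    using setup_time_le by (simp add: algebra_simps)
  then have setup_le: "setup_time + 1 \<le> 60 * B"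
    using NB N b1 b2 b3 by linarith
  have "potential_bound \<le> 21 * (n_marks * ?N * (?e * n_marks)) +
      4 * (?c * (n_marks * (?e * n_marks))) + 8 * (?x * (?c * (n_marks * (?e * n_marks))))"
    using potential_bound_le by (simp add: algebra_simps)
  then have "potential_bound \<le> 100 * B + 32 * D" using b3 b4 b5 by linarith
  then have "H * potential_bound \<le> H * (100 * B + 32 * D)" by (rule mult_le_mono2)
  \<comment> \<open>Setup is independent of the height; as \<open>H\<close> is positive, it fits
    under the same factor.\<close>
  moreover have "setup_time + 1 \<le> H * (60 * B)"
  proof -
    have "1 * (60 * B) \<le> H * (60 * B)" by (rule mult_le_mono1) (use height_pos in simp)
    then show ?thesis using setup_le by linarith
  qed
  ultimately have "setup_time + H * potential_bound + 1 \<le> H * (160 * B + 32 * D)"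
    by (simp add: algebra_simps)
  also have "\<dots> \<le> H * (1000 * (B + D))" by (intro mult_le_mono2) simp
  finally show ?thesis by (simp add: time_const_def B_def D_def mult.left_commute)
qed

section \<open>The automaton produced\<close>

lemma is_raut_result:
  assumes "skeleton A" "wt_sound A"
  shows "is_raut R A"
proof -
  have A: "states A = St" "edges A = E" "initial A = Init" "final A = final C"
    using assms(1) unfolding skeleton_def by auto
  have "states A \<subseteq> all_of src_nodes R \<times> UNIV" using St_src unfolding A by auto
  moreover have "final A \<subseteq> states A \<inter> (all_of En_nodes R \<times> UNIV)"
    using final_state unfolding A St_def by (auto simp: mem_Times_iff)
  moreover have "\<forall>(p, a, q)\<in>edges A. p \<in> states A \<and> q \<in> states A \<and>
      (case a of Some b \<Rightarrow> b_edge_ok R p b q | None \<Rightarrow> eps_edge_ok R p q)"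
    unfolding A
  proof (intro ballI, clarify, intro conjI)
    fix u m a e n assume t: "((u, m), a, (e, n)) \<in> E"
    show "(u, m) \<in> St" "(e, n) \<in> St" using E_states[OF t] by auto
    show "case a of Some b \<Rightarrow> b_edge_ok R (u, m) b (e, n) | None \<Rightarrow> eps_edge_ok R (u, m) (e, n)"
    proof (cases a)
      case None
      from t[unfolded None] obtain i where "i < length R" "fst (e, n) \<in> En_nodes R i"
        "fst (u, m) \<in> In_nodes R i \<union> Ret_nodes R i \<or> fst (u, m) = fst (e, n)" by (rule E_eps)
      then show ?thesis unfolding None option.case eps_edge_ok_def by blast
    next
      case (Some b)
      from t[unfolded Some] obtain i where "i < length R" "b \<in> boxes (R ! i)"
        "fst (u, m) \<in> En_nodes R (callee (R ! i) b)" "fst (e, n) \<in> En_nodes R i" by (rule E_box)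
      then show ?thesis unfolding Some option.case b_edge_ok_def by blast
    qed
  qed
  moreover have "\<forall>p\<in>states A. fst p \<in> all_of En_nodes R \<longrightarrow> (p, None, p) \<in> edges A \<and> wt A (p, None, p) = 1"
  proof (intro ballI impI)
    fix p assume p: "p \<in> states A" "fst p \<in> all_of En_nodes R"
    have "(p, None, p) \<in> edges C \<union> loops"
    proof (cases "p \<in> states C")
      case True
      then show ?thesis using self_loop p(2) by blast
    next
      case False
      then have "snd p = mh" using p(1) unfolding A St_def by auto
      then show ?thesis using p(2) unfolding loops_def by (cases p) auto
    qed
    then show "(p, None, p) \<in> edges A \<and> wt A (p, None, p) = 1"
      using assms(2) unfolding wt_sound_def A E_def by blast
  qed
  ultimately show ?thesis
    unfolding is_raut_def using finite_St Init_subset unfolding A by blast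
qed

text \<open>The fresh mark occurs in a state only if there is a source node to carry it, hence the
  second premise.\<close>

lemma marks_result:
  assumes "skeleton A" "all_of src_nodes R \<noteq> {}"
  shows "card (marks A) = card (marks C) + 1"
proof -
  have "marks A = insert mh (marks C)"
    using assms unfolding skeleton_def marks_def St_def by (auto simp: image_Un)
  then show ?thesis using card_insert_marks(2) unfolding n_marks_def by simp
qed

end

text \<open>All claims concern every execution, whatever the order of extraction and traversal. For
  \<open>\<kappa> = 0\<close> or \<open>theta_e R = 0\<close> the time bound would be 0, although
  each execution takes some time; this is why the bound is stated for positive values.\<close>

theorem theorem1:
  fixes R :: "('b, 'v, 'd::idem_semiring) rsm"
    and C :: "('b, 'v, 'd) raut"
    and H \<kappa> mh :: nat
  assumes "semiring_height TYPE('d) H"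
    and "is_rsm R"
    and "is_raut R C"
    and "\<forall>t\<in>edges C. wt C t = 1"
    and "\<kappa> = card (marks C)"
    and "mh \<notin> marks C"
  shows "\<not> conf_dist_diverges R C mh \<and>
    (\<exists>P T. conf_dist R C mh P T) \<and>
    (\<forall>P T. conf_dist R C mh P T \<longrightarrow>
       is_raut R P \<and>
       (all_of src_nodes R \<noteq> {} \<longrightarrow> card (marks P) = \<kappa> + 1) \<and>
       (eps_edges_first C \<longrightarrow>
          (\<forall>c. is_config R c \<longrightarrow> config_dist R (lang R C) c = aut_value P c)) \<and>
       (1 \<le> \<kappa> \<and> 1 \<le> theta_e R \<longrightarrow>
          T \<le> time_const * (H * (rsm_size R * theta_e R * \<kappa> ^ 2
                + card (all_of Call_nodes R) * theta_e R * theta_x R * \<kappa> ^ 3))))"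
proof -
  interpret conf_dist_input R C H mh
    using assms(1-4,6) by unfold_locales
  let ?run = "(conf_dist_setup R mh ;; while (\<lambda>s. wl s \<noteq> {}) (iteration R mh)) (start_store C)"
  show ?thesis
  proof (intro conjI allI impI)
    show "\<not> conf_dist_diverges R C mh" by (rule no_divergence)
    have "?run \<noteq> {}" using conf_dist_spec unfolding spec_def by blast
    then show "\<exists>P T. conf_dist R C mh P T" unfolding conf_dist_def by fast
  next
    fix P T assume "conf_dist R C mh P T"
    then obtain s where s: "(s, T) \<in> ?run" "P = aut s" unfolding conf_dist_def by blast
    then have inv: "inv {} s" "wl s = {}" and T: "T \<le> setup_time + H * potential_bound + 1"
      using conf_dist_spec unfolding spec_def by auto
    have parts: "skeleton (aut s)" "wt_sound (aut s)" "closed {} s"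
      using inv(1) unfolding inv_def by auto
    show "is_raut R P" using is_raut_result parts s(2) by blast
    show "card (marks P) = \<kappa> + 1" if "all_of src_nodes R \<noteq> {}"
      using marks_result[OF parts(1) that] s(2) assms(5) by simp
    show "config_dist R (lang R C) c = aut_value P c" if "eps_edges_first C" for c
      using aut_value_eq_dist[OF parts inv(2) that] s(2) by simp
    show "T \<le> time_const * (H * (rsm_size R * theta_e R * \<kappa> ^ 2
        + card (all_of Call_nodes R) * theta_e R * theta_x R * \<kappa> ^ 3))"
      if "1 \<le> \<kappa> \<and> 1 \<le> theta_e R"
      using T time_le[OF assms(5)] that by linarith
  qed
qed

end
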